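(* Let $R\subset S$ be an integral FCP extension of commutative rings. Set $T:=\bigcap\{U\in[R,S]\mid U\subseteq S\text{ is subintegral}\}$. Then the following conditions are equivalent: (1) the co-subintegral closure of $R\subset S$ exists; (2) $T\subseteq S$ is subintegral; (3) $T\subseteq S$ is catenarian. If these conditions hold, then $T$ is the co-subintegral closure of $R\subset S$.
   Context: All rings are commutative and unital; $\subset$ denotes proper inclusion. $[R,S]$ is the set of all $R$-subalgebras of $S$, ordered by inclusion; $R\subseteq S$ has FCP if each chain in $[R,S]$ is finite. An FCP extension $T\subseteq S$ is catenarian if all maximal chains of $[T,S]$ have the same length. An integral extension $U\subseteq S$ is subintegral if $\mathrm{Spec}(S)\to\mathrm{Spec}(U)$ is injective and all the residual field extensions $\kappa_U(Q\cap U)\to\kappa_S(Q)$ ($Q\in\mathrm{Spec}(S)$) are isomorphisms. The co-subintegral closure of $R\subseteq S$, if it exists, is the least $V\in[R,S]$ such that $V\subseteq S$ is subintegral. *)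

theory Defs
  imports "HOL-Algebra.Polynomials"
begin

text \<open>
  Throughout, a ring extension \<open>U \<subseteq> S\<close> is given by the ambient ring \<open>S\<close> and the carrier set \<open>U\<close>
  of a unital subring, the ring \<open>U\<close> itself being \<open>S\<lparr>carrier := U\<rparr>\<close>.
\<close>

definition intermediate_rings :: "'a set \<Rightarrow> ('a, 'b) ring_scheme \<Rightarrow> 'a set set"
  where "intermediate_rings R S = {U. subring U S \<and> R \<subseteq> U}"

definition FCP :: "'a set \<Rightarrow> ('a, 'b) ring_scheme \<Rightarrow> bool"
  where "FCP R S \<longleftrightarrow> (\<forall>C. subset.chain (intermediate_rings R S) C \<longrightarrow> finite C)"

text \<open>A chain with \<open>n + 1\<close> elements has length \<open>n\<close>; maximal chains are never empty.\<close>

definition catenarian :: "'a set \<Rightarrow> ('a, 'b) ring_scheme \<Rightarrow> bool"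
  where "catenarian R S \<longleftrightarrow> FCP R S \<and>
    (\<forall>C D. subset.maxchain (intermediate_rings R S) C \<longrightarrow>
           subset.maxchain (intermediate_rings R S) D \<longrightarrow> card C - 1 = card D - 1)"

text \<open>
  Polynomials are coefficient lists with the leading coefficient first, so \<open>\<one> # cs\<close> with
  \<open>set cs \<subseteq> U\<close> is an arbitrary monic polynomial over \<open>U\<close>.
\<close>

definition integral_extension :: "'a set \<Rightarrow> ('a, 'b) ring_scheme \<Rightarrow> bool"
  where "integral_extension U S \<longleftrightarrow> subring U S \<and>
    (\<forall>x \<in> carrier S. \<exists>cs. set cs \<subseteq> U \<and> ring.eval S (\<one>\<^bsub>S\<^esub> # cs) x = \<zero>\<^bsub>S\<^esub>)"

definition Spec :: "('a, 'b) ring_scheme \<Rightarrow> 'a set set"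
  where "Spec A = {P. primeideal P A}"

definition frac_rel :: "('a, 'b) ring_scheme \<Rightarrow> (('a \<times> 'a) \<times> ('a \<times> 'a)) set"
  where "frac_rel D = {((a, s), (b, t)).
    a \<in> carrier D \<and> s \<in> carrier D - {\<zero>\<^bsub>D\<^esub>} \<and> b \<in> carrier D \<and> t \<in> carrier D - {\<zero>\<^bsub>D\<^esub>} \<and>
    a \<otimes>\<^bsub>D\<^esub> t = b \<otimes>\<^bsub>D\<^esub> s}"

definition fraction :: "('a, 'b) ring_scheme \<Rightarrow> 'a \<Rightarrow> 'a \<Rightarrow> ('a \<times> 'a) set"
  where "fraction D a s = frac_rel D `` {(a, s)}"

text \<open>
  The field of fractions of a domain \<open>D\<close>. In the unions all sets are equal, since the results do
  not depend on the chosen representatives.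
\<close>

definition frac_field :: "('a, 'b) ring_scheme \<Rightarrow> ('a \<times> 'a) set ring"
  where "frac_field D =
    \<lparr>carrier = (carrier D \<times> (carrier D - {\<zero>\<^bsub>D\<^esub>})) // frac_rel D,
     mult = (\<lambda>F G. \<Union>(a, s)\<in>F. \<Union>(b, t)\<in>G. fraction D (a \<otimes>\<^bsub>D\<^esub> b) (s \<otimes>\<^bsub>D\<^esub> t)),
     one = fraction D \<one>\<^bsub>D\<^esub> \<one>\<^bsub>D\<^esub>,
     zero = fraction D \<zero>\<^bsub>D\<^esub> \<one>\<^bsub>D\<^esub>,
     add = (\<lambda>F G. \<Union>(a, s)\<in>F. \<Union>(b, t)\<in>G.
              fraction D (a \<otimes>\<^bsub>D\<^esub> t \<oplus>\<^bsub>D\<^esub> b \<otimes>\<^bsub>D\<^esub> s) (s \<otimes>\<^bsub>D\<^esub> t))\<rparr>"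

definition residue_field :: "('a, 'b) ring_scheme \<Rightarrow> 'a set \<Rightarrow> ('a set \<times> 'a set) set ring"
  where "residue_field A P = frac_field (A Quot P)"

text \<open>
  The canonical map from the residue field of \<open>U\<close> at \<open>Q \<inter> U\<close> to that of \<open>S\<close> at \<open>Q\<close>. For a coset
  \<open>A = (Q \<inter> U) + u\<close> the set \<open>Q <+> A\<close> is the coset \<open>Q + u\<close>, so \<open>A \<mapsto> Q <+> A\<close> is the induced
  map \<open>U / (Q \<inter> U) \<rightarrow> S / Q\<close>; it is then extended to fractions.
\<close>

definition residual_map ::
    "('a, 'b) ring_scheme \<Rightarrow> 'a set \<Rightarrow> ('a set \<times> 'a set) set \<Rightarrow> ('a set \<times> 'a set) set"
  where "residual_map S Q F =
    (\<Union>(A, B)\<in>F. fraction (S Quot Q) (Q <+>\<^bsub>S\<^esub> A) (Q <+>\<^bsub>S\<^esub> B))"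

definition subintegral_extension :: "'a set \<Rightarrow> ('a, 'b) ring_scheme \<Rightarrow> bool"
  where "subintegral_extension U S \<longleftrightarrow> integral_extension U S \<and>
    inj_on (\<lambda>Q. Q \<inter> U) (Spec S) \<and>
    (\<forall>Q \<in> Spec S. residual_map S Q \<in>
       ring_iso (residue_field (S\<lparr>carrier := U\<rparr>) (Q \<inter> U)) (residue_field S Q))"

definition is_cosubintegral_closure :: "'a set \<Rightarrow> 'a set \<Rightarrow> ('a, 'b) ring_scheme \<Rightarrow> bool"
  where "is_cosubintegral_closure V R S \<longleftrightarrow>
    V \<in> intermediate_rings R S \<and> subintegral_extension V S \<and>
    (\<forall>W \<in> intermediate_rings R S. subintegral_extension W S \<longrightarrow> V \<subseteq> W)"

end

theory Submission
  imports Defs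
begin

text \<open>
  Throughout, \<open>T\<close> is a subring, and \<open>A \<subset> B\<close> is a minimal extension of rings containing \<open>T\<close>.

  If \<open>A \<subseteq> B\<close> is integral and subintegral, then it is ramified: by Nakayama the conductor is a maximal
  ideal of \<open>A\<close>, and the only prime \<open>Q\<close> of \<open>B\<close> above it satisfies \<open>B = A + Q\<close> and \<open>Q Q \<subseteq> A\<close>.
  If moreover \<open>T \<subseteq> B\<close> is subintegral, then also \<open>B = T + Q\<close>, whence \<open>B / A\<close> is a simple \<open>T\<close>-module.
  Therefore \<open>T \<subseteq> S\<close> subintegral makes the lattice of intermediate rings lower semimodular, and so
  all its maximal chains have the same length.

  Conversely, let \<open>T \<subseteq> S\<close> be catenarian, let \<open>U \<subset> Y\<close> and \<open>V \<subset> Y\<close> be distinct ramified minimal extensions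
  with primes \<open>P\<close> and \<open>Q\<close>, and put \<open>W = U \<inter> V\<close>. Unless \<open>P = Q\<close> and \<open>Q \<inter> U = Q \<inter> V\<close>, both \<open>W \<subset> U\<close> and
  \<open>W \<subset> V\<close> are again minimal and subintegral. In the exceptional case \<open>A \<mapsto> A + Q\<close> is strictly monotone
  from \<open>[W, U]\<close> to \<open>[W + Q, Y]\<close>, and for \<open>q \<in> Q - U\<close> the ring \<open>W + W q\<close> lies strictly between \<open>W\<close> and
  \<open>W + Q\<close>; so some chain from \<open>W\<close> to \<open>Y\<close> is longer than one through \<open>U\<close>, which is impossible.
  This diamond property shows that the rings over which \<open>S\<close> is subintegral are closed under binary
  intersection, and by FCP a minimal one among them is the least one.
\<close>

section \<open>Families of sets with finite chains\<close>

text \<open>The obstacle is that the rings over which \<open>S\<close> is subintegral need not be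
  closed under intersection. Take a field \<open>K\<close> of characteristic p with a derivation
  \<open>d \<noteq> 0\<close>, finite over its field \<open>W\<close> of constants, and
  \<open>Y = K[x]/(x^2)\<close>. Then \<open>U = K\<close> and \<open>V = {a + d(a) x}\<close> are
  distinct, both \<open>U \<subset> Y\<close> and \<open>V \<subset> Y\<close> are ramified with the
  same prime \<open>Q = (x)\<close>, and \<open>Q \<inter> U = Q \<inter> V = 0\<close>, but
  \<open>U \<inter> V = W\<close> has a smaller residue field. Only to exclude this situation is the
  equality of chain lengths used: it supplies a rank that grows by exactly one along each minimal
  extension, and \<open>W \<subset> W + W q \<subset> W + Q\<close> costs one rank more than the
  last step \<open>U \<subset> Y\<close> allows. Everything takes place in subsets of one ambient
  ring, without localisation: primes, residue fields and finite modules are expressed by equations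
  between elements. Lengths of maximal chains are handled as exponents n in
  \<open>covers F ^^ n\<close>, which can be concatenated and compared by induction.\<close>

definition covers :: "'a set set \<Rightarrow> ('a set \<times> 'a set) set"
  where "covers F = {(A, B). A \<in> F \<and> B \<in> F \<and> A \<subset> B \<and> (\<forall>C \<in> F. A \<subset> C \<longrightarrow> C \<subseteq> B \<longrightarrow> C = B)}"

lemma coversD:
  assumes "(A, B) \<in> covers F"
  shows "A \<in> F" "B \<in> F" "A \<subset> B" "\<And>C. C \<in> F \<Longrightarrow> A \<subset> C \<Longrightarrow> C \<subseteq> B \<Longrightarrow> C = B"
  using assms by (auto simp: covers_def)

lemma covers_pow_mem:
  "(A, B) \<in> covers F ^^ n \<Longrightarrow> A \<in> F \<Longrightarrow> B \<in> F \<and> A \<subseteq> B"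
  by (induction n arbitrary: B) (auto dest: coversD)

locale finite_chains =
  fixes F :: "'a set set"
  assumes finite_chain: "subset.chain F C \<Longrightarrow> finite C"
begin

text \<open>The range of such a sequence would be an infinite chain. Both directions are treated at
  once, so that strict inclusion and its converse are both well-founded on \<open>F\<close>.\<close>

lemma no_strict_mono_seq:
  fixes f :: "nat \<Rightarrow> 'a set"
  assumes "\<And>i. f i \<in> F" and "(\<forall>i. f (Suc i) \<subset> f i) \<or> (\<forall>i. f i \<subset> f (Suc i))"
  shows False
proof -
  have "(\<forall>i j. i < j \<longrightarrow> f j \<subset> f i) \<or> (\<forall>i j. i < j \<longrightarrow> f i \<subset> f j)"
    using assms(2)
  proof
    assume a: "\<forall>i. f (Suc i) \<subset> f i"
    have "f j \<subset> f i" if "i < j" for i j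
      using that by (induction rule: strict_inc_induct) (use a in blast)+
    then show ?thesis by blast
  next
    assume a: "\<forall>i. f i \<subset> f (Suc i)"
    have "f i \<subset> f j" if "i < j" for i j
      using that by (induction rule: strict_inc_induct) (use a in blast)+
    then show ?thesis by blast
  qed
  then have neq: "f i \<subset> f j \<or> f j \<subset> f i" if "i \<noteq> j" for i j
    using that by (metis linorder_neqE_nat)
  then have "inj f"
    by (auto intro!: injI)
  moreover have "subset.chain F (range f)"
    unfolding subset_chain_def
  proof (intro conjI ballI)
    show "range f \<subseteq> F" using assms(1) by blast
    fix A B assume "A \<in> range f" "B \<in> range f"
    then obtain i j where "A = f i" "B = f j" by blast
    then show "A \<subseteq> B \<or> B \<subseteq> A" using neq[of i j] by (cases "i = j") auto
  qed
  ultimately show False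
    using finite_chain finite_imageD infinite_UNIV_nat by blast
qed

lemma wf_psubset: "wf {(A, B). A \<in> F \<and> B \<in> F \<and> A \<subset> B}"
proof (unfold wf_iff_no_infinite_down_chain, safe)
  fix f assume "\<forall>i. (f (Suc i), f i) \<in> {(A, B). A \<in> F \<and> B \<in> F \<and> A \<subset> B}"
  then show False
    using no_strict_mono_seq[of f] by auto
qed

lemma wf_psupset: "wf {(A, B). A \<in> F \<and> B \<in> F \<and> B \<subset> A}"
proof (unfold wf_iff_no_infinite_down_chain, safe)
  fix f assume "\<forall>i. (f (Suc i), f i) \<in> {(A, B). A \<in> F \<and> B \<in> F \<and> B \<subset> A}"
  then show False
    using no_strict_mono_seq[of f] by auto
qed

lemma exists_minimal:
  assumes "G \<subseteq> F" and "G \<noteq> {}"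
  shows "\<exists>M \<in> G. \<forall>A \<in> G. \<not> A \<subset> M"
proof -
  obtain E where "E \<in> G" using assms(2) by blast
  then obtain M where "M \<in> G" "\<And>A. A \<in> F \<Longrightarrow> M \<in> F \<Longrightarrow> A \<subset> M \<Longrightarrow> A \<notin> G"
    by (rule wfE_min[OF wf_psubset]) auto
  then show ?thesis using assms(1) by blast
qed

lemma exists_maximal:
  assumes "G \<subseteq> F" and "G \<noteq> {}"
  shows "\<exists>M \<in> G. \<forall>A \<in> G. \<not> M \<subset> A"
proof -
  obtain E where "E \<in> G" using assms(2) by blast
  then obtain M where "M \<in> G" "\<And>A. A \<in> F \<Longrightarrow> M \<in> F \<Longrightarrow> M \<subset> A \<Longrightarrow> A \<notin> G"
    by (rule wfE_min[OF wf_psupset]) auto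
  then show ?thesis using assms(1) by blast
qed

lemma exists_lower_cover:
  assumes "A \<in> F" and "B \<in> F" and "A \<subset> B"
  obtains C where "A \<subseteq> C" and "(C, B) \<in> covers F"
proof -
  have "{C \<in> F. A \<subseteq> C \<and> C \<subset> B} \<noteq> {}" using assms by blast
  then obtain M where M: "M \<in> {C \<in> F. A \<subseteq> C \<and> C \<subset> B}"
    and max: "\<And>A'. A' \<in> {C \<in> F. A \<subseteq> C \<and> C \<subset> B} \<Longrightarrow> \<not> M \<subset> A'"
    using exists_maximal[of "{C \<in> F. A \<subseteq> C \<and> C \<subset> B}"] by auto
  have "(M, B) \<in> covers F"
    unfolding covers_def using M max assms by blast
  then show thesis using M that by blast
qed

lemma exists_covers_pow:
  assumes "A \<in> F" and "B \<in> F" and "A \<subseteq> B"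
  shows "\<exists>n. (A, B) \<in> covers F ^^ n"
  using assms(2,3)
proof (induction B rule: wf_induct_rule[OF wf_psubset])
  case (1 B)
  show ?case
  proof (cases "A = B")
    case True
    then have "(A, B) \<in> covers F ^^ 0" by simp
    then show ?thesis by blast
  next
    case False
    then obtain C where C: "A \<subseteq> C" "(C, B) \<in> covers F"
      using exists_lower_cover[OF assms(1) 1(2)] 1(3) by blast
    then obtain n where "(A, C) \<in> covers F ^^ n"
      using 1(1)[of C] coversD[OF C(2)] by blast
    then have "(A, B) \<in> covers F ^^ Suc n" using C(2) by auto
    then show ?thesis by blast
  qed
qed

end

section \<open>Maximal chains as paths of covering steps, and rank functions\<close>

locale bounded_finite_chains = finite_chains F for F :: "'a set set" +
  fixes bot top :: "'a set"
  assumes bot_mem: "bot \<in> F" and top_mem: "top \<in> F"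
    and bot_le: "A \<in> F \<Longrightarrow> bot \<subseteq> A" and le_top: "A \<in> F \<Longrightarrow> A \<subseteq> top"
begin

lemma maxchain_mem:
  assumes "subset.maxchain F C" and "A \<in> F" and "\<And>B. B \<in> C \<Longrightarrow> A \<subseteq> B \<or> B \<subseteq> A"
  shows "A \<in> C"
proof (rule ccontr)
  assume "A \<notin> C"
  have "subset.chain F (insert A C)"
    using assms unfolding subset.maxchain_def subset_chain_def by blast
  moreover have "C \<subset> insert A C" using \<open>A \<notin> C\<close> by blast
  ultimately show False
    using assms(1) unfolding subset.maxchain_def by blast
qed

text \<open>Consecutive members of a maximal chain cover each other in \<open>F\<close>, because a
  set strictly between them would be comparable with the whole chain and could be added. Each member
  is reached from \<open>bot\<close> in as many steps as there are members below it.\<close>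

lemma maxchain_imp_covers_pow:
  assumes C: "subset.maxchain F C"
  shows "(bot, top) \<in> covers F ^^ (card C - 1)"
proof -
  have ch: "subset.chain F C" using C by (simp add: subset.maxchain_def)
  then have CF: "C \<subseteq> F" and tot: "\<And>A B. A \<in> C \<Longrightarrow> B \<in> C \<Longrightarrow> A \<subseteq> B \<or> B \<subseteq> A"
    by (auto simp: subset_chain_def)
  have fin: "finite C" using finite_chain[OF ch] .
  have *: "Y \<in> C \<Longrightarrow> (bot, Y) \<in> covers F ^^ card {Z \<in> C. Z \<subset> Y}" for Y
  proof (induction Y rule: wf_induct_rule[OF wf_psubset])
    case (1 Y)
    show ?case
    proof (cases "Y = bot")
      case True
      then have "{Z \<in> C. Z \<subset> Y} = {}" using bot_le CF by blast
      then have "card {Z \<in> C. Z \<subset> Y} = 0" by (simp only: card.empty)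
      then show ?thesis using True by (simp only: relpow.simps) simp
    next
      case False
      have "bot \<in> C" using maxchain_mem[OF C bot_mem] bot_le CF by blast
      then have "bot \<in> {Z \<in> C. Z \<subset> Y}" using False bot_le CF 1 by blast
      then have "{Z \<in> C. Z \<subset> Y} \<noteq> {}" by blast
      moreover have "{Z \<in> C. Z \<subset> Y} \<subseteq> F" using CF by blast
      ultimately obtain M where "M \<in> {Z \<in> C. Z \<subset> Y}" and "\<forall>A \<in> {Z \<in> C. Z \<subset> Y}. \<not> M \<subset> A"
        using exists_maximal by meson
      then have M: "M \<in> C" "M \<subset> Y" and max: "\<And>A. A \<in> C \<Longrightarrow> A \<subset> Y \<Longrightarrow> \<not> M \<subset> A"
        by simp_all
      have "D = Y" if D: "D \<in> F" "M \<subset> D" "D \<subseteq> Y" for D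
      proof (rule ccontr)
        assume "D \<noteq> Y"
        have "D \<subseteq> B \<or> B \<subseteq> D" if "B \<in> C" for B
          using tot[OF that 1(2)] tot[OF that M(1)] max[OF that] D by blast
        then have "D \<in> C" using maxchain_mem[OF C D(1)] by blast
        then show False using max[of D] D \<open>D \<noteq> Y\<close> by blast
      qed
      then have cov: "(M, Y) \<in> covers F"
        using M 1(2) CF unfolding covers_def by blast
      have eq: "{Z \<in> C. Z \<subset> Y} = insert M {Z \<in> C. Z \<subset> M}"
      proof (intro equalityI subsetI)
        fix Z assume "Z \<in> {Z \<in> C. Z \<subset> Y}"
        then show "Z \<in> insert M {Z \<in> C. Z \<subset> M}"
          using tot[OF M(1), of Z] max[of Z] by auto
      qed (use M in auto)
      have "card {Z \<in> C. Z \<subset> Y} = Suc (card {Z \<in> C. Z \<subset> M})"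
        unfolding eq using fin by simp
      moreover have "(bot, M) \<in> covers F ^^ card {Z \<in> C. Z \<subset> M}"
        using 1(1)[of M] M 1(2) CF by blast
      ultimately show ?thesis using cov by (simp only: relpow.simps) (rule relcompI)
    qed
  qed
  have top: "top \<in> C" using maxchain_mem[OF C top_mem] le_top CF by blast
  have "{Z \<in> C. Z \<subset> top} = C - {top}" using le_top CF by blast
  then have "card {Z \<in> C. Z \<subset> top} = card C - 1" using top by simp
  then show ?thesis using *[OF top] by simp
qed

lemma covers_pow_imp_maxchain:
  assumes "(bot, top) \<in> covers F ^^ n"
  shows "\<exists>C. subset.maxchain F C \<and> card C = Suc n"
proof -
  \<comment> \<open>\<open>sat Y k C\<close> says that \<open>C\<close> is a maximal chain of the
    part of \<open>F\<close> below \<open>Y\<close>, with \<open>k + 1\<close> members. Maximality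
    is spelled out as containing every comparable set, the form that survives adding a new
    top.\<close>
  define sat where "sat Y k C \<longleftrightarrow> C \<subseteq> F \<and> finite C \<and> card C = Suc k \<and> Y \<in> C \<and>
      (\<forall>A \<in> C. A \<subseteq> Y) \<and> (\<forall>A \<in> C. \<forall>B \<in> C. A \<subseteq> B \<or> B \<subseteq> A) \<and>
      (\<forall>Z \<in> F. Z \<subseteq> Y \<longrightarrow> (\<forall>A \<in> C. A \<subseteq> Z \<or> Z \<subseteq> A) \<longrightarrow> Z \<in> C)" for Y k C
  have "\<exists>C. sat Y n C" if "(bot, Y) \<in> covers F ^^ n" for Y
    using that
  proof (induction n arbitrary: Y)
    case 0
    then have "Y = bot" by simp
    then have "sat Y 0 {bot}" using bot_mem bot_le unfolding sat_def by auto
    then show ?case by blast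
  next
    case (Suc n)
    then obtain E where E: "(bot, E) \<in> covers F ^^ n" "(E, Y) \<in> covers F" by auto
    obtain C where "sat E n C" using Suc.IH[OF E(1)] by blast
    then have C: "C \<subseteq> F" "finite C" "card C = Suc n" "E \<in> C" "\<And>A. A \<in> C \<Longrightarrow> A \<subseteq> E"
      "\<And>A B. A \<in> C \<Longrightarrow> B \<in> C \<Longrightarrow> A \<subseteq> B \<or> B \<subseteq> A"
      "\<And>Z. Z \<in> F \<Longrightarrow> Z \<subseteq> E \<Longrightarrow> \<forall>A \<in> C. A \<subseteq> Z \<or> Z \<subseteq> A \<Longrightarrow> Z \<in> C"
      unfolding sat_def by simp_all
    note cov = coversD[OF E(2)]
    have "Y \<notin> C" using C(5)[of Y] cov(3) by blast
    then have "card (insert Y C) = Suc (Suc n)" using C(2,3) by simp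
    moreover have "Z \<in> insert Y C"
      if "Z \<in> F" "Z \<subseteq> Y" and cmp: "\<forall>A \<in> insert Y C. A \<subseteq> Z \<or> Z \<subseteq> A" for Z
    proof (cases "Z \<subseteq> E")
      case True
      then show ?thesis using C(7)[OF that(1)] cmp by simp
    next
      case False
      then have "E \<subset> Z" using cmp C(4) by auto
      then show ?thesis using cov(4)[OF that(1)] that(2) by simp
    qed
    moreover have "A \<subseteq> Y" if "A \<in> insert Y C" for A
      using that C(5)[of A] cov(3) by auto
    moreover have "A \<subseteq> B \<or> B \<subseteq> A" if "A \<in> insert Y C" "B \<in> insert Y C" for A B
      using that C(5)[of A] C(5)[of B] C(6)[of A B] cov(3) by auto
    ultimately have "sat Y (Suc n) (insert Y C)"
      unfolding sat_def using C(1,2) cov(2) by simp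
    then show ?case by blast
  qed
  from this[OF assms] obtain C where "sat top n C" by blast
  then have C: "C \<subseteq> F" "card C = Suc n"
      "\<And>A B. A \<in> C \<Longrightarrow> B \<in> C \<Longrightarrow> A \<subseteq> B \<or> B \<subseteq> A"
      "\<And>Z. Z \<in> F \<Longrightarrow> Z \<subseteq> top \<Longrightarrow> \<forall>A \<in> C. A \<subseteq> Z \<or> Z \<subseteq> A \<Longrightarrow> Z \<in> C"
    unfolding sat_def by simp_all
  have "subset.maxchain F C"
    unfolding subset.maxchain_def
  proof (intro conjI notI)
    show "subset.chain F C" using C(1,3) by (simp add: subset_chain_def)
    assume "\<exists>D. subset.chain F D \<and> C \<subset> D"
    then obtain D where D: "subset.chain F D" "C \<subset> D" by blast
    then obtain Z where Z: "Z \<in> D" "Z \<notin> C" by blast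
    then have "Z \<in> F" "\<forall>A \<in> C. A \<subseteq> Z \<or> Z \<subseteq> A"
      using D unfolding subset_chain_def by blast+
    then show False using C(4) le_top Z(2) by blast
  qed
  then show ?thesis using C(2) by blast
qed

lemma maxchains_equicardinal_iff:
  "(\<forall>C D. subset.maxchain F C \<longrightarrow> subset.maxchain F D \<longrightarrow> card C - 1 = card D - 1) \<longleftrightarrow>
   (\<forall>m n. (bot, top) \<in> covers F ^^ m \<longrightarrow> (bot, top) \<in> covers F ^^ n \<longrightarrow> m = n)"
  (is "?L \<longleftrightarrow> ?R")
proof
  assume L: ?L
  show ?R
  proof (intro allI impI)
    fix m n assume "(bot, top) \<in> covers F ^^ m" "(bot, top) \<in> covers F ^^ n"
    then obtain C D where "subset.maxchain F C" "card C = Suc m"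
      "subset.maxchain F D" "card D = Suc n"
      using covers_pow_imp_maxchain by blast
    then show "m = n" using L by (metis diff_Suc_1)
  qed
qed (use maxchain_imp_covers_pow in blast)

text \<open>\<open>h A\<close> is the length of an arbitrarily chosen path of covers from
  \<open>bot\<close> to \<open>A\<close>. Prolonging two paths to \<open>B\<close> by the same path
  from \<open>B\<close> to \<open>top\<close> shows that the choice does not affect the
  length.\<close>

lemma exists_rank:
  assumes "\<And>m n. (bot, top) \<in> covers F ^^ m \<Longrightarrow> (bot, top) \<in> covers F ^^ n \<Longrightarrow> m = n"
  obtains h :: "'a set \<Rightarrow> nat" where "\<And>A B. (A, B) \<in> covers F \<Longrightarrow> h B = Suc (h A)"
proof
  define h where "h A = (SOME n. (bot, A) \<in> covers F ^^ n)" for A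
  have h: "(bot, A) \<in> covers F ^^ h A" if "A \<in> F" for A
    unfolding h_def using exists_covers_pow[OF bot_mem that bot_le[OF that]] by (rule someI_ex)
  fix A B assume cov: "(A, B) \<in> covers F"
  have A: "A \<in> F" and B: "B \<in> F" using coversD[OF cov] by auto
  obtain k where k: "(B, top) \<in> covers F ^^ k"
    using exists_covers_pow[OF B top_mem le_top[OF B]] by blast
  have "(bot, B) \<in> covers F ^^ Suc (h A)" using h[OF A] cov by auto
  then have "(bot, top) \<in> covers F ^^ (Suc (h A) + k)"
    using k by (metis relpow_add relcomp.relcompI)
  moreover have "(bot, top) \<in> covers F ^^ (h B + k)"
    using k h[OF B] by (metis relpow_add relcomp.relcompI)
  ultimately show "h B = Suc (h A)" using assms by fastforce
qed

text \<open>A Jordan-Hoelder induction on the last steps: two paths that end through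
  \<open>U\<close> and through \<open>V\<close> are both compared with a path through
  \<open>U \<inter> V\<close>, which lies one step below each.\<close>

lemma covers_pow_length_unique:
  assumes semimod: "\<And>U V E. (U, E) \<in> covers F \<Longrightarrow> (V, E) \<in> covers F \<Longrightarrow> U \<noteq> V \<Longrightarrow>
      (U \<inter> V, U) \<in> covers F \<and> (U \<inter> V, V) \<in> covers F"
    and "(bot, E) \<in> covers F ^^ m" and "(bot, E) \<in> covers F ^^ n"
  shows "m = n"
  using assms(2,3)
proof (induction m arbitrary: n E)
  case 0
  then have E: "E = bot" by simp
  show ?case
  proof (cases n)
    case (Suc k)
    then obtain Y where "(bot, Y) \<in> covers F ^^ k" "(Y, E) \<in> covers F" using 0 by auto
    then show ?thesis using E coversD[of Y E F] bot_le by blast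
  qed simp
next
  case (Suc m)
  then obtain U where U: "(bot, U) \<in> covers F ^^ m" "(U, E) \<in> covers F" by auto
  show ?case
  proof (cases n)
    case 0
    then show ?thesis using Suc.prems(2) U coversD[of U E F] bot_le by auto
  next
    case (Suc k)
    then obtain V where V: "(bot, V) \<in> covers F ^^ k" "(V, E) \<in> covers F" using Suc.prems by auto
    have "m = k"
    proof (cases "U = V")
      case True
      then show ?thesis using Suc.IH U V by blast
    next
      case False
      then have W: "(U \<inter> V, U) \<in> covers F" "(U \<inter> V, V) \<in> covers F"
        using semimod U V by blast+
      then obtain j where j: "(bot, U \<inter> V) \<in> covers F ^^ j"
        using exists_covers_pow bot_mem bot_le coversD(1) by metis
      then have "(bot, U) \<in> covers F ^^ Suc j" "(bot, V) \<in> covers F ^^ Suc j"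
        using W by auto
      \<comment> \<open>The induction hypothesis at \<open>U\<close> gives \<open>m = Suc j\<close>;
        this makes it applicable at \<open>V\<close>, where it gives
        \<open>Suc j = k\<close>.\<close>
      then show ?thesis using Suc.IH U V by blast
    qed
    then show ?thesis using Suc by simp
  qed
qed

end

text \<open>Confluence of a rewriting relation by tiling with diamonds. The common reduct is
  prescribed to be the intersection, so the tiles fit together by associativity; the reflexive
  closure admits tiles with a degenerate side.\<close>

lemma Int_confluence:
  assumes sub: "\<And>Y U. (Y, U) \<in> r \<Longrightarrow> U \<subset> Y"
    and diamond: "\<And>Y U V. (Y, U) \<in> r \<Longrightarrow> (Y, V) \<in> r \<Longrightarrow> (U, U \<inter> V) \<in> r\<^sup>= \<and> (V, U \<inter> V) \<in> r\<^sup>="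
    and YU: "(Y, U) \<in> r\<^sup>*" and YV: "(Y, V) \<in> r\<^sup>*"
  shows "(U, U \<inter> V) \<in> r\<^sup>*"
proof -
  have diamond': "(U, U \<inter> V) \<in> r\<^sup>= \<and> (V, U \<inter> V) \<in> r\<^sup>=" if "(Y, U) \<in> r\<^sup>=" "(Y, V) \<in> r" for Y U V
  proof (cases "Y = U")
    case True
    then have "U \<inter> V = V" using sub[OF that(2)] by blast
    then show ?thesis using that(2) True by simp
  next
    case False
    then show ?thesis using that diamond by blast
  qed
  have le: "U \<subseteq> Y" if "(Y, U) \<in> r\<^sup>*" for Y U
    using that by (induction rule: rtrancl_induct) (use sub in blast)+
  \<comment> \<open>One step against a path. The side opposite to the step keeps length at most one,
    so that the induction can apply \<open>diamond'\<close> again.\<close>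
  have strip: "(V, U \<inter> V) \<in> r\<^sup>= \<and> (U, U \<inter> V) \<in> r\<^sup>*" if "(Y, V) \<in> r\<^sup>*" "(Y, U) \<in> r" for Y U V
    using that(1)
  proof (induction rule: rtrancl_induct)
    case base
    have "U \<inter> Y = U" using sub[OF that(2)] by blast
    then show ?case using that(2) by simp
  next
    case (step V' V)
    have "U \<inter> V' \<inter> V = U \<inter> V" using sub[OF step.hyps(2)] by blast
    then have 1: "(U \<inter> V', U \<inter> V) \<in> r\<^sup>=" and 2: "(V, U \<inter> V) \<in> r\<^sup>="
      using diamond'[of V' "U \<inter> V'" V] step by auto
    from 1 have "(U \<inter> V', U \<inter> V) \<in> r\<^sup>*" by auto
    then have "(U, U \<inter> V) \<in> r\<^sup>*" using step.IH by (meson rtrancl_trans)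
    then show ?case using 2 by blast
  qed
  have "(U, U \<inter> V) \<in> r\<^sup>* \<and> (V, U \<inter> V) \<in> r\<^sup>*"
    using YU
  proof (induction rule: rtrancl_induct)
    case base
    have "Y \<inter> V = V" using le[OF YV] by blast
    then show ?case using YV by simp
  next
    case (step U' U)
    have "U \<inter> (U' \<inter> V) = U \<inter> V" using sub[OF step.hyps(2)] by blast
    then have 1: "(U' \<inter> V, U \<inter> V) \<in> r\<^sup>=" and 2: "(U, U \<inter> V) \<in> r\<^sup>*"
      using strip[of U' "U' \<inter> V" U] step by auto
    from 1 have "(U' \<inter> V, U \<inter> V) \<in> r\<^sup>*" by auto
    then show ?case using 2 step.IH by (meson rtrancl_trans)
  qed
  then show ?thesis by blast
qed

context finite_chains begin

lemma rank_strict_mono: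
  assumes h: "\<And>A B. (A, B) \<in> covers F \<Longrightarrow> h B = Suc (h A)"
    and AB: "A \<in> F" "B \<in> F" "A \<subset> B"
  shows "h A < h B"
proof -
  have add: "h B = h A + n" if "(A, B) \<in> covers F ^^ n" for n B
    using that
  proof (induction n arbitrary: B)
    case (Suc n)
    then obtain C where C: "(A, C) \<in> covers F ^^ n" "(C, B) \<in> covers F" by auto
    then show ?case using Suc.IH[OF C(1)] h[OF C(2)] by simp
  qed simp
  obtain n where n: "(A, B) \<in> covers F ^^ n" using exists_covers_pow[of A B] AB by blast
  have "n \<noteq> 0" using n AB(3) by (intro notI) auto
  then show ?thesis using add[OF n] by simp
qed

end

section \<open>Residue fields\<close>

text \<open>Evaluates the unions over representatives in \<open>frac_field\<close> and
  \<open>residual_map\<close> at a single representative.\<close>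

lemma UN_eq_const:
  assumes "x \<in> F" and "\<And>y. y \<in> F \<Longrightarrow> g y = c"
  shows "(\<Union>y\<in>F. g y) = c"
  using assms by blast

context "domain" begin

lemma frac_rel_iff:
  "((a, s), (b, t)) \<in> frac_rel R \<longleftrightarrow>
    a \<in> carrier R \<and> s \<in> carrier R - {\<zero>} \<and> b \<in> carrier R \<and> t \<in> carrier R - {\<zero>} \<and>
    a \<otimes> t = b \<otimes> s"
  by (simp add: frac_rel_def)

lemma equiv_frac_rel: "equiv (carrier R \<times> (carrier R - {\<zero>})) (frac_rel R)"
proof (rule equivI)
  show "frac_rel R \<subseteq> (carrier R \<times> (carrier R - {\<zero>})) \<times> (carrier R \<times> (carrier R - {\<zero>}))"
    by (auto simp: frac_rel_def)
  show "refl_on (carrier R \<times> (carrier R - {\<zero>})) (frac_rel R)"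
    by (auto simp: refl_on_def frac_rel_def)
  show "sym (frac_rel R)"
    by (auto simp: sym_def frac_rel_def)
  show "trans (frac_rel R)"
  proof (rule transI, clarify)
    fix a s b t c u
    assume "((a, s), (b, t)) \<in> frac_rel R" and "((b, t), (c, u)) \<in> frac_rel R"
    then have c: "a \<in> carrier R" "s \<in> carrier R" "s \<noteq> \<zero>" "b \<in> carrier R" "t \<in> carrier R" "t \<noteq> \<zero>"
        "c \<in> carrier R" "u \<in> carrier R" "u \<noteq> \<zero>"
      and eq: "a \<otimes> t = b \<otimes> s" "b \<otimes> u = c \<otimes> t"
      by (auto simp: frac_rel_iff)
    have "t \<otimes> (a \<otimes> u) = (a \<otimes> t) \<otimes> u" using c by algebra
    also have "\<dots> = (b \<otimes> u) \<otimes> s" unfolding eq(1) using c by algebra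
    also have "\<dots> = t \<otimes> (c \<otimes> s)" unfolding eq(2) using c by algebra
    finally have "a \<otimes> u = c \<otimes> s" using c m_lcancel[of t "a \<otimes> u" "c \<otimes> s"] by simp
    then show "((a, s), (c, u)) \<in> frac_rel R" using c by (simp add: frac_rel_iff)
  qed
qed

lemma fraction_eq_iff:
  assumes "a \<in> carrier R" "s \<in> carrier R - {\<zero>}" "b \<in> carrier R" "t \<in> carrier R - {\<zero>}"
  shows "fraction R a s = fraction R b t \<longleftrightarrow> a \<otimes> t = b \<otimes> s"
  using eq_equiv_class_iff[OF equiv_frac_rel, of "(a, s)" "(b, t)"] assms
  by (simp add: fraction_def frac_rel_iff)

lemma mem_fraction_iff:
  assumes "a \<in> carrier R" "s \<in> carrier R - {\<zero>}"
  shows "(b, t) \<in> fraction R a s \<longleftrightarrow>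
    b \<in> carrier R \<and> t \<in> carrier R - {\<zero>} \<and> b \<otimes> s = a \<otimes> t"
  using assms by (auto simp: fraction_def frac_rel_iff)

lemma carrier_frac_field:
  "carrier (frac_field R) = {fraction R a s | a s. a \<in> carrier R \<and> s \<in> carrier R - {\<zero>}}"
  by (auto simp: frac_field_def quotient_def fraction_def)

lemma frac_field_mult:
  assumes "a \<in> carrier R" "s \<in> carrier R - {\<zero>}" "b \<in> carrier R" "t \<in> carrier R - {\<zero>}"
  shows "fraction R a s \<otimes>\<^bsub>frac_field R\<^esub> fraction R b t = fraction R (a \<otimes> b) (s \<otimes> t)"
proof -
  have eq: "fraction R (a' \<otimes> b') (s' \<otimes> t') = fraction R (a \<otimes> b) (s \<otimes> t)"
    if "(a', s') \<in> fraction R a s" "(b', t') \<in> fraction R b t" for a' s' b' t'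
  proof -
    have c: "a' \<in> carrier R" "s' \<in> carrier R - {\<zero>}" "b' \<in> carrier R" "t' \<in> carrier R - {\<zero>}"
      and e: "a' \<otimes> s = a \<otimes> s'" "b' \<otimes> t = b \<otimes> t'"
      using that assms by (simp_all add: mem_fraction_iff)
    have k: "s \<in> carrier R" "t \<in> carrier R" "s' \<in> carrier R" "t' \<in> carrier R"
      using c assms by simp_all
    have "(a' \<otimes> b') \<otimes> (s \<otimes> t) = (a' \<otimes> s) \<otimes> (b' \<otimes> t)" using c(1,3) assms(1,3) k by algebra
    also have "\<dots> = (a \<otimes> b) \<otimes> (s' \<otimes> t')" unfolding e using c(1,3) assms(1,3) k by algebra
    finally show ?thesis using c assms integral_iff by (subst fraction_eq_iff) auto
  qed
  have m: "(a, s) \<in> fraction R a s" "(b, t) \<in> fraction R b t"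
    using assms by (simp_all add: mem_fraction_iff)
  show ?thesis
    unfolding frac_field_def monoid.simps using eq
    by (intro UN_eq_const[OF m(1)] UN_eq_const[OF m(2)]) (auto intro!: UN_eq_const[OF m(2)])
qed

lemma frac_field_add:
  assumes "a \<in> carrier R" "s \<in> carrier R - {\<zero>}" "b \<in> carrier R" "t \<in> carrier R - {\<zero>}"
  shows "fraction R a s \<oplus>\<^bsub>frac_field R\<^esub> fraction R b t =
    fraction R (a \<otimes> t \<oplus> b \<otimes> s) (s \<otimes> t)"
proof -
  have eq: "fraction R (a' \<otimes> t' \<oplus> b' \<otimes> s') (s' \<otimes> t') = fraction R (a \<otimes> t \<oplus> b \<otimes> s) (s \<otimes> t)"
    if "(a', s') \<in> fraction R a s" "(b', t') \<in> fraction R b t" for a' s' b' t'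
  proof -
    have c: "a' \<in> carrier R" "s' \<in> carrier R - {\<zero>}" "b' \<in> carrier R" "t' \<in> carrier R - {\<zero>}"
      and e: "a' \<otimes> s = a \<otimes> s'" "b' \<otimes> t = b \<otimes> t'"
      using that assms by (simp_all add: mem_fraction_iff)
    have k: "s \<in> carrier R" "t \<in> carrier R" "s' \<in> carrier R" "t' \<in> carrier R"
      using c assms by simp_all
    have "(a' \<otimes> t' \<oplus> b' \<otimes> s') \<otimes> (s \<otimes> t) = (a' \<otimes> s) \<otimes> (t \<otimes> t') \<oplus> (b' \<otimes> t) \<otimes> (s \<otimes> s')"
      using c(1,3) assms(1,3) k by algebra
    also have "\<dots> = (a \<otimes> t \<oplus> b \<otimes> s) \<otimes> (s' \<otimes> t')" unfolding e using c(1,3) assms(1,3) k by algebra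
    finally show ?thesis using c assms integral_iff by (subst fraction_eq_iff) auto
  qed
  have m: "(a, s) \<in> fraction R a s" "(b, t) \<in> fraction R b t"
    using assms by (simp_all add: mem_fraction_iff)
  show ?thesis
    unfolding frac_field_def ring.simps using eq
    by (intro UN_eq_const[OF m(1)] UN_eq_const[OF m(2)]) (auto intro!: UN_eq_const[OF m(2)])
qed

end

text \<open>An injective ring homomorphism always induces an injective homomorphism of fraction
  fields, so only surjectivity is in question. It suffices to reach the fractions
  \<open>e/1\<close>, because every fraction is a quotient of two of them.\<close>

lemma frac_field_map_iso_iff:
  assumes "domain D" and "domain E" and hom: "\<phi> \<in> ring_hom D E" and inj: "inj_on \<phi> (carrier D)"
    and \<Phi>: "\<And>F. \<Phi> F = (\<Union>(a, b)\<in>F. fraction E (\<phi> a) (\<phi> b))"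
  shows "\<Phi> \<in> ring_iso (frac_field D) (frac_field E) \<longleftrightarrow>
    (\<forall>e \<in> carrier E. \<exists>a \<in> carrier D. \<exists>b \<in> carrier D - {\<zero>\<^bsub>D\<^esub>}. e \<otimes>\<^bsub>E\<^esub> \<phi> b = \<phi> a)"
proof -
  interpret D: "domain" D by fact
  interpret E: "domain" E by fact
  interpret h: ring_hom_ring D E \<phi>
    using hom by (intro ring_hom_ringI2) (auto intro: D.ring_axioms E.ring_axioms)
  have nz: "\<phi> s \<in> carrier E - {\<zero>\<^bsub>E\<^esub>}" if "s \<in> carrier D - {\<zero>\<^bsub>D\<^esub>}" for s
    using that inj_onD[OF inj, of s "\<zero>\<^bsub>D\<^esub>"] by auto
  have \<Phi>_fraction: "\<Phi> (fraction D a s) = fraction E (\<phi> a) (\<phi> s)"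
    if a: "a \<in> carrier D" and s: "s \<in> carrier D - {\<zero>\<^bsub>D\<^esub>}" for a s
    unfolding \<Phi>
  proof (rule UN_eq_const)
    show "(a, s) \<in> fraction D a s" using a s by (simp add: D.mem_fraction_iff)
    fix y assume y: "y \<in> fraction D a s"
    obtain b t where yb: "y = (b, t)" by (cases y)
    then have b: "b \<in> carrier D" and t: "t \<in> carrier D - {\<zero>\<^bsub>D\<^esub>}" and e: "b \<otimes>\<^bsub>D\<^esub> s = a \<otimes>\<^bsub>D\<^esub> t"
      using y a s by (simp_all add: D.mem_fraction_iff)
    have "\<phi> b \<otimes>\<^bsub>E\<^esub> \<phi> s = \<phi> a \<otimes>\<^bsub>E\<^esub> \<phi> t"
      using e a s b t by (metis DiffD1 h.hom_mult)
    then show "(case y of (a, b) \<Rightarrow> fraction E (\<phi> a) (\<phi> b)) = fraction E (\<phi> a) (\<phi> s)"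
      using yb a s b t nz by (simp add: E.fraction_eq_iff)
  qed
  have \<Phi>_hom: "\<Phi> \<in> ring_hom (frac_field D) (frac_field E)"
  proof (rule ring_hom_memI)
    fix F assume "F \<in> carrier (frac_field D)"
    then obtain a s where F: "F = fraction D a s" "a \<in> carrier D" "s \<in> carrier D - {\<zero>\<^bsub>D\<^esub>}"
      by (auto simp: D.carrier_frac_field)
    show "\<Phi> F \<in> carrier (frac_field E)"
      unfolding F(1) \<Phi>_fraction[OF F(2,3)] E.carrier_frac_field
      using h.hom_closed[OF F(2)] nz[OF F(3)] by blast
    fix G assume "G \<in> carrier (frac_field D)"
    then obtain b t where G: "G = fraction D b t" "b \<in> carrier D" "t \<in> carrier D - {\<zero>\<^bsub>D\<^esub>}"
      by (auto simp: D.carrier_frac_field)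
    have st: "s \<otimes>\<^bsub>D\<^esub> t \<in> carrier D - {\<zero>\<^bsub>D\<^esub>}"
      using F G D.integral_iff by auto
    have k: "s \<in> carrier D" "t \<in> carrier D" using F G by auto
    have "\<Phi> (F \<otimes>\<^bsub>frac_field D\<^esub> G) = fraction E (\<phi> (a \<otimes>\<^bsub>D\<^esub> b)) (\<phi> (s \<otimes>\<^bsub>D\<^esub> t))"
      unfolding F(1) G(1) D.frac_field_mult[OF F(2,3) G(2,3)] using \<Phi>_fraction st F G by simp
    also have "\<dots> = \<Phi> F \<otimes>\<^bsub>frac_field E\<^esub> \<Phi> G"
      unfolding F(1) G(1) \<Phi>_fraction[OF F(2,3)] \<Phi>_fraction[OF G(2,3)]
      using E.frac_field_mult nz[OF F(3)] nz[OF G(3)] F(2) G(2) k by simp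
    finally show "\<Phi> (F \<otimes>\<^bsub>frac_field D\<^esub> G) = \<Phi> F \<otimes>\<^bsub>frac_field E\<^esub> \<Phi> G" .
    have "\<Phi> (F \<oplus>\<^bsub>frac_field D\<^esub> G) =
        fraction E (\<phi> (a \<otimes>\<^bsub>D\<^esub> t \<oplus>\<^bsub>D\<^esub> b \<otimes>\<^bsub>D\<^esub> s)) (\<phi> (s \<otimes>\<^bsub>D\<^esub> t))"
      unfolding F(1) G(1) D.frac_field_add[OF F(2,3) G(2,3)] using \<Phi>_fraction st F G by simp
    also have "\<dots> = \<Phi> F \<oplus>\<^bsub>frac_field E\<^esub> \<Phi> G"
      unfolding F(1) G(1) \<Phi>_fraction[OF F(2,3)] \<Phi>_fraction[OF G(2,3)]
      using E.frac_field_add nz[OF F(3)] nz[OF G(3)] F(2) G(2) k by simp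
    finally show "\<Phi> (F \<oplus>\<^bsub>frac_field D\<^esub> G) = \<Phi> F \<oplus>\<^bsub>frac_field E\<^esub> \<Phi> G" .
  next
    have "\<one>\<^bsub>frac_field D\<^esub> = fraction D \<one>\<^bsub>D\<^esub> \<one>\<^bsub>D\<^esub>" "\<one>\<^bsub>frac_field E\<^esub> = fraction E \<one>\<^bsub>E\<^esub> \<one>\<^bsub>E\<^esub>"
      by (simp_all add: frac_field_def)
    then show "\<Phi> \<one>\<^bsub>frac_field D\<^esub> = \<one>\<^bsub>frac_field E\<^esub>"
      by (simp add: \<Phi>_fraction)
  qed
  have \<Phi>_inj: "inj_on \<Phi> (carrier (frac_field D))"
  proof (rule inj_onI)
    fix F G assume FG: "F \<in> carrier (frac_field D)" "G \<in> carrier (frac_field D)" "\<Phi> F = \<Phi> G"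
    obtain a s where F: "F = fraction D a s" "a \<in> carrier D" "s \<in> carrier D - {\<zero>\<^bsub>D\<^esub>}"
      using FG by (auto simp: D.carrier_frac_field)
    obtain b t where G: "G = fraction D b t" "b \<in> carrier D" "t \<in> carrier D - {\<zero>\<^bsub>D\<^esub>}"
      using FG by (auto simp: D.carrier_frac_field)
    have "\<phi> a \<otimes>\<^bsub>E\<^esub> \<phi> t = \<phi> b \<otimes>\<^bsub>E\<^esub> \<phi> s"
      using FG(3) F G nz E.fraction_eq_iff[of "\<phi> a" "\<phi> s" "\<phi> b" "\<phi> t"] by (simp add: \<Phi>_fraction)
    then have "\<phi> (a \<otimes>\<^bsub>D\<^esub> t) = \<phi> (b \<otimes>\<^bsub>D\<^esub> s)" using F G by simp
    then have "a \<otimes>\<^bsub>D\<^esub> t = b \<otimes>\<^bsub>D\<^esub> s" using inj_onD[OF inj] F G by simp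
    then show "F = G" using F G by (simp add: D.fraction_eq_iff)
  qed
  have \<Phi>_in: "\<Phi> ` carrier (frac_field D) \<subseteq> carrier (frac_field E)"
    using ring_hom_closed[OF \<Phi>_hom] by blast
  have "carrier (frac_field E) \<subseteq> \<Phi> ` carrier (frac_field D) \<longleftrightarrow>
    (\<forall>e \<in> carrier E. \<exists>a \<in> carrier D. \<exists>b \<in> carrier D - {\<zero>\<^bsub>D\<^esub>}. e \<otimes>\<^bsub>E\<^esub> \<phi> b = \<phi> a)"
    (is "?L \<longleftrightarrow> ?R")
  proof
    assume L: ?L
    show ?R
    proof
      fix e assume e: "e \<in> carrier E"
      have "\<one>\<^bsub>E\<^esub> \<in> carrier E - {\<zero>\<^bsub>E\<^esub>}" by simp
      then have "fraction E e \<one>\<^bsub>E\<^esub> \<in> \<Phi> ` carrier (frac_field D)"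
        using L e unfolding E.carrier_frac_field by blast
      then obtain a s where a: "a \<in> carrier D" and s: "s \<in> carrier D - {\<zero>\<^bsub>D\<^esub>}"
        and "fraction E e \<one>\<^bsub>E\<^esub> = \<Phi> (fraction D a s)"
        by (auto simp: D.carrier_frac_field)
      then have "e \<otimes>\<^bsub>E\<^esub> \<phi> s = \<phi> a \<otimes>\<^bsub>E\<^esub> \<one>\<^bsub>E\<^esub>"
        using e nz[OF s] E.fraction_eq_iff[of e "\<one>\<^bsub>E\<^esub>" "\<phi> a" "\<phi> s"] by (simp add: \<Phi>_fraction)
      then show "\<exists>a \<in> carrier D. \<exists>b \<in> carrier D - {\<zero>\<^bsub>D\<^esub>}. e \<otimes>\<^bsub>E\<^esub> \<phi> b = \<phi> a"
        using a s by auto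
    qed
  next
    assume R: ?R
    show ?L
    proof
      fix G assume "G \<in> carrier (frac_field E)"
      then obtain e f where G: "G = fraction E e f" and e: "e \<in> carrier E"
        and f: "f \<in> carrier E" "f \<noteq> \<zero>\<^bsub>E\<^esub>"
        by (auto simp: E.carrier_frac_field)
      obtain a b where a: "a \<in> carrier D" and b: "b \<in> carrier D - {\<zero>\<^bsub>D\<^esub>}"
        and eb: "e \<otimes>\<^bsub>E\<^esub> \<phi> b = \<phi> a" using R e by blast
      \<comment> \<open>From \<open>e = \<phi> a / \<phi> b\<close> and
        \<open>f = \<phi> c / \<phi> d\<close> the preimage of \<open>e / f\<close> is
        \<open>a d / (b c)\<close>; here \<open>c\<close> is nonzero because \<open>f\<close>
        is.\<close>
      obtain c d where c: "c \<in> carrier D" and d: "d \<in> carrier D - {\<zero>\<^bsub>D\<^esub>}"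
        and fd: "f \<otimes>\<^bsub>E\<^esub> \<phi> d = \<phi> c" using R f by blast
      have "\<phi> c \<noteq> \<zero>\<^bsub>E\<^esub>" using fd f nz[OF d] E.integral_iff by auto
      then have c0: "c \<noteq> \<zero>\<^bsub>D\<^esub>" by auto
      have ad: "a \<otimes>\<^bsub>D\<^esub> d \<in> carrier D" and bc: "b \<otimes>\<^bsub>D\<^esub> c \<in> carrier D - {\<zero>\<^bsub>D\<^esub>}"
        using a b c d c0 D.integral_iff by auto
      have k: "\<phi> b \<in> carrier E" "\<phi> d \<in> carrier E" using b d by auto
      have "e \<otimes>\<^bsub>E\<^esub> (\<phi> b \<otimes>\<^bsub>E\<^esub> \<phi> c) = (\<phi> a \<otimes>\<^bsub>E\<^esub> \<phi> d) \<otimes>\<^bsub>E\<^esub> f"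
        unfolding eb[symmetric] fd[symmetric] using e f k by algebra
      then have "fraction E e f = fraction E (\<phi> (a \<otimes>\<^bsub>D\<^esub> d)) (\<phi> (b \<otimes>\<^bsub>D\<^esub> c))"
        using e f a b c d nz[OF bc] h.hom_closed[OF ad]
        by (subst E.fraction_eq_iff) auto
      then have "G = \<Phi> (fraction D (a \<otimes>\<^bsub>D\<^esub> d) (b \<otimes>\<^bsub>D\<^esub> c))"
        using G \<Phi>_fraction[OF ad bc] by simp
      then show "G \<in> \<Phi> ` carrier (frac_field D)"
        using ad bc by (auto simp: D.carrier_frac_field)
    qed
  qed
  then show ?thesis
    using \<Phi>_hom \<Phi>_inj \<Phi>_in by (auto simp: ring_iso_def bij_betw_def)
qed


section \<open>Cosets, contracted primes and residual maps\<close>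

lemma (in ideal) a_coset_eq_iff:
  assumes "x \<in> carrier R" "y \<in> carrier R"
  shows "I +> x = I +> y \<longleftrightarrow> (\<exists>i\<in>I. x = i \<oplus> y)"
proof
  assume "I +> x = I +> y"
  then have "x \<in> I +> y" using a_rcos_self[OF assms(1)] by simp
  then show "\<exists>i\<in>I. x = i \<oplus> y" by (auto simp: a_r_coset_def')
next
  assume "\<exists>i\<in>I. x = i \<oplus> y"
  then have "x \<in> I +> y" by (auto simp: a_r_coset_def')
  then show "I +> x = I +> y"
    using a_repr_independence[OF _ assms(2) a_subgroup] by simp
qed

lemma carrier_Quot: "carrier (A Quot P) = {P +>\<^bsub>A\<^esub> a | a. a \<in> carrier A}"
  by (auto simp: FactRing_def A_RCOSETS_def')

lemma (in ideal) zero_Quot_iff: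
  assumes "x \<in> carrier R"
  shows "I +> x = \<zero>\<^bsub>R Quot I\<^esub> \<longleftrightarrow> x \<in> I"
  using assms a_rcos_const[of x] a_rcos_self[of x] by (auto simp: FactRing_def)

lemma (in ideal) mult_Quot:
  assumes "x \<in> carrier R" "y \<in> carrier R"
  shows "(I +> x) \<otimes>\<^bsub>R Quot I\<^esub> (I +> y) = I +> (x \<otimes> y)"
  using rcoset_mult_add[OF assms] by (simp add: FactRing_def)

lemma (in ideal) add_Quot:
  assumes "x \<in> carrier R" "y \<in> carrier R"
  shows "(I +> x) \<oplus>\<^bsub>R Quot I\<^esub> (I +> y) = I +> (x \<oplus> y)"
  using a_rcos_sum[OF assms] by (simp add: FactRing_def)

lemma (in cring) primeideal_contract:
  assumes "subring U R" and "primeideal Q R"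
  shows "primeideal (Q \<inter> U) (R\<lparr>carrier := U\<rparr>)"
proof -
  interpret Q: primeideal Q R by fact
  note U = subringE[OF assms(1)]
  have ring: "cring (R\<lparr>carrier := U\<rparr>)"
    using subcring_iff[OF U(1)] subcringI'[OF assms(1)] by blast
  then interpret U: cring "R\<lparr>carrier := U\<rparr>" .
  show ?thesis
  proof (rule primeidealI2)
    show "additive_subgroup (Q \<inter> U) (R\<lparr>carrier := U\<rparr>)"
    proof (rule additive_subgroup.intro, rule U.add.subgroupI)
      fix a assume a: "a \<in> Q \<inter> U"
      have "\<ominus> a \<in> Q \<inter> U" using a U(5) Q.a_inv_closed by blast
      moreover have "\<ominus>\<^bsub>R\<lparr>carrier := U\<rparr>\<^esub> a = \<ominus> a"
        using U.minus_equality[of "\<ominus> a" a] a U(1,5) l_neg by auto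
      ultimately show "\<ominus>\<^bsub>R\<lparr>carrier := U\<rparr>\<^esub> a \<in> Q \<inter> U" by simp
    next
      show "Q \<inter> U \<noteq> {}"
        using U(2) additive_subgroup.zero_closed[OF Q.is_additive_subgroup] by blast
    qed (use U Q.a_closed in auto)
    show "carrier (R\<lparr>carrier := U\<rparr>) \<noteq> Q \<inter> U"
      using U(3) Q.one_imp_carrier Q.I_notcarr by auto
    fix a b
    assume "a \<in> carrier (R\<lparr>carrier := U\<rparr>)" "b \<in> carrier (R\<lparr>carrier := U\<rparr>)"
      "a \<otimes>\<^bsub>R\<lparr>carrier := U\<rparr>\<^esub> b \<in> Q \<inter> U"
    then show "a \<in> Q \<inter> U \<or> b \<in> Q \<inter> U" using Q.I_prime[of a b] U(1) by auto
  qed (use U Q.I_l_closed Q.I_r_closed ring in auto)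
qed

text \<open>The map \<open>A \<mapsto> Q <+> A\<close> embeds \<open>U / (Q \<inter> U)\<close> into
  \<open>R / Q\<close>, since two elements of \<open>U\<close> that agree modulo \<open>Q\<close>
  differ by an element of \<open>Q \<inter> U\<close>. What remains is that each residue class
  \<open>x\<close> modulo \<open>Q\<close> is a fraction \<open>u / v\<close>, a condition on
  elements only.\<close>

lemma (in cring) residual_map_iso_iff:
  assumes "subring U R" and "primeideal Q R"
  shows "residual_map R Q \<in>
      ring_iso (residue_field (R\<lparr>carrier := U\<rparr>) (Q \<inter> U)) (residue_field R Q) \<longleftrightarrow>
    (\<forall>x \<in> carrier R. \<exists>u \<in> U. \<exists>v \<in> U - Q. \<exists>q \<in> Q. v \<otimes> x = u \<oplus> q)"
proof -
  let ?U = "R\<lparr>carrier := U\<rparr>" and ?P = "Q \<inter> U" and ?\<phi> = "\<lambda>A. Q <+>\<^bsub>R\<^esub> A"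
  note U = subringE[OF assms(1)]
  interpret Q: primeideal Q R by fact
  interpret P: primeideal ?P ?U using primeideal_contract assms .
  have coset: "?P +>\<^bsub>?U\<^esub> u = ?P +> u" for u by (simp add: a_r_coset_def')
  have \<phi>: "?\<phi> (?P +> u) = Q +> u" if u: "u \<in> U" for u
  proof (intro equalityI subsetI)
    fix x assume "x \<in> ?\<phi> (?P +> u)"
    then obtain q p where x: "q \<in> Q" "p \<in> ?P" "x = q \<oplus> (p \<oplus> u)"
      by (auto simp: set_add_def' a_r_coset_def')
    then have "x = (q \<oplus> p) \<oplus> u" "q \<oplus> p \<in> Q" using u U(1) Q.Icarr a_assoc[of q p u] by auto
    then show "x \<in> Q +> u" by (auto simp: a_r_coset_def')
  next
    fix x assume "x \<in> Q +> u"
    then obtain q where x: "q \<in> Q" "x = q \<oplus> u" by (auto simp: a_r_coset_def')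
    then have "x = q \<oplus> (\<zero> \<oplus> u)" using u U(1) by auto
    moreover have "\<zero> \<oplus> u \<in> ?P +> u" using U(2) by (auto simp: a_r_coset_def')
    ultimately show "x \<in> ?\<phi> (?P +> u)" using x(1) by (auto simp: set_add_def')
  qed
  have carr: "carrier (?U Quot ?P) = {?P +> u | u. u \<in> U}"
    by (simp add: carrier_Quot coset)
  have hom: "?\<phi> \<in> ring_hom (?U Quot ?P) (R Quot Q)"
  proof (rule ring_hom_memI)
    fix A assume "A \<in> carrier (?U Quot ?P)"
    then obtain u where A: "A = ?P +> u" and u: "u \<in> U" by (auto simp: carr)
    then have uR: "u \<in> carrier R" using U(1) by blast
    show "?\<phi> A \<in> carrier (R Quot Q)" using uR u by (auto simp: A \<phi> carrier_Quot)
    fix B assume "B \<in> carrier (?U Quot ?P)"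
    then obtain v where B: "B = ?P +> v" and v: "v \<in> U" by (auto simp: carr)
    then have vR: "v \<in> carrier R" using U(1) by blast
    have "A \<otimes>\<^bsub>?U Quot ?P\<^esub> B = ?P +> (u \<otimes> v)" "A \<oplus>\<^bsub>?U Quot ?P\<^esub> B = ?P +> (u \<oplus> v)"
      using P.mult_Quot[of u v] P.add_Quot[of u v] u v by (simp_all add: A B coset)
    then show "?\<phi> (A \<otimes>\<^bsub>?U Quot ?P\<^esub> B) = ?\<phi> A \<otimes>\<^bsub>R Quot Q\<^esub> ?\<phi> B"
      and "?\<phi> (A \<oplus>\<^bsub>?U Quot ?P\<^esub> B) = ?\<phi> A \<oplus>\<^bsub>R Quot Q\<^esub> ?\<phi> B"
      using Q.mult_Quot[OF uR vR] Q.add_Quot[OF uR vR] u v U(6,7) by (simp_all add: A B \<phi>)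
  next
    have "\<one>\<^bsub>?U Quot ?P\<^esub> = ?P +> \<one>" "\<one>\<^bsub>R Quot Q\<^esub> = Q +> \<one>"
      by (simp_all add: FactRing_def coset)
    then show "?\<phi> \<one>\<^bsub>?U Quot ?P\<^esub> = \<one>\<^bsub>R Quot Q\<^esub>"
      using \<phi>[OF U(3)] by simp
  qed
  have inj: "inj_on ?\<phi> (carrier (?U Quot ?P))"
  proof (rule inj_onI)
    fix A B assume AB: "A \<in> carrier (?U Quot ?P)" "B \<in> carrier (?U Quot ?P)" "?\<phi> A = ?\<phi> B"
    obtain u where A: "A = ?P +> u" and u: "u \<in> U" using AB by (auto simp: carr)
    obtain v where B: "B = ?P +> v" and v: "v \<in> U" using AB by (auto simp: carr)
    have k: "u \<in> carrier R" "v \<in> carrier R" using u v U(1) by blast+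
    have "Q +> u = Q +> v" using AB(3) by (simp add: A B \<phi> u v)
    then obtain q where q: "q \<in> Q" "u = q \<oplus> v" using Q.a_coset_eq_iff[OF k] by blast
    then have "q = u \<oplus> (\<ominus> v)" using k Q.Icarr[OF q(1)] by algebra
    then have "q \<in> ?P" using q(1) u v U(5,7) by simp
    then show "A = B" using P.a_coset_eq_iff[of u v] q(2) u v by (auto simp: A B coset)
  qed
  have "residual_map R Q \<in> ring_iso (residue_field ?U ?P) (residue_field R Q) \<longleftrightarrow>
    (\<forall>e \<in> carrier (R Quot Q). \<exists>a \<in> carrier (?U Quot ?P).
       \<exists>b \<in> carrier (?U Quot ?P) - {\<zero>\<^bsub>?U Quot ?P\<^esub>}. e \<otimes>\<^bsub>R Quot Q\<^esub> ?\<phi> b = ?\<phi> a)"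
    unfolding residue_field_def
    by (rule frac_field_map_iso_iff[OF P.quotient_is_domain Q.quotient_is_domain hom inj])
      (simp add: residual_map_def)
  also have "\<dots> \<longleftrightarrow> (\<forall>x \<in> carrier R. \<exists>u \<in> U. \<exists>v \<in> U - Q. \<exists>q \<in> Q. v \<otimes> x = u \<oplus> q)"
    (is "?L \<longleftrightarrow> ?R")
  proof -
    have key: "(Q +> x) \<otimes>\<^bsub>R Quot Q\<^esub> ?\<phi> (?P +> v) = ?\<phi> (?P +> u) \<longleftrightarrow> (\<exists>q\<in>Q. v \<otimes> x = u \<oplus> q)"
      if "x \<in> carrier R" "u \<in> U" "v \<in> U" for x u v
    proof -
      have k: "u \<in> carrier R" "v \<in> carrier R" using that U(1) by blast+
      have "(Q +> x) \<otimes>\<^bsub>R Quot Q\<^esub> ?\<phi> (?P +> v) = Q +> (v \<otimes> x)"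
        using that k Q.mult_Quot[of x v] by (simp add: \<phi> m_comm)
      then show ?thesis
        using that k Q.a_coset_eq_iff[of "v \<otimes> x" u] a_comm[OF Q.Icarr k(1)] by (auto simp: \<phi>)
    qed
    have nz: "?P +> v \<noteq> \<zero>\<^bsub>?U Quot ?P\<^esub> \<longleftrightarrow> v \<notin> Q" if "v \<in> U" for v
      using P.zero_Quot_iff[of v] that by (simp add: coset)
    show ?thesis
    proof
      assume L: ?L
      show ?R
      proof
        fix x assume x: "x \<in> carrier R"
        then have "Q +> x \<in> carrier (R Quot Q)" by (auto simp: carrier_Quot)
        then obtain a b where "a \<in> carrier (?U Quot ?P)"
          "b \<in> carrier (?U Quot ?P) - {\<zero>\<^bsub>?U Quot ?P\<^esub>}"
          and eq: "(Q +> x) \<otimes>\<^bsub>R Quot Q\<^esub> ?\<phi> b = ?\<phi> a" using L by blast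
        then obtain u v where u: "u \<in> U" "a = ?P +> u" and v: "v \<in> U" "b = ?P +> v" "v \<notin> Q"
          unfolding carr using nz by blast
        have "\<exists>q\<in>Q. v \<otimes> x = u \<oplus> q" using key[OF x u(1) v(1)] eq u v by simp
        then show "\<exists>u \<in> U. \<exists>v \<in> U - Q. \<exists>q \<in> Q. v \<otimes> x = u \<oplus> q" using u v by blast
      qed
    next
      assume R: ?R
      show ?L
      proof
        fix e assume "e \<in> carrier (R Quot Q)"
        then obtain x where e: "e = Q +> x" and x: "x \<in> carrier R" by (auto simp: carrier_Quot)
        then obtain u v where u: "u \<in> U" and v: "v \<in> U" "v \<notin> Q" "\<exists>q\<in>Q. v \<otimes> x = u \<oplus> q"
          using R by blast
        have "e \<otimes>\<^bsub>R Quot Q\<^esub> ?\<phi> (?P +> v) = ?\<phi> (?P +> u)" using key[OF x u v(1)] v(3) e by simp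
        moreover have "?P +> u \<in> carrier (?U Quot ?P)"
          "?P +> v \<in> carrier (?U Quot ?P) - {\<zero>\<^bsub>?U Quot ?P\<^esub>}"
          using u v nz by (auto simp: carr)
        ultimately show "\<exists>a \<in> carrier (?U Quot ?P).
          \<exists>b \<in> carrier (?U Quot ?P) - {\<zero>\<^bsub>?U Quot ?P\<^esub>}. e \<otimes>\<^bsub>R Quot Q\<^esub> ?\<phi> b = ?\<phi> a" by blast
      qed
    qed
  qed
  finally show ?thesis .
qed

section \<open>Ideals and integrality in subrings\<close>

context cring begin

text \<open>Ideals of the subring \<open>Y\<close> are subsets of the ambient ring, so that ideals
  of different rings of a tower can be compared and intersected directly. Negatives are obtained as
  multiples by \<open>\<ominus> \<one>\<close>.\<close>

definition ideal_in :: "'a set \<Rightarrow> 'a set \<Rightarrow> bool"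
  where "ideal_in Y I \<longleftrightarrow> I \<subseteq> Y \<and> \<zero> \<in> I \<and> (\<forall>a\<in>I. \<forall>b\<in>I. a \<oplus> b \<in> I) \<and> (\<forall>y\<in>Y. \<forall>a\<in>I. y \<otimes> a \<in> I)"

definition prime_in :: "'a set \<Rightarrow> 'a set \<Rightarrow> bool"
  where "prime_in Y P \<longleftrightarrow> ideal_in Y P \<and> \<one> \<notin> P \<and> (\<forall>a\<in>Y. \<forall>b\<in>Y. a \<otimes> b \<in> P \<longrightarrow> a \<in> P \<or> b \<in> P)"

definition sum_set :: "'a set \<Rightarrow> 'a set \<Rightarrow> 'a set"
  where "sum_set U J = {u \<oplus> j | u j. u \<in> U \<and> j \<in> J}"

lemma ideal_inD:
  assumes "ideal_in Y I"
  shows "I \<subseteq> Y" "\<zero> \<in> I" "\<And>a b. a \<in> I \<Longrightarrow> b \<in> I \<Longrightarrow> a \<oplus> b \<in> I"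
    "\<And>y a. y \<in> Y \<Longrightarrow> a \<in> I \<Longrightarrow> y \<otimes> a \<in> I"
  using assms by (auto simp: ideal_in_def)

lemma prime_inD:
  assumes "prime_in Y P"
  shows "ideal_in Y P" "\<one> \<notin> P" "\<And>a b. a \<in> Y \<Longrightarrow> b \<in> Y \<Longrightarrow> a \<otimes> b \<in> P \<Longrightarrow> a \<in> P \<or> b \<in> P"
  using assms by (auto simp: prime_in_def)

lemma sum_setI: "u \<in> U \<Longrightarrow> j \<in> J \<Longrightarrow> u \<oplus> j \<in> sum_set U J"
  by (auto simp: sum_set_def)

lemma sum_setE:
  assumes "x \<in> sum_set U J"
  obtains u j where "u \<in> U" "j \<in> J" "x = u \<oplus> j"
  using assms by (auto simp: sum_set_def)

lemma subring_minus:
  assumes "subring U R" "a \<in> U" "b \<in> U"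
  shows "a \<ominus> b \<in> U"
  using subringE[OF assms(1)] assms by (simp add: a_minus_def)

lemma ideal_in_carrier:
  assumes "subring Y R" "ideal_in Y I"
  shows "I \<subseteq> carrier R"
  using subringE(1)[OF assms(1)] ideal_inD(1)[OF assms(2)] by (rule subset_trans[rotated])

lemma ideal_in_uminus:
  assumes "subring Y R" "ideal_in Y I" "a \<in> I"
  shows "\<ominus> a \<in> I"
proof -
  have "a \<in> carrier R" using assms ideal_in_carrier by blast
  then have "\<ominus> a = (\<ominus> \<one>) \<otimes> a" by algebra
  then show ?thesis
    using ideal_inD(4)[OF assms(2) subringE(5)[OF assms(1) subringE(3)[OF assms(1)]] assms(3)] by simp
qed

lemma ideal_in_minus:
  assumes "subring Y R" "ideal_in Y I" "a \<in> I" "b \<in> I"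
  shows "a \<ominus> b \<in> I"
  using ideal_inD(3)[OF assms(2,3) ideal_in_uminus[OF assms(1,2,4)]] by (simp add: a_minus_def)

lemma ideal_in_add_cancel:
  assumes "subring Y R" "ideal_in Y I" "a \<in> carrier R" "b \<in> I" "a \<oplus> b \<in> I"
  shows "a \<in> I"
proof -
  have "b \<in> carrier R" using assms ideal_in_carrier by blast
  then have "a = (a \<oplus> b) \<ominus> b" using assms(3) by algebra
  then show ?thesis using ideal_in_minus[OF assms(1,2,5,4)] by simp
qed

lemma subring_add_cancel:
  assumes "subring U R" "a \<in> carrier R" "b \<in> U" "a \<oplus> b \<in> U"
  shows "a \<in> U"
proof -
  have "b \<in> carrier R" using assms subringE(1) by blast
  then have "a = (a \<oplus> b) \<ominus> b" using assms(2) by algebra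
  then show ?thesis using subring_minus[OF assms(1,4,3)] by simp
qed

lemma ideal_in_Int:
  assumes "subring U R" "U \<subseteq> Y" "ideal_in Y I"
  shows "ideal_in U (I \<inter> U)"
  using assms(2) ideal_inD[OF assms(3)] subringE(2,6,7)[OF assms(1)] by (simp add: ideal_in_def subset_iff)

lemma prime_in_Int:
  assumes "subring U R" "U \<subseteq> Y" "prime_in Y P"
  shows "prime_in U (P \<inter> U)"
  using ideal_in_Int[OF assms(1,2) prime_inD(1)[OF assms(3)]] prime_inD(2,3)[OF assms(3)] assms(2)
  by (simp add: prime_in_def subset_iff)

lemma prime_in_power:
  assumes "subring Y R" "prime_in Y P" "a \<in> Y" "a [^] (n::nat) \<in> P"
  shows "a \<in> P"
  using assms(4)
proof (induction n)
  case 0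
  then show ?case using prime_inD(2)[OF assms(2)] by simp
next
  case (Suc n)
  have "a [^] n \<in> Y"
    using subringE[OF assms(1)] assms(3) by (induction n) auto
  then show ?case using Suc prime_inD(3)[OF assms(2) _ assms(3)] by auto
qed

lemma subring_power:
  assumes "subring U R" "a \<in> U"
  shows "a [^] (n::nat) \<in> U"
  using subringE(3,6)[OF assms(1)] assms(2) by (induction n) auto

lemma ideal_in_sum_set:
  assumes Y: "subring Y R" and I: "ideal_in Y I" and J: "ideal_in Y J"
  shows "ideal_in Y (sum_set I J)"
proof -
  note YE = subringE[OF Y] and IE = ideal_inD[OF I] and JE = ideal_inD[OF J]
  have c: "a \<in> carrier R" if "a \<in> I \<or> a \<in> J \<or> a \<in> Y" for a using that IE(1) JE(1) YE(1) by blast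
  show ?thesis unfolding ideal_in_def
  proof (intro conjI ballI)
    show "sum_set I J \<subseteq> Y" using IE(1) JE(1) YE(7) by (auto simp: sum_set_def)
    show "\<zero> \<in> sum_set I J" using sum_setI[OF IE(2) JE(2)] by simp
    fix a assume "a \<in> sum_set I J"
    then obtain i j where a: "i \<in> I" "j \<in> J" "a = i \<oplus> j" by (rule sum_setE)
    {
      fix b assume "b \<in> sum_set I J"
      then obtain i' j' where b: "i' \<in> I" "j' \<in> J" "b = i' \<oplus> j'" by (rule sum_setE)
      have "i \<in> carrier R" "j \<in> carrier R" "i' \<in> carrier R" "j' \<in> carrier R" using a b c by auto
      then have "a \<oplus> b = (i \<oplus> i') \<oplus> (j \<oplus> j')" unfolding a b by algebra
      then show "a \<oplus> b \<in> sum_set I J" using sum_setI IE(3) JE(3) a b by metis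
    }
    fix y assume y: "y \<in> Y"
    have "i \<in> carrier R" "j \<in> carrier R" "y \<in> carrier R" using a y c by auto
    then have "y \<otimes> a = y \<otimes> i \<oplus> y \<otimes> j" unfolding a by algebra
    then show "y \<otimes> a \<in> sum_set I J" using sum_setI IE(4) JE(4) a y by metis
  qed
qed

lemma ideal_in_principal:
  assumes Y: "subring Y R" and a: "a \<in> Y"
  shows "ideal_in Y {a \<otimes> y | y. y \<in> Y}"
proof -
  note YE = subringE[OF Y]
  have c: "a \<in> carrier R" "\<And>y. y \<in> Y \<Longrightarrow> y \<in> carrier R" using a YE(1) by auto
  have "\<zero> = a \<otimes> \<zero>" using c by simp
  moreover have "a \<otimes> x \<oplus> a \<otimes> y = a \<otimes> (x \<oplus> y)" if "x \<in> Y" "y \<in> Y" for x y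
    using c that by algebra
  moreover have "z \<otimes> (a \<otimes> y) = a \<otimes> (z \<otimes> y)" if "z \<in> Y" "y \<in> Y" for z y
    using c(1) c(2)[OF that(1)] c(2)[OF that(2)] by algebra
  ultimately show ?thesis
    unfolding ideal_in_def using YE a by (auto; blast)
qed

lemma subset_sum_set:
  assumes "\<zero> \<in> J" "U \<subseteq> carrier R"
  shows "U \<subseteq> sum_set U J"
proof
  fix u assume u: "u \<in> U"
  then have "u = u \<oplus> \<zero>" using assms by auto
  then show "u \<in> sum_set U J" using sum_setI[OF u assms(1)] by simp
qed

lemma subset_sum_set':
  assumes "\<zero> \<in> U" "J \<subseteq> carrier R"
  shows "J \<subseteq> sum_set U J"
proof
  fix u assume u: "u \<in> J"
  then have "u = \<zero> \<oplus> u" using assms by auto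
  then show "u \<in> sum_set U J" using sum_setI[OF assms(1) u] by simp
qed

text \<open>Products from \<open>J\<close> are allowed to fall into \<open>U + J\<close>. This
  serves both for an ideal \<open>J\<close>, where they stay in \<open>J\<close>, and for
  \<open>J = U q\<close> with \<open>q \<otimes> q \<in> U\<close>, where they fall into
  \<open>U\<close>.\<close>

lemma subring_sum_set:
  assumes U: "subring U R" and J: "J \<subseteq> carrier R" "\<zero> \<in> J" "\<And>i j. i \<in> J \<Longrightarrow> j \<in> J \<Longrightarrow> i \<oplus> j \<in> J"
    "\<And>u j. u \<in> U \<Longrightarrow> j \<in> J \<Longrightarrow> u \<otimes> j \<in> J"
    and JJ: "\<And>i j. i \<in> J \<Longrightarrow> j \<in> J \<Longrightarrow> i \<otimes> j \<in> sum_set U J"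
  shows "subring (sum_set U J) R"
proof -
  note UE = subringE[OF U]
  have c: "a \<in> carrier R" if "a \<in> U \<or> a \<in> J" for a using that J(1) UE(1) by blast
  have add: "a \<oplus> b \<in> sum_set U J" if "a \<in> sum_set U J" "b \<in> sum_set U J" for a b
  proof -
    obtain u i where a: "u \<in> U" "i \<in> J" "a = u \<oplus> i" using \<open>a \<in> _\<close> by (rule sum_setE)
    obtain v j where b: "v \<in> U" "j \<in> J" "b = v \<oplus> j" using \<open>b \<in> _\<close> by (rule sum_setE)
    have "u \<in> carrier R" "i \<in> carrier R" "v \<in> carrier R" "j \<in> carrier R" using a b c by auto
    then have "a \<oplus> b = (u \<oplus> v) \<oplus> (i \<oplus> j)" unfolding a b by algebra
    then show ?thesis using sum_setI UE(7) J(3) a b by metis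
  qed
  have scale: "v \<otimes> a \<in> sum_set U J" if "v \<in> U" "a \<in> sum_set U J" for v a
  proof -
    obtain u i where a: "u \<in> U" "i \<in> J" "a = u \<oplus> i" using \<open>a \<in> _\<close> by (rule sum_setE)
    have "u \<in> carrier R" "i \<in> carrier R" "v \<in> carrier R" using a that c by auto
    then have "v \<otimes> a = v \<otimes> u \<oplus> v \<otimes> i" unfolding a by algebra
    then show ?thesis using sum_setI UE(6) J(4) a that by metis
  qed
  have sub: "sum_set U J \<subseteq> carrier R" using UE(1) J(1) by (auto simp: sum_set_def)
  show ?thesis
  proof (rule subringI)
    show "sum_set U J \<subseteq> carrier R" by (fact sub)
    show "\<one> \<in> sum_set U J" using subset_sum_set[OF J(2) UE(1)] UE(3) by blast
    fix a assume a: "a \<in> sum_set U J"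
    have ac: "a \<in> carrier R" using a sub by blast
    have "\<ominus> a = (\<ominus> \<one>) \<otimes> a" using ac by algebra
    then show "\<ominus> a \<in> sum_set U J" using scale[OF UE(5)[OF UE(3)] a] by simp
    fix b assume b: "b \<in> sum_set U J"
    have bc: "b \<in> carrier R" using b sub by blast
    show "a \<oplus> b \<in> sum_set U J" using add a b .
    obtain u i where a': "u \<in> U" "i \<in> J" "a = u \<oplus> i" using a by (rule sum_setE)
    obtain v j where b': "v \<in> U" "j \<in> J" "b = v \<oplus> j" using b by (rule sum_setE)
    have k: "u \<in> carrier R" "i \<in> carrier R" "v \<in> carrier R" "j \<in> carrier R" using a' b' c by auto
    have "a \<otimes> b = u \<otimes> b \<oplus> (v \<otimes> i \<oplus> i \<otimes> j)" unfolding a' b' using k by algebra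
    moreover have "v \<otimes> i \<in> sum_set U J"
      using subset_sum_set'[OF UE(2) J(1)] J(4)[OF b'(1) a'(2)] by blast
    ultimately show "a \<otimes> b \<in> sum_set U J"
      using add scale[OF a'(1) b] JJ[OF a'(2) b'(2)] by metis
  qed
qed

lemma subring_sum_set_ideal:
  assumes U: "subring U R" and Y: "subring Y R" and UY: "U \<subseteq> Y" and I: "ideal_in Y I"
  shows "subring (sum_set U I) R" "U \<subseteq> sum_set U I" "I \<subseteq> sum_set U I" "sum_set U I \<subseteq> Y"
proof -
  note UE = subringE[OF U] and IE = ideal_inD[OF I] and Ic = ideal_in_carrier[OF Y I]
  show sub: "U \<subseteq> sum_set U I" "I \<subseteq> sum_set U I"
    using subset_sum_set[OF IE(2) UE(1)] subset_sum_set'[OF UE(2) Ic] by auto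
  show "sum_set U I \<subseteq> Y" using UY IE(1) subringE(7)[OF Y] by (auto simp: sum_set_def)
  show "subring (sum_set U I) R"
  proof (rule subring_sum_set[OF U Ic IE(2,3)])
    show "u \<otimes> j \<in> I" if "u \<in> U" "j \<in> I" for u j using IE(4) that UY by blast
    show "i \<otimes> j \<in> sum_set U I" if "i \<in> I" "j \<in> I" for i j
      using IE(4)[of i j] that IE(1) sub(2) by blast
  qed
qed

lemma subring_adjoin_square:
  assumes U: "subring U R" and q: "q \<in> carrier R" "q \<otimes> q \<in> U"
  shows "subring (sum_set U {u \<otimes> q | u. u \<in> U}) R"
    "U \<subseteq> sum_set U {u \<otimes> q | u. u \<in> U}" "q \<in> sum_set U {u \<otimes> q | u. u \<in> U}"
proof -
  note UE = subringE[OF U]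
  have Uc: "\<And>u. u \<in> U \<Longrightarrow> u \<in> carrier R" using UE(1) by blast
  let ?J = "{u \<otimes> q | u. u \<in> U}"
  have Jc: "?J \<subseteq> carrier R" using Uc q by auto
  have "\<zero> = \<zero> \<otimes> q" using q by simp
  then have J0: "\<zero> \<in> ?J" using UE(2) by blast
  show sub: "U \<subseteq> sum_set U ?J" using subset_sum_set[OF J0 UE(1)] .
  have "q = \<one> \<otimes> q" using q by simp
  then have "q \<in> ?J" using UE(3) by blast
  then show "q \<in> sum_set U ?J" using subset_sum_set'[OF UE(2) Jc] by blast
  show "subring (sum_set U ?J) R"
  proof (rule subring_sum_set[OF U Jc J0])
    fix i j assume "i \<in> ?J" "j \<in> ?J"
    then obtain u v where uv: "u \<in> U" "v \<in> U" "i = u \<otimes> q" "j = v \<otimes> q" by blast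
    have k: "u \<in> carrier R" "v \<in> carrier R" using uv Uc by auto
    have "i \<oplus> j = (u \<oplus> v) \<otimes> q" unfolding uv using k q(1) by algebra
    then show "i \<oplus> j \<in> ?J" using UE(7) uv by blast
    have "i \<otimes> j = (u \<otimes> v) \<otimes> (q \<otimes> q)" unfolding uv using k q(1) by algebra
    then have "i \<otimes> j \<in> U" using UE(6) uv q(2) by metis
    then show "i \<otimes> j \<in> sum_set U ?J" using sub by blast
  next
    fix u j assume u: "u \<in> U" and "j \<in> ?J"
    then obtain v where v: "v \<in> U" "j = v \<otimes> q" by blast
    have "u \<otimes> j = (u \<otimes> v) \<otimes> q" using v u Uc q m_assoc by simp
    then show "u \<otimes> j \<in> ?J" using UE(6) u v by blast
  qed
qed

text \<open>An ideal maximal among those that contain \<open>I\<close> and avoid the multiplicative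
  set \<open>M\<close> is prime (Krull). Maximality is part of the result because
  \<open>going_up\<close> needs it once more.\<close>

lemma exists_prime_in_avoiding:
  assumes Y: "subring Y R" and I: "ideal_in Y I" and M: "M \<subseteq> Y" "\<one> \<in> M"
    "\<And>a b. a \<in> M \<Longrightarrow> b \<in> M \<Longrightarrow> a \<otimes> b \<in> M" and IM: "I \<inter> M = {}"
  obtains P where "prime_in Y P" "I \<subseteq> P" "P \<inter> M = {}"
    "\<And>J. ideal_in Y J \<Longrightarrow> P \<subset> J \<Longrightarrow> J \<inter> M \<noteq> {}"
proof -
  note YE = subringE[OF Y]
  define A where "A = {J. ideal_in Y J \<and> I \<subseteq> J \<and> J \<inter> M = {}}"
  have "\<exists>P\<in>A. \<forall>J\<in>A. P \<subseteq> J \<longrightarrow> J = P"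
  proof (rule subset_Zorn_nonempty)
    show "A \<noteq> {}" using I IM by (auto simp: A_def)
    fix C assume C: "C \<noteq> {}" "subset.chain A C"
    then have CA: "\<And>J. J \<in> C \<Longrightarrow> ideal_in Y J \<and> I \<subseteq> J \<and> J \<inter> M = {}"
      and tot: "\<And>J K. J \<in> C \<Longrightarrow> K \<in> C \<Longrightarrow> J \<subseteq> K \<or> K \<subseteq> J"
      by (auto simp: subset_chain_def A_def)
    have "a \<oplus> b \<in> \<Union>C" if ab: "a \<in> \<Union>C" "b \<in> \<Union>C" for a b
    proof -
      obtain J K where JK: "J \<in> C" "a \<in> J" "K \<in> C" "b \<in> K" using ab by blast
      then have "(a \<in> K \<and> b \<in> K) \<or> (a \<in> J \<and> b \<in> J)" using tot[of J K] by blast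
      then show ?thesis using JK CA ideal_inD(3) by (meson UnionI)
    qed
    moreover have "y \<otimes> a \<in> \<Union>C" if "y \<in> Y" "a \<in> \<Union>C" for y a
      using that CA ideal_inD(4) by (meson UnionE UnionI)
    moreover have "\<zero> \<in> \<Union>C" "\<Union>C \<subseteq> Y" "I \<subseteq> \<Union>C" "\<Union>C \<inter> M = {}"
      using C(1) CA ideal_inD(1,2) by blast+
    ultimately show "\<Union>C \<in> A" by (simp add: A_def ideal_in_def)
  qed
  then obtain P where P: "ideal_in Y P" "I \<subseteq> P" "P \<inter> M = {}" and maxA: "\<forall>J\<in>A. P \<subseteq> J \<longrightarrow> J = P"
    by (auto simp: A_def)
  have max: "J \<inter> M \<noteq> {}" if "ideal_in Y J" "P \<subset> J" for J
    using maxA that P(2) by (auto simp: A_def)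
  note PE = ideal_inD[OF P(1)]
  have meet: "\<exists>p\<in>P. \<exists>y\<in>Y. p \<oplus> a \<otimes> y \<in> M" if a: "a \<in> Y" "a \<notin> P" for a
  proof -
    let ?J = "{a \<otimes> y | y. y \<in> Y}"
    have J: "ideal_in Y ?J" using ideal_in_principal[OF Y a(1)] .
    have "a = a \<otimes> \<one>" using a YE(1) by auto
    then have "a \<in> ?J" using YE(3) by blast
    then have "a \<in> sum_set P ?J"
      using subset_sum_set'[OF PE(2) ideal_in_carrier[OF Y J]] by blast
    moreover have "P \<subseteq> sum_set P ?J"
      using subset_sum_set[OF ideal_inD(2)[OF J] ideal_in_carrier[OF Y P(1)]] .
    ultimately have "sum_set P ?J \<inter> M \<noteq> {}"
      using max[OF ideal_in_sum_set[OF Y P(1) J]] a(2) by blast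
    then show ?thesis by (auto simp: sum_set_def)
  qed
  have "a \<in> P \<or> b \<in> P" if ab: "a \<in> Y" "b \<in> Y" "a \<otimes> b \<in> P" for a b
  proof (rule ccontr)
    assume "\<not> (a \<in> P \<or> b \<in> P)"
    then obtain p y q z where k: "p \<in> P" "y \<in> Y" "p \<oplus> a \<otimes> y \<in> M" "q \<in> P" "z \<in> Y" "q \<oplus> b \<otimes> z \<in> M"
      using meet ab by meson
    have c: "p \<in> carrier R" "y \<in> carrier R" "q \<in> carrier R" "z \<in> carrier R" "a \<in> carrier R" "b \<in> carrier R"
      using k ab YE(1) PE(1) by auto
    \<comment> \<open>The product of the elements of \<open>P + a Y\<close> and
      \<open>P + b Y\<close> found in \<open>M\<close> lies in \<open>P + a b Y\<close>, hence in
      \<open>P\<close>.\<close>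
    have "(p \<oplus> a \<otimes> y) \<otimes> (q \<oplus> b \<otimes> z) = (q \<oplus> b \<otimes> z) \<otimes> p \<oplus> ((a \<otimes> y) \<otimes> q \<oplus> (y \<otimes> z) \<otimes> (a \<otimes> b))"
      using c by algebra
    moreover have "\<dots> \<in> P"
      using k ab PE YE(6,7) by (meson subsetD)
    ultimately show False using M(3)[OF k(3,6)] P(3) by auto
  qed
  moreover have "\<one> \<notin> P" using P(3) M(2) by blast
  ultimately have "prime_in Y P" using P(1) by (simp add: prime_in_def)
  then show thesis using that P max by blast
qed

lemma exists_prime_in:
  assumes Y: "subring Y R" and I: "ideal_in Y I" "\<one> \<notin> I"
  shows "\<exists>P. prime_in Y P \<and> I \<subseteq> P"
  by (rule exists_prime_in_avoiding[OF Y I(1), of "{\<one>}"]) (use I(2) subringE(3)[OF Y] in auto)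

section \<open>Integral elements and the going-up theorem\<close>

primrec power_span :: "'a set \<Rightarrow> 'a \<Rightarrow> nat \<Rightarrow> 'a set"
  where "power_span U x 0 = {\<zero>}"
  | "power_span U x (Suc n) = {c \<otimes> x [^] n \<oplus> z | c z. c \<in> U \<and> z \<in> power_span U x n}"

lemma power_span_SucE:
  assumes "a \<in> power_span U x (Suc n)"
  obtains c z where "c \<in> U" "z \<in> power_span U x n" "a = c \<otimes> x [^] n \<oplus> z"
  using assms by auto

text \<open>\<open>power_span U x n\<close> is the \<open>U\<close>-module spanned by
  \<open>x^0, ..., x^(n-1)\<close>, so this is a monic equation of degree \<open>n\<close> for
  \<open>x\<close>. In this form it passes to larger \<open>U\<close> at once and exhibits finite
  modules. Degree 0 is possible only if \<open>\<one> = \<zero>\<close>.\<close>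

definition integral_over :: "'a set \<Rightarrow> 'a \<Rightarrow> bool"
  where "integral_over U x \<longleftrightarrow> (\<exists>n. x [^] n \<in> power_span U x n)"

lemma power_span_carrier:
  assumes "subring U R" "x \<in> carrier R"
  shows "power_span U x n \<subseteq> carrier R"
  using subringE(1)[OF assms(1)] assms(2) by (induction n) auto

lemma power_span_add:
  assumes "subring U R" "x \<in> carrier R"
  shows "a \<in> power_span U x n \<Longrightarrow> b \<in> power_span U x n \<Longrightarrow> a \<oplus> b \<in> power_span U x n"
proof (induction n arbitrary: a b)
  case (Suc n)
  obtain c z where a: "c \<in> U" "z \<in> power_span U x n" "a = c \<otimes> x [^] n \<oplus> z" using Suc.prems by auto
  obtain d w where b: "d \<in> U" "w \<in> power_span U x n" "b = d \<otimes> x [^] n \<oplus> w" using Suc.prems by auto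
  have k: "c \<in> carrier R" "d \<in> carrier R" "z \<in> carrier R" "w \<in> carrier R" "x [^] n \<in> carrier R"
    using a b assms subringE(1)[OF assms(1)] power_span_carrier[OF assms] by auto
  have "a \<oplus> b = (c \<oplus> d) \<otimes> x [^] n \<oplus> (z \<oplus> w)" unfolding a b using k by algebra
  then show ?case using Suc.IH[OF a(2) b(2)] subringE(7)[OF assms(1) a(1) b(1)] by auto
qed simp

lemma power_span_scale:
  assumes "subring U R" "x \<in> carrier R" "u \<in> U"
  shows "a \<in> power_span U x n \<Longrightarrow> u \<otimes> a \<in> power_span U x n"
proof (induction n arbitrary: a)
  case 0
  then show ?case using assms subringE(1)[OF assms(1)] by auto
next
  case (Suc n)
  obtain c z where a: "c \<in> U" "z \<in> power_span U x n" "a = c \<otimes> x [^] n \<oplus> z" using Suc.prems by auto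
  have k: "c \<in> carrier R" "u \<in> carrier R" "z \<in> carrier R" "x [^] n \<in> carrier R"
    using a assms subringE(1)[OF assms(1)] power_span_carrier[OF assms(1,2)] by auto
  have "u \<otimes> a = (u \<otimes> c) \<otimes> x [^] n \<oplus> u \<otimes> z" unfolding a using k by algebra
  then show ?case using Suc.IH[OF a(2)] subringE(6)[OF assms(1) assms(3) a(1)] by auto
qed

lemma power_span_Suc:
  assumes "subring U R" "x \<in> carrier R"
  shows "power_span U x n \<subseteq> power_span U x (Suc n)"
proof
  fix a assume a: "a \<in> power_span U x n"
  then have "a \<in> carrier R" using power_span_carrier[OF assms] by blast
  then have "\<zero> \<otimes> x [^] n \<oplus> a = a" using assms(2) by simp
  then show "a \<in> power_span U x (Suc n)"
    using a subringE(2)[OF assms(1)] unfolding power_span.simps by (metis (mono_tags, lifting) mem_Collect_eq)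
qed

lemma subset_power_span:
  assumes "subring U R" "x \<in> carrier R"
  shows "U \<subseteq> power_span U x (Suc n)"
proof (induction n)
  case 0
  have "u = u \<otimes> x [^] (0::nat) \<oplus> \<zero>" if "u \<in> U" for u
    using that assms subringE(1)[OF assms(1)] by auto
  then show ?case by auto
next
  case (Suc n)
  then show ?case using power_span_Suc[OF assms, of "Suc n"] by blast
qed

lemma power_span_mult_var:
  assumes "subring U R" "x \<in> carrier R"
  shows "a \<in> power_span U x n \<Longrightarrow> x \<otimes> a \<in> power_span U x (Suc n)"
proof (induction n arbitrary: a)
  case 0
  then show ?case using assms subset_power_span[OF assms, of 0] subringE(2)[OF assms(1)] by auto
next
  case (Suc n)
  obtain c z where a: "c \<in> U" "z \<in> power_span U x n" "a = c \<otimes> x [^] n \<oplus> z" using Suc.prems by auto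
  have k: "c \<in> carrier R" "z \<in> carrier R" "x [^] n \<in> carrier R"
    using a assms subringE(1)[OF assms(1)] power_span_carrier[OF assms(1,2)] by auto
  have "x \<otimes> a = c \<otimes> (x [^] n \<otimes> x) \<oplus> x \<otimes> z" unfolding a using k assms(2) by algebra
  then have "x \<otimes> a = c \<otimes> x [^] Suc n \<oplus> x \<otimes> z" by simp
  then show ?case using Suc.IH[OF a(2)] a(1) unfolding power_span.simps(2)[of U x "Suc n"] by blast
qed

lemma eval_mem_power_span:
  assumes "x \<in> carrier R"
  shows "set cs \<subseteq> U \<Longrightarrow> eval cs x \<in> power_span U x (length cs)"
  by (induction cs) auto

lemma integral_extension_imp_integral_over:
  assumes "integral_extension U R" "x \<in> carrier R"
  shows "integral_over U x"
proof -
  have U: "subring U R" using assms by (simp add: integral_extension_def)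
  obtain cs where cs: "set cs \<subseteq> U" "eval (\<one> # cs) x = \<zero>"
    using assms by (auto simp: integral_extension_def)
  let ?e = "eval cs x" and ?n = "length cs"
  have e: "?e \<in> power_span U x ?n" using eval_mem_power_span[OF assms(2) cs(1)] .
  then have ec: "?e \<in> carrier R" using power_span_carrier[OF U assms(2)] by blast
  have "x [^] ?n \<oplus> ?e = \<zero>" using cs(2) assms(2) by simp
  then have "x [^] ?n = (\<ominus> \<one>) \<otimes> ?e"
    using assms(2) ec minus_equality[of "x [^] ?n" ?e] l_minus[of \<one> ?e] by simp
  then have "x [^] ?n \<in> power_span U x ?n"
    using power_span_scale[OF U assms(2) subringE(5)[OF U subringE(3)[OF U]] e] by simp
  then show ?thesis by (auto simp: integral_over_def)
qed

lemma integral_over_mono: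
  assumes "U \<subseteq> V" "integral_over U x"
  shows "integral_over V x"
proof -
  have "power_span U x n \<subseteq> power_span V x n" for n
    using assms(1) by (induction n) auto
  then show ?thesis using assms(2) by (auto simp: integral_over_def)
qed

text \<open>Let \<open>Q\<close> be maximal among the ideals of \<open>Y\<close> that contain
  \<open>I\<close> and avoid \<open>U - P\<close>. If some \<open>a \<in> P\<close> were outside
  \<open>Q\<close>, then \<open>Q + a Y\<close> would contain some \<open>b = q + a y\<close> in
  \<open>U - P\<close>. Multiplying an integral equation of \<open>y\<close> by a power of
  \<open>a\<close> yields \<open>b^n - a d \<in> Q \<inter> U \<subseteq> P\<close> for some
  \<open>d \<in> U\<close>, whence \<open>b^n \<in> P\<close>. With \<open>I = 0\<close> this is
  lying over.\<close>

lemma going_up: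
  assumes U: "subring U R" and Y: "subring Y R" and UY: "U \<subseteq> Y"
    and int: "\<And>y. y \<in> Y \<Longrightarrow> integral_over U y"
    and P: "prime_in U P" and I: "ideal_in Y I" "I \<inter> U \<subseteq> P"
  obtains Q where "prime_in Y Q" "I \<subseteq> Q" "Q \<inter> U = P"
proof -
  note UE = subringE[OF U] and YE = subringE[OF Y] and PE = prime_inD[OF P]
  have PU: "P \<subseteq> U" using PE(1) ideal_inD(1) by blast
  obtain Q where Q: "prime_in Y Q" "I \<subseteq> Q" "Q \<inter> (U - P) = {}"
    and max: "\<And>J. ideal_in Y J \<Longrightarrow> Q \<subset> J \<Longrightarrow> J \<inter> (U - P) \<noteq> {}"
  proof (rule exists_prime_in_avoiding[OF Y I(1), of "U - P"])
    show "a \<otimes> b \<in> U - P" if "a \<in> U - P" "b \<in> U - P" for a b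
      using that UE(6) PE(3) by blast
  qed (use UY UE(3) PE(2) I(2) in auto)
  note QI = prime_inD(1)[OF Q(1)]
  note QE = ideal_inD[OF QI]
  have Yc: "\<And>y. y \<in> Y \<Longrightarrow> y \<in> carrier R" using YE(1) by blast
  have "a \<in> Q" if a: "a \<in> P" for a
  proof (rule ccontr)
    assume aQ: "a \<notin> Q"
    have aU: "a \<in> U" and aY: "a \<in> Y" and ac: "a \<in> carrier R" using a PU UY YE(1) by auto
    let ?J = "{a \<otimes> y | y. y \<in> Y}"
    have J: "ideal_in Y ?J" using ideal_in_principal[OF Y aY] .
    have "a = a \<otimes> \<one>" using ac by simp
    then have "a \<in> ?J" using YE(3) by blast
    then have "a \<in> sum_set Q ?J"
      using subset_sum_set'[OF QE(2) ideal_in_carrier[OF Y J]] by blast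
    moreover have "Q \<subseteq> sum_set Q ?J"
      using subset_sum_set[OF ideal_inD(2)[OF J] ideal_in_carrier[OF Y QI]] .
    ultimately have "sum_set Q ?J \<inter> (U - P) \<noteq> {}"
      using max[OF ideal_in_sum_set[OF Y QI J]] aQ by blast
    then obtain q y where q: "q \<in> Q" and y: "y \<in> Y" and b: "q \<oplus> a \<otimes> y \<in> U" "q \<oplus> a \<otimes> y \<notin> P"
      by (auto simp: sum_set_def)
    define b where "b = q \<oplus> a \<otimes> y"
    have bU: "b \<in> U" "b \<notin> P" using b by (auto simp: b_def)
    have qc: "q \<in> carrier R" and yc: "y \<in> carrier R" and bc: "b \<in> carrier R"
      using q y bU UE(1) QE(1) YE(1) by auto
    have ay: "a \<otimes> y = b \<oplus> (\<ominus> q)" unfolding b_def using ac yc qc by algebra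
    have nq: "\<ominus> q \<in> Q" using ideal_in_uminus[OF Y QI q] .
    have cong: "\<exists>s\<in>Q. (a \<otimes> y) [^] (n::nat) = b [^] n \<oplus> s" for n
    proof (induction n)
      case 0
      have "(a \<otimes> y) [^] (0::nat) = b [^] (0::nat) \<oplus> \<zero>" by simp
      then show ?case using QE(2) by blast
    next
      case (Suc m)
      then obtain s where s: "s \<in> Q" "(a \<otimes> y) [^] m = b [^] m \<oplus> s" by blast
      have sc: "s \<in> carrier R" "b [^] m \<in> carrier R" using s QE(1) Yc bc by auto
      have "(a \<otimes> y) [^] Suc m = (b [^] m \<oplus> s) \<otimes> (b \<oplus> (\<ominus> q))" using s ay by simp
      also have "\<dots> = b [^] m \<otimes> b \<oplus> (b [^] m \<otimes> (\<ominus> q) \<oplus> (b \<oplus> (\<ominus> q)) \<otimes> s)"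
        using sc bc qc by algebra
      finally have "(a \<otimes> y) [^] Suc m = b [^] Suc m \<oplus> (b [^] m \<otimes> (\<ominus> q) \<oplus> (a \<otimes> y) \<otimes> s)"
        using ay by simp
      moreover have "b [^] m \<otimes> (\<ominus> q) \<oplus> (a \<otimes> y) \<otimes> s \<in> Q"
        using QE(3,4) subring_power[OF U bU(1)] UY nq s(1) YE(6)[OF aY y] by blast
      ultimately show ?case by blast
    qed
    \<comment> \<open>For \<open>z = c_0 + ... + c_(n-1) y^(n-1)\<close> each term of
      \<open>a^n z\<close> equals \<open>c_i a^(n-i) (a y)^i\<close>, and \<open>(a y)^i\<close> is
      \<open>b^i\<close> modulo \<open>Q\<close>. Since \<open>i < n\<close>, a factor
      \<open>a\<close> remains in front.\<close>
    have span: "\<exists>d\<in>U. \<exists>r\<in>Q. a [^] n \<otimes> z = a \<otimes> d \<oplus> r" if "z \<in> power_span U y n" for z n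
      using that
    proof (induction n arbitrary: z)
      case 0
      have "a [^] (0::nat) \<otimes> z = a \<otimes> \<zero> \<oplus> \<zero>" using 0 ac by simp
      then show ?case using UE(2) QE(2) by blast
    next
      case (Suc n)
      obtain c w where z: "c \<in> U" "w \<in> power_span U y n" "z = c \<otimes> y [^] n \<oplus> w" using Suc.prems by auto
      obtain d r where d: "d \<in> U" "r \<in> Q" "a [^] n \<otimes> w = a \<otimes> d \<oplus> r" using Suc.IH[OF z(2)] by blast
      have k: "c \<in> carrier R" "w \<in> carrier R" "d \<in> carrier R" "r \<in> carrier R"
        "a [^] n \<in> carrier R" "y [^] n \<in> carrier R" "b [^] n \<in> carrier R"
        using z d UE(1) power_span_carrier[OF U yc] QE(1) Yc ac yc bc by auto
      obtain s where s: "s \<in> Q" "(a \<otimes> y) [^] n = b [^] n \<oplus> s" using cong by blast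
      have sc: "s \<in> carrier R" using s QE(1) Yc by auto
      have "a [^] Suc n \<otimes> z = a \<otimes> (c \<otimes> (a [^] n \<otimes> y [^] n) \<oplus> a [^] n \<otimes> w)"
        unfolding z nat_pow_Suc using k ac by algebra
      also have "\<dots> = a \<otimes> (c \<otimes> (b [^] n \<oplus> s) \<oplus> (a \<otimes> d \<oplus> r))"
        using s(2) d(3) nat_pow_distrib[OF ac yc, of n] by simp
      also have "\<dots> = a \<otimes> (c \<otimes> b [^] n \<oplus> a \<otimes> d) \<oplus> ((a \<otimes> c) \<otimes> s \<oplus> a \<otimes> r)"
        using k ac sc by algebra
      finally have "a [^] Suc n \<otimes> z = a \<otimes> (c \<otimes> b [^] n \<oplus> a \<otimes> d) \<oplus> ((a \<otimes> c) \<otimes> s \<oplus> a \<otimes> r)" .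
      moreover have "c \<otimes> b [^] n \<oplus> a \<otimes> d \<in> U"
        using UE(6,7) z(1) d(1) aU subring_power[OF U bU(1)] by blast
      moreover have "(a \<otimes> c) \<otimes> s \<oplus> a \<otimes> r \<in> Q"
        using QE(3,4) UE(6)[OF aU z(1)] UY s(1) d(2) aY by blast
      ultimately show ?case by blast
    qed
    obtain n where "y [^] n \<in> power_span U y n" using int[OF y] by (auto simp: integral_over_def)
    then obtain d r where d: "d \<in> U" "r \<in> Q" "a [^] n \<otimes> y [^] n = a \<otimes> d \<oplus> r" using span by blast
    obtain s where s: "s \<in> Q" "(a \<otimes> y) [^] n = b [^] n \<oplus> s" using cong by blast
    have k: "d \<in> carrier R" "r \<in> carrier R" "s \<in> carrier R" "b [^] n \<in> carrier R"
      using d s UE(1) QE(1) Yc bc by auto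
    have eq: "b [^] n \<oplus> s = a \<otimes> d \<oplus> r"
      using d(3) s(2) nat_pow_distrib[OF ac yc, of n] by simp
    have "r \<ominus> s = (a \<otimes> d \<oplus> r) \<ominus> s \<ominus> a \<otimes> d" using k ac by algebra
    also have "\<dots> = b [^] n \<ominus> a \<otimes> d" unfolding eq[symmetric] using k ac by algebra
    finally have rs: "b [^] n \<ominus> a \<otimes> d \<in> Q" using ideal_in_minus[OF Y QI d(2) s(1)] by simp
    have "b [^] n \<ominus> a \<otimes> d \<in> U"
      using subring_minus[OF U subring_power[OF U bU(1)] UE(6)[OF aU d(1)]] .
    then have "b [^] n \<ominus> a \<otimes> d \<in> P" using rs Q(3) by blast
    moreover have ad: "a \<otimes> d \<in> P"
      using ideal_inD(4)[OF PE(1) d(1) a] m_comm[OF ac k(1)] by simp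
    moreover have "(b [^] n \<ominus> a \<otimes> d) \<oplus> a \<otimes> d = b [^] n" using k ac by algebra
    ultimately have "b [^] n \<in> P" using ideal_inD(3)[OF PE(1)] by metis
    then show False using prime_in_power[OF U P bU(1)] bU(2) by blast
  qed
  then have "Q \<inter> U = P" using Q(3) PU by blast
  then show thesis using that Q by blast
qed


text \<open>
  The residual maps are always injective field homomorphisms, so only their surjectivity is demanded;
  denominators are cleared.
\<close>

definition subintegral_in :: "'a set \<Rightarrow> 'a set \<Rightarrow> bool"
  where "subintegral_in U Y \<longleftrightarrow>
    (\<forall>P Q. prime_in Y P \<longrightarrow> prime_in Y Q \<longrightarrow> P \<inter> U = Q \<inter> U \<longrightarrow> P = Q) \<and>
    (\<forall>Q. prime_in Y Q \<longrightarrow> (\<forall>y\<in>Y. \<exists>u\<in>U. \<exists>v\<in>U - Q. \<exists>q\<in>Q. v \<otimes> y = u \<oplus> q))"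

section \<open>Subintegrality in towers\<close>

lemma subintegral_inD:
  assumes "subintegral_in U Y"
  shows "\<And>P Q. prime_in Y P \<Longrightarrow> prime_in Y Q \<Longrightarrow> P \<inter> U = Q \<inter> U \<Longrightarrow> P = Q"
    "\<And>Q y. prime_in Y Q \<Longrightarrow> y \<in> Y \<Longrightarrow> \<exists>u\<in>U. \<exists>v\<in>U - Q. \<exists>q\<in>Q. v \<otimes> y = u \<oplus> q"
  using assms by (auto simp: subintegral_in_def)

lemma subintegral_in_upper:
  assumes "U \<subseteq> V" "V \<subseteq> Y" "subintegral_in U Y"
  shows "subintegral_in V Y"
  unfolding subintegral_in_def
proof (intro conjI allI impI ballI)
  fix P Q assume PQ: "prime_in Y P" "prime_in Y Q" "P \<inter> V = Q \<inter> V"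
  then have "P \<inter> U = Q \<inter> U" using assms(1) by blast
  then show "P = Q" using subintegral_inD(1)[OF assms(3) PQ(1,2)] by blast
next
  fix Q y assume "prime_in Y Q" "y \<in> Y"
  then obtain u v q where "u \<in> U" "v \<in> U - Q" "q \<in> Q" "v \<otimes> y = u \<oplus> q"
    using subintegral_inD(2)[OF assms(3)] by blast
  then show "\<exists>u\<in>V. \<exists>v\<in>V - Q. \<exists>q\<in>Q. v \<otimes> y = u \<oplus> q"
    using assms(1) by blast
qed

text \<open>Every prime of \<open>V\<close> is the trace of a prime of \<open>Y\<close> by lying
  over, so both conditions can be checked in \<open>Y\<close>. In \<open>v y = u + q\<close> with
  \<open>y \<in> V\<close> the error term \<open>q\<close> is automatically in
  \<open>V\<close>.\<close>

lemma subintegral_in_lower: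
  assumes U: "subring U R" and V: "subring V R" and Y: "subring Y R" and UV: "U \<subseteq> V" and VY: "V \<subseteq> Y"
    and int: "\<And>y. y \<in> Y \<Longrightarrow> integral_over U y" and sub: "subintegral_in U Y"
  shows "subintegral_in U V"
proof -
  have lift: "\<exists>Q. prime_in Y Q \<and> Q \<inter> V = P" if P: "prime_in V P" for P
  proof -
    have "ideal_in Y {\<zero>}"
      using subringE(1,2)[OF Y] by (auto simp: ideal_in_def)
    moreover have "{\<zero>} \<inter> V \<subseteq> P" using ideal_inD(2)[OF prime_inD(1)[OF P]] by blast
    ultimately show ?thesis
      using going_up[OF V Y VY integral_over_mono[OF UV int] P] by metis
  qed
  show ?thesis
    unfolding subintegral_in_def
  proof (intro conjI allI impI ballI)
    fix P P' assume PP: "prime_in V P" "prime_in V P'" "P \<inter> U = P' \<inter> U"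
    obtain Q Q' where Q: "prime_in Y Q" "Q \<inter> V = P" "prime_in Y Q'" "Q' \<inter> V = P'"
      using lift PP by meson
    then have "Q \<inter> U = Q' \<inter> U" using PP(3) UV by blast
    then show "P = P'" using subintegral_inD(1)[OF sub Q(1,3)] Q by blast
  next
    fix P y assume P: "prime_in V P" and y: "y \<in> V"
    obtain Q where Q: "prime_in Y Q" "Q \<inter> V = P" using lift P by blast
    obtain u v q where uvq: "u \<in> U" "v \<in> U - Q" "q \<in> Q" "v \<otimes> y = u \<oplus> q"
      using subintegral_inD(2)[OF sub Q(1)] y VY by blast
    have c: "u \<in> carrier R" "q \<in> carrier R"
      using uvq subringE(1)[OF U] ideal_in_carrier[OF Y prime_inD(1)[OF Q(1)]] by auto
    have "v \<otimes> y \<in> V" using uvq(2) y UV subringE(6)[OF V] by blast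
    then have "q \<oplus> u \<in> V" unfolding uvq(4) a_comm[OF c] .
    then have "q \<in> V" using subring_add_cancel[OF V c(2)] uvq(1) UV by blast
    then show "\<exists>u\<in>U. \<exists>v\<in>U - P. \<exists>q\<in>P. v \<otimes> y = u \<oplus> q"
      using uvq Q(2) by blast
  qed
qed

lemma subintegral_in_trans:
  assumes U: "subring U R" and V: "subring V R" and Y: "subring Y R" and UV: "U \<subseteq> V" and VY: "V \<subseteq> Y"
    and s1: "subintegral_in U V" and s2: "subintegral_in V Y"
  shows "subintegral_in U Y"
  unfolding subintegral_in_def
proof (intro conjI allI impI ballI)
  fix P Q assume PQ: "prime_in Y P" "prime_in Y Q" "P \<inter> U = Q \<inter> U"
  have "(P \<inter> V) \<inter> U = (Q \<inter> V) \<inter> U" using PQ(3) UV by blast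
  then have "P \<inter> V = Q \<inter> V"
    using subintegral_inD(1)[OF s1] prime_in_Int[OF V VY] PQ by blast
  then show "P = Q" using subintegral_inD(1)[OF s2 PQ(1,2)] by blast
next
  fix Q y assume Q: "prime_in Y Q" and y: "y \<in> Y"
  note UE = subringE[OF U] and QE = ideal_inD[OF prime_inD(1)[OF Q]]
  have QV: "prime_in V (Q \<inter> V)" using prime_in_Int[OF V VY Q] .
  \<comment> \<open>Modulo \<open>Q\<close>, first \<open>y = v / w\<close> over \<open>V\<close>,
    then \<open>v = u / a\<close> and \<open>w = c / b\<close> over \<open>U\<close>, so that
    \<open>y = (b u) / (a c)\<close>. Here \<open>c\<close> is outside \<open>Q\<close> because
    \<open>b\<close> and \<open>w\<close> are.\<close>
  obtain v w q where 1: "v \<in> V" "w \<in> V - Q" "q \<in> Q" "w \<otimes> y = v \<oplus> q"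
    using subintegral_inD(2)[OF s2 Q y] by blast
  obtain u a r where 2: "u \<in> U" "a \<in> U - Q" "r \<in> Q" "a \<otimes> v = u \<oplus> r"
    using subintegral_inD(2)[OF s1 QV 1(1)] UV by blast
  obtain c b s where 3: "c \<in> U" "b \<in> U - Q" "s \<in> Q" "b \<otimes> w = c \<oplus> s"
    using subintegral_inD(2)[OF s1 QV, of w] 1(2) UV by blast
  have inY: "a \<in> Y" "b \<in> Y" "c \<in> Y" "w \<in> Y" "u \<in> Y" "s \<in> Y" "r \<in> Y" "q \<in> Y" "v \<in> Y"
    using 1 2 3 UV VY QE(1) by auto
  then have k: "a \<in> carrier R" "b \<in> carrier R" "c \<in> carrier R" "w \<in> carrier R" "u \<in> carrier R"
    "s \<in> carrier R" "r \<in> carrier R" "q \<in> carrier R" "v \<in> carrier R" "y \<in> carrier R"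
    using y subringE(1)[OF Y] by auto
  have "c \<notin> Q"
  proof
    assume "c \<in> Q"
    then have "b \<otimes> w \<in> Q" using 3(3,4) QE(3) by simp
    then show False using prime_inD(3)[OF Q] inY 1(2) 3(2) by blast
  qed
  then have ac: "a \<otimes> c \<in> U - Q" using prime_inD(3)[OF Q] inY UE(6) 2(2) 3(1) by blast
  have "(a \<otimes> c) \<otimes> y = a \<otimes> ((c \<oplus> s) \<otimes> y) \<ominus> (a \<otimes> y) \<otimes> s" using k by algebra
  also have "\<dots> = b \<otimes> (a \<otimes> (w \<otimes> y)) \<ominus> (a \<otimes> y) \<otimes> s" unfolding 3(4)[symmetric] using k by algebra
  also have "\<dots> = b \<otimes> (a \<otimes> v) \<oplus> ((b \<otimes> a) \<otimes> q \<ominus> (a \<otimes> y) \<otimes> s)" unfolding 1(4) using k by algebra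
  also have "\<dots> = b \<otimes> u \<oplus> (b \<otimes> r \<oplus> ((b \<otimes> a) \<otimes> q \<ominus> (a \<otimes> y) \<otimes> s))" unfolding 2(4) using k by algebra
  finally have eq: "(a \<otimes> c) \<otimes> y = b \<otimes> u \<oplus> (b \<otimes> r \<oplus> ((b \<otimes> a) \<otimes> q \<ominus> (a \<otimes> y) \<otimes> s))" .
  have "b \<otimes> r \<in> Q" "(b \<otimes> a) \<otimes> q \<in> Q" "(a \<otimes> y) \<otimes> s \<in> Q"
    using QE(4) inY y 1(3) 2(3) 3(3) subringE(6)[OF Y] by auto
  then have "b \<otimes> r \<oplus> ((b \<otimes> a) \<otimes> q \<ominus> (a \<otimes> y) \<otimes> s) \<in> Q"
    using QE(3) ideal_in_minus[OF Y prime_inD(1)[OF Q]] by blast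
  moreover have "b \<otimes> u \<in> U" using UE(6) 2(1) 3(2) by blast
  ultimately show "\<exists>u\<in>U. \<exists>v\<in>U - Q. \<exists>q\<in>Q. v \<otimes> y = u \<oplus> q" using eq ac by blast
qed

text \<open>At a prime containing \<open>J\<close> the residue classes come from
  \<open>Y = U + J\<close>. At a prime \<open>Q\<close> with some \<open>j \<in> J - Q\<close>, the
  two rings agree after inverting \<open>j \<otimes> j\<close>, as
  \<open>j j Y \<subseteq> J J \<subseteq> U\<close>. This makes the steps down to an intersection
  subintegral in \<open>ramified_diamond_side\<close>.\<close>

lemma subintegral_in_if_square:
  assumes U: "subring U R" and Y: "subring Y R" and UY: "U \<subseteq> Y" and J: "ideal_in Y J"
    and sum: "Y \<subseteq> sum_set U J" and sq: "\<And>i j. i \<in> J \<Longrightarrow> j \<in> J \<Longrightarrow> i \<otimes> j \<in> U"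
  shows "subintegral_in U Y"
proof -
  note UE = subringE[OF U] and YE = subringE[OF Y] and JE = ideal_inD[OF J]
  have sub: "P \<subseteq> Q" if P: "prime_in Y P" and Q: "prime_in Y Q" and eq: "P \<inter> U = Q \<inter> U" for P Q
  proof
    fix p assume p: "p \<in> P"
    note PE = ideal_inD[OF prime_inD(1)[OF P]] and QE = ideal_inD[OF prime_inD(1)[OF Q]]
    have pY: "p \<in> Y" using p PE(1) by blast
    show "p \<in> Q"
    proof (cases "J \<subseteq> Q")
      case True
      obtain u j where uj: "u \<in> U" "j \<in> J" "p = u \<oplus> j" using sum pY by (blast elim: sum_setE)
      have jY: "j \<in> Y" using uj JE(1) by blast
      \<comment> \<open>The traces on \<open>U\<close> see only the square
        \<open>j \<otimes> j\<close>; through it, \<open>J \<subseteq> Q\<close> forces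
        \<open>j \<in> P\<close>.\<close>
      have "j \<otimes> j \<in> Q" using True uj(2) QE(4) jY by blast
      then have "j \<otimes> j \<in> P" using sq[OF uj(2) uj(2)] eq by blast
      then have "j \<in> P" using prime_inD(3)[OF P jY jY] by blast
      then have "u \<in> P"
        using ideal_in_add_cancel[OF Y prime_inD(1)[OF P], of u j] uj p UE(1) by blast
      then have "u \<in> Q" using eq uj(1) by blast
      then show ?thesis using uj True QE(3) by blast
    next
      case False
      then obtain j where j: "j \<in> J" "j \<notin> Q" by blast
      have jY: "j \<in> Y" using j JE(1) by blast
      have k: "j \<in> carrier R" "p \<in> carrier R" using jY pY YE(1) by auto
      have "j \<otimes> (p \<otimes> j) \<in> U" using sq j JE(4) pY by blast
      moreover have "j \<otimes> (p \<otimes> j) = (j \<otimes> j) \<otimes> p" using k by algebra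
      moreover have "(j \<otimes> j) \<otimes> p \<in> P" using PE(4) YE(6) jY p by blast
      ultimately have "(j \<otimes> j) \<otimes> p \<in> Q" using eq by auto
      then show ?thesis using prime_inD(3)[OF Q] jY pY YE(6) j(2) by blast
    qed
  qed
  show ?thesis
    unfolding subintegral_in_def
  proof (intro conjI allI impI ballI)
    fix P Q assume "prime_in Y P" "prime_in Y Q" "P \<inter> U = Q \<inter> U"
    then show "P = Q" using sub[of P Q] sub[of Q P] by blast
  next
    fix Q y assume Q: "prime_in Y Q" and y: "y \<in> Y"
    note QE = ideal_inD[OF prime_inD(1)[OF Q]]
    show "\<exists>u\<in>U. \<exists>v\<in>U - Q. \<exists>q\<in>Q. v \<otimes> y = u \<oplus> q"
    proof (cases "J \<subseteq> Q")
      case True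
      obtain u j where uj: "u \<in> U" "j \<in> J" "y = u \<oplus> j" using sum y by (blast elim: sum_setE)
      have "\<one> \<otimes> y = u \<oplus> j" using uj y YE(1) by auto
      then show ?thesis using uj True UE(3) prime_inD(2)[OF Q] by blast
    next
      case False
      then obtain j where j: "j \<in> J" "j \<notin> Q" by blast
      have jY: "j \<in> Y" using j JE(1) by blast
      have k: "j \<in> carrier R" "y \<in> carrier R" using jY y YE(1) by auto
      have "(j \<otimes> j) \<otimes> y = j \<otimes> (y \<otimes> j) \<oplus> \<zero>" using k by algebra
      moreover have "j \<otimes> (y \<otimes> j) \<in> U" using sq j JE(4) y by blast
      moreover have "j \<otimes> j \<in> U - Q" using sq j prime_inD(3)[OF Q jY jY] by blast
      ultimately show ?thesis using QE(2) by blast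
    qed
  qed
qed

section \<open>Minimal ring extensions and their conductors\<close>

definition maximal_subring :: "'a set \<Rightarrow> 'a set \<Rightarrow> bool"
  where "maximal_subring U Y \<longleftrightarrow> subring U R \<and> subring Y R \<and> U \<subset> Y \<and>
    (\<forall>A. subring A R \<longrightarrow> U \<subset> A \<longrightarrow> A \<subseteq> Y \<longrightarrow> A = Y)"

lemma maximal_subringD:
  assumes "maximal_subring U Y"
  shows "subring U R" "subring Y R" "U \<subset> Y"
    "\<And>A. subring A R \<Longrightarrow> U \<subset> A \<Longrightarrow> A \<subseteq> Y \<Longrightarrow> A = Y"
  using assms by (auto simp: maximal_subring_def)

text \<open>The span of the powers below the degree of an integral equation of \<open>x\<close> is
  closed under multiplication, hence a ring, and maximality makes it all of \<open>Y\<close>. The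
  degree is written \<open>Suc n\<close> so that the span visibly contains \<open>U\<close>.\<close>

lemma maximal_subring_power_span:
  assumes max: "maximal_subring U Y" and x: "x \<in> Y" "x \<notin> U" and int: "integral_over U x"
  obtains n where "Y = power_span U x (Suc n)"
proof -
  note U = maximal_subringD(1)[OF max] and Y = maximal_subringD(2)[OF max]
  note UE = subringE[OF U] and YE = subringE[OF Y]
  have xc: "x \<in> carrier R" using x YE(1) by blast
  obtain m where m: "x [^] m \<in> power_span U x m" using int by (auto simp: integral_over_def)
  \<comment> \<open>An equation of degree 0 would mean the zero ring, where no \<open>x\<close> lies
    outside \<open>U\<close>.\<close>
  have "m \<noteq> 0"
  proof
    assume "m = 0"
    then have one: "\<one> = \<zero>" using m by simp
    have "x = \<one> \<otimes> x" using xc by simp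
    then have "x = \<zero>" using one xc by simp
    then show False using x(2) UE(2) by simp
  qed
  then obtain n where n: "m = Suc n" by (cases m) auto
  let ?N = "power_span U x m"
  note add = power_span_add[OF U xc] and scale = power_span_scale[OF U xc]
  have UN: "U \<subseteq> ?N" using subset_power_span[OF U xc] n by simp
  have shift: "x \<otimes> a \<in> ?N" if aN: "a \<in> ?N" for a
  proof -
    obtain c z where "c \<in> U" "z \<in> ?N" "x \<otimes> a = c \<otimes> x [^] m \<oplus> z"
      by (rule power_span_SucE[OF power_span_mult_var[OF U xc aN]])
    then show ?thesis using add scale m by metis
  qed
  have pow: "x [^] (k::nat) \<otimes> a \<in> ?N" if "a \<in> ?N" for k a
  proof (induction k)
    case 0
    then show ?case using that power_span_carrier[OF U xc, of m] by auto
  next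
    case (Suc k)
    have "a \<in> carrier R" "x [^] k \<in> carrier R" using that power_span_carrier[OF U xc, of m] xc by auto
    then have "(x [^] k \<otimes> x) \<otimes> a = x \<otimes> (x [^] k \<otimes> a)" using xc by algebra
    then show ?case using shift[OF Suc] by simp
  qed
  have mult: "b \<otimes> a \<in> ?N" if a: "a \<in> ?N" and "b \<in> power_span U x k" for a b k
    using that(2)
  proof (induction k arbitrary: b)
    case 0
    have "a \<in> carrier R" using a power_span_carrier[OF U xc, of m] by blast
    then show ?case using 0 UN UE(2) by auto
  next
    case (Suc k)
    then obtain c z where b: "c \<in> U" "z \<in> power_span U x k" "b = c \<otimes> x [^] k \<oplus> z" by auto
    have k: "c \<in> carrier R" "z \<in> carrier R" "x [^] k \<in> carrier R" "a \<in> carrier R"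
      using a b UE(1) power_span_carrier[OF U xc] xc by auto
    have "b \<otimes> a = c \<otimes> (x [^] k \<otimes> a) \<oplus> z \<otimes> a" unfolding b using k by algebra
    then show ?case using add scale[OF b(1) pow[OF a]] Suc.IH[OF b(2)] by metis
  qed
  have "subring ?N R"
  proof (rule subringI)
    show "?N \<subseteq> carrier R" using power_span_carrier[OF U xc] .
    show "\<one> \<in> ?N" using UN UE(3) by blast
    fix a assume a: "a \<in> ?N"
    have "a \<in> carrier R" using a power_span_carrier[OF U xc, of m] by blast
    then have "\<ominus> a = (\<ominus> \<one>) \<otimes> a" by algebra
    then show "\<ominus> a \<in> ?N" using scale[OF UE(5)[OF UE(3)] a] by simp
  qed (use mult add in blast)+
  moreover have "x \<in> ?N" using shift[of \<one>] UN UE(3) xc by auto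
  moreover have "power_span U x k \<subseteq> Y" for k
  proof (induction k)
    case (Suc k)
    show ?case
    proof
      fix a assume "a \<in> power_span U x (Suc k)"
      then obtain c z where a: "c \<in> U" "z \<in> power_span U x k" "a = c \<otimes> x [^] k \<oplus> z"
        by (rule power_span_SucE)
      then have "c \<in> Y" "z \<in> Y" using maximal_subringD(3)[OF max] Suc by blast+
      then show "a \<in> Y" using a(3) YE(6,7) subring_power[OF Y x(1)] by simp
    qed
  qed (use YE(2) in simp)
  ultimately have "?N = Y"
    using maximal_subringD(4)[OF max] UN x(2) by blast
  then show thesis using that n by blast
qed

text \<open>Nakayama's lemma for the finite module \<open>Y / U\<close>, which equals \<open>a (Y / U)\<close> by maximality.\<close>

lemma maximal_subring_conductor:
  assumes max: "maximal_subring U Y" and int: "\<And>y. y \<in> Y \<Longrightarrow> integral_over U y"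
    and a: "a \<in> U" and y0: "y0 \<in> Y" "a \<otimes> y0 \<notin> U"
  shows "\<exists>b\<in>U. \<exists>c\<in>U. (\<forall>y\<in>Y. c \<otimes> y \<in> U) \<and> c \<oplus> a \<otimes> b = \<one>"
proof -
  note U = maximal_subringD(1)[OF max] and Y = maximal_subringD(2)[OF max]
  note UE = subringE[OF U] and YE = subringE[OF Y] and UY = maximal_subringD(3)[OF max]
  have Uc: "\<And>u. u \<in> U \<Longrightarrow> u \<in> carrier R" and Yc: "\<And>y. y \<in> Y \<Longrightarrow> y \<in> carrier R"
    using UE(1) YE(1) by auto
  have ac: "a \<in> carrier R" and aY: "a \<in> Y" using a UE(1) UY by auto
  let ?J = "{a \<otimes> y | y. y \<in> Y}"
  have J: "ideal_in Y ?J" using ideal_in_principal[OF Y aY] .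
  note adj = subring_sum_set_ideal[OF U Y psubset_imp_subset[OF UY] J]
  have "a \<otimes> y0 \<in> ?J" using y0(1) by blast
  then have Yeq: "sum_set U ?J = Y"
    using maximal_subringD(4)[OF max adj(1) _ adj(4)] adj(2,3) y0(2) by blast
  obtain x where x: "x \<in> Y" "x \<notin> U" using UY by blast
  have xc: "x \<in> carrier R" using x YE(1) by blast
  note scale = power_span_scale[OF U xc] and add = power_span_add[OF U xc]
  obtain n where n: "Y = power_span U x (Suc n)"
    using maximal_subring_power_span[OF max x int[OF x(1)]] .
  \<comment> \<open>The generators \<open>x^n, x^(n-1), ...\<close> are eliminated one at a time: a
    factor \<open>c\<close> congruent to \<open>\<one>\<close> modulo \<open>a U\<close> pushes
    \<open>Y\<close> into the span of the first \<open>n - k + 1\<close> powers. For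
    \<open>k = n\<close> this span is \<open>U\<close>.\<close>
  have step: "\<exists>b\<in>U. \<exists>c\<in>U. (\<forall>y\<in>Y. c \<otimes> y \<in> power_span U x (Suc (n - k))) \<and> c \<oplus> a \<otimes> b = \<one>"
    if "k \<le> n" for k
    using that
  proof (induction k)
    case 0
    have "\<one> \<oplus> a \<otimes> \<zero> = \<one>" using ac by simp
    moreover have "\<forall>y\<in>Y. \<one> \<otimes> y \<in> power_span U x (Suc n)" using Yc n by simp
    ultimately show ?case using UE(2,3) by auto
  next
    case (Suc k)
    then obtain b c where bc: "b \<in> U" "c \<in> U" "c \<oplus> a \<otimes> b = \<one>"
      and cY: "\<And>y. y \<in> Y \<Longrightarrow> c \<otimes> y \<in> power_span U x (Suc (n - k))" by auto
    define j where "j = n - Suc k"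
    have nk: "n - k = Suc j" using Suc.prems by (simp add: j_def)
    let ?x = "x [^] Suc j"
    have xj: "?x \<in> Y" using subring_power[OF Y x(1)] .
    have "?x \<in> sum_set U ?J" unfolding Yeq by (fact xj)
    then obtain u i where u': "u \<in> U" "i \<in> ?J" "?x = u \<oplus> i" by (rule sum_setE)
    obtain y where y: "y \<in> Y" "i = a \<otimes> y" using u'(2) by blast
    note u = u'(1) y(1) u'(3)[unfolded y(2)]
    obtain e z where e: "e \<in> U" "z \<in> power_span U x (Suc j)" "c \<otimes> y = e \<otimes> ?x \<oplus> z"
      by (rule power_span_SucE[OF cY[OF u(2), unfolded nk]])
    \<comment> \<open>With \<open>x^(j+1) = u + a y\<close> and \<open>c y = e x^(j+1) + z\<close>,
      the terms in \<open>x^(j+1)\<close> combine to \<open>(c - a e) x^(j+1) = c u + a z\<close>,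
      which involves lower powers only. So \<open>d\<close> lowers the leading term of every
      \<open>c w\<close>.\<close>
    define d where "d = c \<ominus> a \<otimes> e"
    have dU: "d \<in> U" unfolding d_def using subring_minus[OF U bc(2) UE(6)[OF a e(1)]] .
    have k: "u \<in> carrier R" "y \<in> carrier R" "e \<in> carrier R" "z \<in> carrier R" "c \<in> carrier R"
      "b \<in> carrier R" "?x \<in> carrier R" "d \<in> carrier R"
      using u(1,2) e(1) bc(1,2) Uc Yc subsetD[OF power_span_carrier[OF U xc] e(2)] xj dU by blast+
    have "d \<otimes> ?x = c \<otimes> ?x \<ominus> a \<otimes> (e \<otimes> ?x)" unfolding d_def using k ac by algebra
    also have "\<dots> = c \<otimes> u \<oplus> a \<otimes> (c \<otimes> y) \<ominus> a \<otimes> (e \<otimes> ?x)"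
    proof -
      have "c \<otimes> ?x = c \<otimes> u \<oplus> a \<otimes> (c \<otimes> y)" unfolding u(3) using k(1,2,5) ac by algebra
      then show ?thesis by simp
    qed
    also have "\<dots> = c \<otimes> u \<oplus> a \<otimes> z" unfolding e(3) using k ac by algebra
    finally have "d \<otimes> ?x = c \<otimes> u \<oplus> a \<otimes> z" .
    moreover have "c \<otimes> u \<in> power_span U x (Suc j)" using subset_power_span[OF U xc] UE(6)[OF bc(2) u(1)] by blast
    ultimately have dx: "d \<otimes> ?x \<in> power_span U x (Suc j)"
      using add[of _ "Suc j"] scale[OF a e(2)] by auto
    have "(d \<otimes> c) \<otimes> w \<in> power_span U x (Suc j)" if w: "w \<in> Y" for w
    proof -
      obtain f v where f: "f \<in> U" "v \<in> power_span U x (Suc j)" "c \<otimes> w = f \<otimes> ?x \<oplus> v"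
        by (rule power_span_SucE[OF cY[OF w, unfolded nk]])
      have kw: "w \<in> carrier R" "f \<in> carrier R" "v \<in> carrier R"
        using w f(1) Uc Yc subsetD[OF power_span_carrier[OF U xc] f(2)] by blast+
      have "(d \<otimes> c) \<otimes> w = d \<otimes> (c \<otimes> w)" using k kw by algebra
      also have "\<dots> = f \<otimes> (d \<otimes> ?x) \<oplus> d \<otimes> v" unfolding f(3) using k kw by algebra
      finally have "(d \<otimes> c) \<otimes> w = f \<otimes> (d \<otimes> ?x) \<oplus> d \<otimes> v" .
      then show ?thesis using add scale[OF f(1) dx] scale[OF dU f(2)] by metis
    qed
    \<comment> \<open>The new cofactor results from \<open>d c = c c - a e c\<close> on substituting
      \<open>c = \<one> - a b\<close>.\<close>
    moreover have "d \<otimes> c \<oplus> a \<otimes> (e \<otimes> c \<oplus> (b \<otimes> c \<oplus> b)) = \<one>"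
    proof -
      have "d \<otimes> c \<oplus> a \<otimes> (e \<otimes> c \<oplus> (b \<otimes> c \<oplus> b)) = (c \<oplus> a \<otimes> b) \<otimes> c \<oplus> a \<otimes> b"
        unfolding d_def using k ac by algebra
      also have "\<dots> = \<one>" unfolding bc(3) using k(5) bc(3) by simp
      finally show ?thesis .
    qed
    moreover have "d \<otimes> c \<in> U" "e \<otimes> c \<oplus> (b \<otimes> c \<oplus> b) \<in> U" using UE(6,7) dU bc e(1) by auto
    ultimately show ?case unfolding j_def[symmetric] by blast
  qed
  have "U = power_span U x (Suc 0)"
  proof
    show "power_span U x (Suc 0) \<subseteq> U" using Uc by auto
  qed (rule subset_power_span[OF U xc])
  then show ?thesis using step[of n] by auto
qed


text \<open>Minimal extensions of this kind are called ramified; \<open>Q\<close> lies over the conductor \<open>Q \<inter> U\<close>.\<close>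

definition ramified_at :: "'a set \<Rightarrow> 'a set \<Rightarrow> 'a set \<Rightarrow> bool"
  where "ramified_at U Y Q \<longleftrightarrow> prime_in Y Q \<and> Y \<subseteq> sum_set U Q \<and>
    (\<forall>p\<in>Q. \<forall>q\<in>Q. p \<otimes> q \<in> U) \<and> (\<forall>d\<in>U - Q. \<exists>b\<in>U. \<exists>c\<in>Q \<inter> U. c \<oplus> d \<otimes> b = \<one>)"

lemma ramified_atD:
  assumes "ramified_at U Y Q"
  shows "prime_in Y Q" "ideal_in Y Q" "Y \<subseteq> sum_set U Q" "\<And>p q. p \<in> Q \<Longrightarrow> q \<in> Q \<Longrightarrow> p \<otimes> q \<in> U"
    "\<And>d. d \<in> U \<Longrightarrow> d \<notin> Q \<Longrightarrow> \<exists>b\<in>U. \<exists>c\<in>Q \<inter> U. c \<oplus> d \<otimes> b = \<one>"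
  using assms by (auto simp: ramified_at_def prime_in_def)

lemma exists_ramified_at:
  assumes max: "maximal_subring U Y" and int: "\<And>y. y \<in> Y \<Longrightarrow> integral_over U y"
    and sub: "subintegral_in U Y"
  obtains Q where "ramified_at U Y Q"
proof -
  note U = maximal_subringD(1)[OF max] and Y = maximal_subringD(2)[OF max]
  note UE = subringE[OF U] and YE = subringE[OF Y] and UsY = maximal_subringD(3)[OF max]
  have UY: "U \<subseteq> Y" using UsY by blast
  have Yc: "\<And>y. y \<in> Y \<Longrightarrow> y \<in> carrier R" and Uc: "\<And>y. y \<in> U \<Longrightarrow> y \<in> carrier R"
    using UE(1) YE(1) by auto
  define C where "C = {c \<in> U. \<forall>y\<in>Y. c \<otimes> y \<in> U}"
  have CU: "C \<subseteq> U" and Cmul: "\<And>c y. c \<in> C \<Longrightarrow> y \<in> Y \<Longrightarrow> c \<otimes> y \<in> U"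
    by (auto simp: C_def)
  have unit: "\<exists>b\<in>U. \<exists>c\<in>C. c \<oplus> d \<otimes> b = \<one>" if d: "d \<in> U" "d \<notin> C" for d
  proof -
    obtain y where y: "y \<in> Y" "d \<otimes> y \<notin> U" using d by (auto simp: C_def)
    obtain b c where "b \<in> U" "c \<in> U" "\<forall>y\<in>Y. c \<otimes> y \<in> U" "c \<oplus> d \<otimes> b = \<one>"
      using maximal_subring_conductor[OF max int d(1) y] by blast
    then show ?thesis by (auto simp: C_def)
  qed
  have C1: "\<one> \<notin> C"
  proof
    assume "\<one> \<in> C"
    then have "Y \<subseteq> U" using Cmul Yc by (metis l_one subsetI)
    then show False using UsY by blast
  qed
  have CI: "ideal_in Y C"
    unfolding ideal_in_def
  proof (intro conjI ballI)
    show "C \<subseteq> Y" using CU UY by blast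
    show "\<zero> \<in> C" using UE(2) Yc by (simp add: C_def)
    fix a assume a: "a \<in> C"
    have ac: "a \<in> U" "a \<in> carrier R" using a CU Uc by auto
    show "a \<oplus> b \<in> C" if b: "b \<in> C" for b
    proof -
      have bc: "b \<in> U" "b \<in> carrier R" using b CU Uc by auto
      have "(a \<oplus> b) \<otimes> y \<in> U" if "y \<in> Y" for y
        using UE(7)[OF Cmul[OF a that] Cmul[OF b that]] l_distr[OF ac(2) bc(2) Yc[OF that]] by simp
      then show ?thesis using UE(7)[OF ac(1) bc(1)] by (simp add: C_def)
    qed
    show "y \<otimes> a \<in> C" if y: "y \<in> Y" for y
    proof -
      have "(y \<otimes> a) \<otimes> z = a \<otimes> (y \<otimes> z)" if "z \<in> Y" for z
        using ac(2) Yc[OF y] Yc[OF that] by algebra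
      then have "(y \<otimes> a) \<otimes> z \<in> U" if "z \<in> Y" for z
        using Cmul[OF a YE(6)[OF y that]] that by simp
      moreover have "y \<otimes> a \<in> U" using Cmul[OF a y] m_comm[OF ac(2) Yc[OF y]] by simp
      ultimately show ?thesis by (simp add: C_def)
    qed
  qed
  have CIU: "ideal_in U C" using ideal_in_Int[OF U UY CI] CU by (simp add: Int_absorb2)
  have max_C: "P \<inter> U = C" if P: "prime_in Y P" "C \<subseteq> P" for P
  proof
    show "C \<subseteq> P \<inter> U" using P CU by blast
    show "P \<inter> U \<subseteq> C"
    proof (rule ccontr)
      assume "\<not> P \<inter> U \<subseteq> C"
      then obtain d where d: "d \<in> P" "d \<in> U" "d \<notin> C" by blast
      then obtain b c where bc: "b \<in> U" "c \<in> C" "c \<oplus> d \<otimes> b = \<one>" using unit by blast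
      note PE = ideal_inD[OF prime_inD(1)[OF P(1)]]
      have "d \<otimes> b \<in> P" using PE(4)[of b d] d bc(1) UY m_comm[OF Uc Uc] by auto
      then have "\<one> \<in> P" using PE(3)[of c "d \<otimes> b"] bc P(2) by auto
      then show False using prime_inD(2)[OF P(1)] by blast
    qed
  qed
  obtain Q where Q: "prime_in Y Q" "C \<subseteq> Q" using exists_prime_in[OF Y CI C1] by blast
  note QI = prime_inD(1)[OF Q(1)]
  note QE = ideal_inD[OF QI]
  have QU: "Q \<inter> U = C" using max_C Q by blast
  \<comment> \<open>All primes of \<open>Y\<close> that contain the conductor have trace
    \<open>C\<close>, so injectivity on spectra leaves only one.\<close>
  have uniq: "P = Q" if "prime_in Y P" "C \<subseteq> P" for P
    using subintegral_inD(1)[OF sub that(1) Q(1)] max_C[OF that] QU by simp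
  \<comment> \<open>The residual condition gives \<open>v y = u + q\<close>; then \<open>v\<close>
    is inverted modulo the conductor, and the error \<open>y c\<close> is in \<open>Q\<close>
    because \<open>C \<subseteq> Q\<close>.\<close>
  have "y \<in> sum_set U Q" if y: "y \<in> Y" for y
  proof -
    obtain u v q where 1: "u \<in> U" "v \<in> U - Q" "q \<in> Q" "v \<otimes> y = u \<oplus> q"
      using subintegral_inD(2)[OF sub Q(1) y] by blast
    then obtain b c where 2: "b \<in> U" "c \<in> C" "c \<oplus> v \<otimes> b = \<one>" using unit[of v] Q(2) by blast
    have k: "u \<in> carrier R" "v \<in> carrier R" "q \<in> carrier R" "b \<in> carrier R" "c \<in> carrier R" "y \<in> carrier R"
      using 1 2 y Uc Yc QE(1) CU by auto
    have "y = (c \<oplus> v \<otimes> b) \<otimes> y" using k 2(3) by simp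
    also have "\<dots> = b \<otimes> (v \<otimes> y) \<oplus> y \<otimes> c" using k by algebra
    also have "\<dots> = b \<otimes> u \<oplus> (b \<otimes> q \<oplus> y \<otimes> c)" unfolding 1(4) using k by algebra
    finally have eq: "y = b \<otimes> u \<oplus> (b \<otimes> q \<oplus> y \<otimes> c)" .
    have "b \<otimes> q \<in> Q" "y \<otimes> c \<in> Q" using QE(4) 1(3) 2(1,2) UY Q(2) y by blast+
    then have "b \<otimes> q \<oplus> y \<otimes> c \<in> Q" using QE(3) by blast
    then show ?thesis using eq sum_setI[OF UE(6)[OF 2(1) 1(1)]] by metis
  qed
  then have sum: "Y \<subseteq> sum_set U Q" by blast
  \<comment> \<open>Suppose \<open>z = p q\<close> is outside \<open>U\<close>. Then
    \<open>Y = U + z Y\<close> by maximality, so \<open>p = u + p q y\<close>, and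
    \<open>(\<one> - q y) p = u\<close> lies in \<open>Q \<inter> U = C\<close>. The ideal
    \<open>(C : p)\<close> of \<open>Y\<close> contains \<open>C\<close> and
    \<open>\<one> - q y\<close>, which is not in \<open>Q\<close>; as no other prime contains
    \<open>C\<close>, it is all of \<open>Y\<close>. So \<open>p \<in> C\<close>, and
    \<open>p q \<in> U\<close> after all.\<close>
  have sq: "p \<otimes> q \<in> U" if pq: "p \<in> Q" "q \<in> Q" for p q
  proof (rule ccontr)
    assume nU: "p \<otimes> q \<notin> U"
    have pY: "p \<in> Y" and qY: "q \<in> Y" using pq QE(1) by auto
    have pc: "p \<in> carrier R" and qc: "q \<in> carrier R" using pY qY Yc by auto
    define z where "z = p \<otimes> q"
    have zY: "z \<in> Y" using YE(6)[OF pY qY] by (simp add: z_def)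
    have zc: "z \<in> carrier R" using Yc[OF zY] .
    let ?J = "{z \<otimes> y | y. y \<in> Y}"
    have J: "ideal_in Y ?J" using ideal_in_principal[OF Y zY] .
    note adj = subring_sum_set_ideal[OF U Y UY J]
    have "z = z \<otimes> \<one>" using zc by simp
    then have "z \<in> ?J" using YE(3) by blast
    then have Yeq: "sum_set U ?J = Y"
      using maximal_subringD(4)[OF max adj(1) _ adj(4)] adj(2,3) nU unfolding z_def by blast
    have "p \<in> sum_set U ?J" unfolding Yeq by (fact pY)
    then obtain u j where u': "u \<in> U" "j \<in> ?J" "p = u \<oplus> j" by (rule sum_setE)
    obtain y where y: "y \<in> Y" "j = z \<otimes> y" using u'(2) by blast
    have k: "u \<in> carrier R" "y \<in> carrier R" using u'(1) y(1) Uc Yc by auto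
    have p: "p = u \<oplus> z \<otimes> y" using u'(3) y(2) by simp
    have zQ: "z \<otimes> y \<in> Q"
      using QE(4)[OF YE(6)[OF qY y(1)] pq(1)] unfolding z_def using pc qc k m_comm m_assoc by simp
    then have "u \<in> Q" using ideal_in_add_cancel[OF Y QI k(1) zQ] p pq(1) by simp
    then have uC: "u \<in> C" using QU u'(1) by blast
    define w where "w = \<one> \<ominus> q \<otimes> y"
    have qy: "q \<otimes> y \<in> Q" using QE(4)[OF y(1) pq(2)] m_comm[OF qc k(2)] by simp
    have wY: "w \<in> Y" using subring_minus[OF Y YE(3) YE(6)[OF qY y(1)]] by (simp add: w_def)
    have wQ: "w \<notin> Q"
    proof
      assume "w \<in> Q"
      then have "w \<oplus> q \<otimes> y \<in> Q" using QE(3) qy by blast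
      moreover have "w \<oplus> q \<otimes> y = \<one>" unfolding w_def using qc k by algebra
      ultimately show False using prime_inD(2)[OF Q(1)] by simp
    qed
    have "w \<otimes> p = p \<ominus> z \<otimes> y" unfolding w_def z_def using pc qc k by algebra
    also have "\<dots> = u" using p k zc by algebra
    finally have wp: "w \<otimes> p \<in> C" using uC by simp
    define K where "K = {a \<in> Y. a \<otimes> p \<in> C}"
    note CE = ideal_inD[OF CI]
    have "ideal_in Y K"
      unfolding ideal_in_def
    proof (intro conjI ballI)
      show "K \<subseteq> Y" by (auto simp: K_def)
      show "\<zero> \<in> K" using YE(2) CE(2) pc by (simp add: K_def)
      fix a assume a: "a \<in> K"
      then have aY: "a \<in> Y" "a \<in> carrier R" and aC: "a \<otimes> p \<in> C" using Yc by (auto simp: K_def)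
      show "a \<oplus> b \<in> K" if "b \<in> K" for b
        using that aY aC CE(3) YE(7) l_distr[OF aY(2) Yc pc] by (simp add: K_def)
      show "y \<otimes> a \<in> K" if "y \<in> Y" for y
        using that aY aC CE(4) YE(6) m_assoc[OF Yc aY(2) pc] by (simp add: K_def)
    qed
    moreover have "w \<in> K" using wY wp by (simp add: K_def)
    moreover have "C \<subseteq> K"
      using CE(1) CE(4)[OF pY] m_comm[OF Yc pc] by (auto simp: K_def)
    ultimately have "\<one> \<in> K" using exists_prime_in[OF Y, of K] uniq wQ by blast
    then have "p \<in> C" using pc by (simp add: K_def)
    then show False using Cmul qY nU by blast
  qed
  have "ramified_at U Y Q"
    unfolding ramified_at_def using Q(1) sum sq unit QU by blast
  then show thesis using that by blast
qed

lemma maximal_subring_generated: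
  assumes max: "maximal_subring U Y" and q: "q \<in> Y" "q \<notin> U" "q \<otimes> q \<in> U" and y: "y \<in> Y"
  obtains u v where "u \<in> U" "v \<in> U" "y = u \<oplus> v \<otimes> q"
proof -
  note U = maximal_subringD(1)[OF max] and Y = maximal_subringD(2)[OF max]
  note UE = subringE[OF U] and YE = subringE[OF Y] and UY = maximal_subringD(3)[OF max]
  have qc: "q \<in> carrier R" using q YE(1) by blast
  let ?J = "{u \<otimes> q | u. u \<in> U}"
  note adj = subring_adjoin_square[OF U qc q(3)]
  have "sum_set U ?J \<subseteq> Y"
  proof
    fix x assume "x \<in> sum_set U ?J"
    then obtain u j where uj: "u \<in> U" "j \<in> ?J" "x = u \<oplus> j" by (rule sum_setE)
    then have "u \<in> Y" "j \<in> Y" using UY YE(6) q(1) by blast+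
    then show "x \<in> Y" using uj(3) YE(7) by simp
  qed
  then have "sum_set U ?J = Y"
    using maximal_subringD(4)[OF max adj(1)] adj(2,3) q(2) by blast
  then have "y \<in> sum_set U ?J" using y by simp
  then obtain u j where "u \<in> U" "j \<in> ?J" "y = u \<oplus> j" by (rule sum_setE)
  then show thesis using that by blast
qed


section \<open>Lower semimodularity over a subintegral base\<close>

lemma subring_Int: "subring U R \<Longrightarrow> subring V R \<Longrightarrow> subring (U \<inter> V) R"
proof -
  assume U: "subring U R" and V: "subring V R"
  show ?thesis
    by (rule subringI) (use subringE[OF U] subringE[OF V] in auto)
qed

text \<open>Write \<open>x = a0 + q0\<close> with \<open>q0 \<in> Q\<close>, so that
  \<open>B = A + A q0\<close>. A coefficient \<open>a' = t + q'\<close> is split by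
  \<open>B = T + Q\<close>; the part \<open>q' q0\<close> falls into \<open>A\<close>, and modulo
  \<open>A\<close> only \<open>t q0\<close>, that is \<open>t x\<close>, remains.\<close>

lemma subintegral_maximal_simple:
  assumes T: "subring T R" and TA: "T \<subseteq> A" and max: "maximal_subring A B"
    and int: "\<And>y. y \<in> B \<Longrightarrow> integral_over T y" and sub: "subintegral_in T B"
    and x: "x \<in> B" "x \<notin> A" and y: "y \<in> B"
  shows "\<exists>a\<in>A. \<exists>t\<in>T. y = a \<oplus> t \<otimes> x"
proof -
  note A = maximal_subringD(1)[OF max] and B = maximal_subringD(2)[OF max]
  note AE = subringE[OF A] and BE = subringE[OF B] and TE = subringE[OF T]
  have AB: "A \<subseteq> B" and TB: "T \<subseteq> B" using maximal_subringD(3)[OF max] TA by auto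
  have Bc: "\<And>b. b \<in> B \<Longrightarrow> b \<in> carrier R" using BE(1) by blast
  obtain Q where Q: "ramified_at A B Q"
    using exists_ramified_at[OF max integral_over_mono[OF TA int] subintegral_in_upper[OF TA AB sub]] .
  note QP = ramified_atD(1)[OF Q] and QI = ramified_atD(2)[OF Q]
  note QE = ideal_inD[OF QI]
  have TQ: "b \<in> sum_set T Q" if b: "b \<in> B" for b
  proof -
    obtain t v q where 1: "t \<in> T" "v \<in> T - Q" "q \<in> Q" "v \<otimes> b = t \<oplus> q"
      using subintegral_inD(2)[OF sub QP b] by blast
    have vT: "v \<in> T" using 1 by blast
    obtain a c where 2: "a \<in> A" "c \<in> Q \<inter> A" "c \<oplus> v \<otimes> a = \<one>"
      using ramified_atD(5)[OF Q, of v] 1(2) TA by blast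
    \<comment> \<open>The denominator \<open>v \<in> T - Q\<close> must be inverted modulo
      \<open>Q \<inter> T\<close>, but ramification inverts it only within \<open>A\<close>. A prime
      of \<open>T\<close> containing \<open>v\<close> and \<open>Q \<inter> T\<close> would lift by
      going up to a prime of \<open>B\<close> containing \<open>v\<close> and \<open>Q\<close>,
      hence \<open>c + v a = \<one>\<close>.\<close>
    let ?K = "sum_set (Q \<inter> T) {v \<otimes> t | t. t \<in> T}"
    have QT: "ideal_in T (Q \<inter> T)" using ideal_in_Int[OF T TB QI] .
    have vI: "ideal_in T {v \<otimes> t | t. t \<in> T}" using ideal_in_principal[OF T vT] .
    have KI: "ideal_in T ?K" using ideal_in_sum_set[OF T QT vI] .
    have "\<one> \<in> ?K"
    proof (rule ccontr)
      assume "\<one> \<notin> ?K"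
      then obtain P where P: "prime_in T P" "?K \<subseteq> P"
        using exists_prime_in[OF T KI] by blast
      have "v = v \<otimes> \<one>" using vT TE(1) by auto
      then have "v \<in> {v \<otimes> t | t. t \<in> T}" using TE(3) by blast
      then have "v \<in> P"
        using subset_sum_set'[OF ideal_inD(2)[OF QT] ideal_in_carrier[OF T vI]] P(2) by blast
      have "Q \<inter> T \<subseteq> P"
        using subset_sum_set[OF ideal_inD(2)[OF vI] ideal_in_carrier[OF T QT]] P(2) by blast
      then obtain Q' where Q': "prime_in B Q'" "Q \<subseteq> Q'" "Q' \<inter> T = P"
        using going_up[OF T B TB int P(1) QI] by blast
      note Q'E = ideal_inD[OF prime_inD(1)[OF Q'(1)]]
      have "v \<in> Q'" using \<open>v \<in> P\<close> Q'(3) by blast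
      moreover have "a \<in> B" "v \<in> B" using 2(1) AB vT TB by auto
      ultimately have "v \<otimes> a \<in> Q'" using Q'E(4)[of a v] m_comm[OF Bc Bc] by simp
      then have "c \<oplus> v \<otimes> a \<in> Q'" using 2(2) Q'(2) Q'E(3) by blast
      then show False using 2(3) prime_inD(2)[OF Q'(1)] by simp
    qed
    then obtain p j where "p \<in> Q \<inter> T" "j \<in> {v \<otimes> t | t. t \<in> T}" "\<one> = p \<oplus> j" by (rule sum_setE)
    then obtain s where 3: "p \<in> Q" "p \<in> T" "s \<in> T" "\<one> = p \<oplus> v \<otimes> s" by blast
    have k: "t \<in> carrier R" "v \<in> carrier R" "q \<in> carrier R" "p \<in> carrier R" "s \<in> carrier R" "b \<in> carrier R"
      using 1 3 vT TE(1) QE(1) Bc b by auto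
    have "b = \<one> \<otimes> b" using k by simp
    also have "\<dots> = s \<otimes> (v \<otimes> b) \<oplus> b \<otimes> p" unfolding 3(4) using k by algebra
    also have "\<dots> = s \<otimes> t \<oplus> (s \<otimes> q \<oplus> b \<otimes> p)" unfolding 1(4) using k by algebra
    finally have eq: "b = s \<otimes> t \<oplus> (s \<otimes> q \<oplus> b \<otimes> p)" .
    have "s \<otimes> q \<in> Q" "b \<otimes> p \<in> Q" using QE(4) 1(3) 3 b TB by blast+
    then have "s \<otimes> q \<oplus> b \<otimes> p \<in> Q" using QE(3) by blast
    then show ?thesis using eq sum_setI[OF TE(6)[OF 3(3) 1(1)]] by metis
  qed
  obtain a0 q0 where 0: "a0 \<in> A" "q0 \<in> Q" "x = a0 \<oplus> q0"
    using ramified_atD(3)[OF Q] x(1) by (blast elim: sum_setE)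
  have q0A: "q0 \<notin> A" using 0 AE(7) x(2) by blast
  have q0B: "q0 \<in> B" using 0 QE(1) by blast
  obtain a a' where 1: "a \<in> A" "a' \<in> A" "y = a \<oplus> a' \<otimes> q0"
    using maximal_subring_generated[OF max q0B q0A ramified_atD(4)[OF Q 0(2) 0(2)] y] .
  obtain t q' where 2: "t \<in> T" "q' \<in> Q" "a' = t \<oplus> q'" using TQ[of a'] 1(2) AB by (blast elim: sum_setE)
  have k: "a \<in> carrier R" "t \<in> carrier R" "q' \<in> carrier R" "q0 \<in> carrier R" "a0 \<in> carrier R"
    using 0 1 2 AE(1) TE(1) QE(1) Bc by auto
  have "y = (a \<oplus> q' \<otimes> q0 \<ominus> t \<otimes> a0) \<oplus> t \<otimes> x" unfolding 0(3) 1(3) 2(3) using k by algebra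
  moreover have "a \<oplus> q' \<otimes> q0 \<ominus> t \<otimes> a0 \<in> A"
    using subring_minus[OF A AE(7)[OF 1(1) ramified_atD(4)[OF Q 2(2) 0(2)]] AE(6)[OF subsetD[OF TA 2(1)] 0(1)]] .
  ultimately show ?thesis using 2(1) by blast
qed

text \<open>The module \<open>U / (U \<inter> V)\<close> embeds into \<open>Y / V\<close>, and the
  hypothesis \<open>simple\<close> makes the latter a simple \<open>T\<close>-module. As
  \<open>T\<close> lies in \<open>U \<inter> V\<close>, every ring between
  \<open>U \<inter> V\<close> and \<open>U\<close> is a \<open>T\<close>-submodule.\<close>

lemma maximal_subring_Int:
  assumes T: "T \<subseteq> U \<inter> V" and maxU: "maximal_subring U Y" and maxV: "maximal_subring V Y" and "U \<noteq> V"
    and simple: "\<And>x y. x \<in> Y \<Longrightarrow> x \<notin> V \<Longrightarrow> y \<in> Y \<Longrightarrow> \<exists>v\<in>V. \<exists>t\<in>T. y = v \<oplus> t \<otimes> x"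
  shows "maximal_subring (U \<inter> V) U"
  unfolding maximal_subring_def
proof (intro conjI allI impI)
  note U = maximal_subringD(1)[OF maxU] and V = maximal_subringD(1)[OF maxV]
  note UE = subringE[OF U] and VE = subringE[OF V]
  have UY: "U \<subseteq> Y" using maximal_subringD(3)[OF maxU] by blast
  show "subring (U \<inter> V) R" using subring_Int[OF U V] .
  show "subring U R" by (fact U)
  show "U \<inter> V \<subset> U"
    using maximal_subringD(4)[OF maxU V] maximal_subringD(3)[OF maxV] \<open>U \<noteq> V\<close> by blast
  fix N assume N: "subring N R" "U \<inter> V \<subset> N" "N \<subseteq> U"
  note NE = subringE[OF N(1)]
  obtain x where x: "x \<in> N" "x \<notin> V" using N by blast
  have "u \<in> N" if u: "u \<in> U" for u
  proof -
    obtain v t where vt: "v \<in> V" "t \<in> T" "u = v \<oplus> t \<otimes> x"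
      using simple[of x u] x N(3) UY u by blast
    have tx: "t \<otimes> x \<in> N" using NE(6) x(1) vt(2) T N(2) by blast
    have "v \<in> U"
      using subring_add_cancel[OF U, of v "t \<otimes> x"] vt tx u N(3) VE(1) by blast
    then have "v \<in> N" using vt(1) N(2) by blast
    then show ?thesis using vt(3) NE(7) tx by simp
  qed
  then show "N = U" using N(3) by blast
qed

section \<open>Intersections of two ramified maximal subrings\<close>

lemma ramified_diamond_side:
  assumes U: "subring U R" and UY: "U \<subseteq> Y" and max: "maximal_subring V Y" and Q: "ideal_in Y Q"
    and sq: "\<And>p q. p \<in> Q \<Longrightarrow> q \<in> Q \<Longrightarrow> p \<otimes> q \<in> V" and sum: "Y \<subseteq> sum_set U Q"
    and q: "q \<in> Q" "q \<in> U" "q \<notin> V"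
  shows "maximal_subring (U \<inter> V) U \<and> subintegral_in (U \<inter> V) U"
proof -
  note V = maximal_subringD(1)[OF max] and Y = maximal_subringD(2)[OF max]
  have VY: "V \<subseteq> Y" using maximal_subringD(3)[OF max] by blast
  note UE = subringE[OF U] and VE = subringE[OF V] and YE = subringE[OF Y] and QE = ideal_inD[OF Q]
  have Uc: "\<And>u. u \<in> U \<Longrightarrow> u \<in> carrier R" using UE(1) by blast
  have Yc: "\<And>u. u \<in> Y \<Longrightarrow> u \<in> carrier R" using YE(1) by blast
  have W: "subring (U \<inter> V) R" using subring_Int[OF U V] .
  note WE = subringE[OF W]
  have J: "ideal_in U (Q \<inter> U)" using ideal_in_Int[OF U UY Q] .
  \<comment> \<open>In \<open>u = v + v' j\<close> with coefficients from \<open>V\<close>, write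
    \<open>v' = u' + q'\<close> using \<open>Y = U + Q\<close>. The part \<open>q' j\<close> lies in
    \<open>Q Q \<subseteq> V\<close> and is moved into the first summand, which is then also in
    \<open>U\<close>.\<close>
  have gen: "\<exists>w\<in>U \<inter> V. \<exists>u'\<in>U. u = w \<oplus> u' \<otimes> j" if j: "j \<in> Q" "j \<in> U" "j \<notin> V" and u: "u \<in> U" for u j
  proof -
    obtain v v' where v: "v \<in> V" "v' \<in> V" "u = v \<oplus> v' \<otimes> j"
      using maximal_subring_generated[OF max _ j(3) sq[OF j(1,1)], of u] j(2) u UY by blast
    obtain u' q' where u': "u' \<in> U" "q' \<in> Q" "v' = u' \<oplus> q'" using sum v(2) VY by (blast elim: sum_setE)
    have k: "v \<in> carrier R" "u' \<in> carrier R" "q' \<in> carrier R" "j \<in> carrier R"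
      using v u' j Uc Yc VY QE(1) by auto
    have eq: "u = (v \<oplus> q' \<otimes> j) \<oplus> u' \<otimes> j" unfolding v(3) u'(3) using k by algebra
    have wV: "v \<oplus> q' \<otimes> j \<in> V" using VE(7) v(1) sq[OF u'(2) j(1)] by blast
    have "v \<oplus> q' \<otimes> j \<in> U"
      using subring_add_cancel[OF U, of "v \<oplus> q' \<otimes> j" "u' \<otimes> j"] k UE(6)[OF u'(1) j(2)] u eq by simp
    then show ?thesis using eq wV u'(1) by blast
  qed
  have sumU: "U \<subseteq> sum_set (U \<inter> V) (Q \<inter> U)"
  proof
    fix u assume "u \<in> U"
    then obtain w u' where w: "w \<in> U \<inter> V" "u' \<in> U" "u = w \<oplus> u' \<otimes> q" using gen[OF q] by blast
    moreover have "u' \<otimes> q \<in> Q \<inter> U" using QE(4) w(2) UY q UE(6) by blast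
    ultimately show "u \<in> sum_set (U \<inter> V) (Q \<inter> U)" using sum_setI by simp
  qed
  have sqU: "i \<otimes> j \<in> U \<inter> V" if "i \<in> Q \<inter> U" "j \<in> Q \<inter> U" for i j
    using sq UE(6) that by blast
  have "subintegral_in (U \<inter> V) U"
    using subintegral_in_if_square[OF W U _ J sumU sqU] by blast
  moreover have "maximal_subring (U \<inter> V) U"
    unfolding maximal_subring_def
  proof (intro conjI allI impI)
    show "subring (U \<inter> V) R" "subring U R" using U W by auto
    show "U \<inter> V \<subset> U" using q by blast
    fix N assume N: "subring N R" "U \<inter> V \<subset> N" "N \<subseteq> U"
    note NE = subringE[OF N(1)]
    obtain n where n: "n \<in> N" "n \<in> U" "n \<notin> V" using N by blast
    obtain w j where wj: "w \<in> U \<inter> V" "j \<in> Q \<inter> U" "n = w \<oplus> j" using sumU n(2) by (blast elim: sum_setE)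
    have k: "w \<in> carrier R" "j \<in> carrier R" using wj Uc by auto
    have jV: "j \<notin> V" using wj VE(7) n(3) by blast
    have jN: "j \<in> N"
      using subring_add_cancel[OF N(1) k(2), of w] a_comm[OF k] wj N(2) n(1) by auto
    have "u \<in> N" if u: "u \<in> U" for u
    proof -
      \<comment> \<open>The coefficient \<open>u'\<close> need not be in \<open>N\<close>, so it is
        split once more: \<open>w2 j\<close> is in \<open>N\<close> because
        \<open>w2 \<in> U \<inter> V\<close>, and \<open>j' j\<close> already lies in
        \<open>U \<inter> V\<close>.\<close>
      obtain w1 u' where w1: "w1 \<in> U \<inter> V" "u' \<in> U" "u = w1 \<oplus> u' \<otimes> j" using gen[OF _ _ jV u] wj(2) by blast
      obtain w2 j' where w2: "w2 \<in> U \<inter> V" "j' \<in> Q \<inter> U" "u' = w2 \<oplus> j'"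
        using sumU w1(2) by (blast elim: sum_setE)
      have k2: "w2 \<in> carrier R" "j' \<in> carrier R" "w1 \<in> carrier R" using w1 w2 Uc by auto
      have "u = w1 \<oplus> (w2 \<otimes> j \<oplus> j' \<otimes> j)" unfolding w1(3) w2(3) using k k2 by algebra
      moreover have "w1 \<in> N" "w2 \<otimes> j \<in> N" "j' \<otimes> j \<in> N"
        using w1(1) w2(1) N(2) NE(6) jN sqU[OF w2(2) wj(2)] by blast+
      ultimately show ?thesis using NE(7) by simp
    qed
    then show "N = U" using N(3) by blast
  qed
  ultimately show ?thesis by blast
qed

text \<open>Modulo \<open>Q\<close> every element of \<open>Y\<close> comes from \<open>U\<close>,
  and the elements of \<open>U - Q\<close> are invertible there; so \<open>Q\<close> is a maximal
  ideal of \<open>Y\<close>.\<close>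

lemma ramified_at_comaximal:
  assumes U: "subring U R" and Y: "subring Y R" and UY: "U \<subseteq> Y" and Q: "ramified_at U Y Q"
    and I: "ideal_in Y I" "\<not> I \<subseteq> Q"
  obtains a b where "a \<in> Q" "b \<in> I" "a \<oplus> b = \<one>"
proof -
  note UE = subringE[OF U] and QE = ideal_inD[OF ramified_atD(2)[OF Q]] and IE = ideal_inD[OF I(1)]
  obtain p where p: "p \<in> I" "p \<notin> Q" using I(2) by blast
  obtain u q where uq: "u \<in> U" "q \<in> Q" "p = u \<oplus> q"
    using ramified_atD(3)[OF Q] p(1) IE(1) by (blast elim: sum_setE)
  have "u \<notin> Q" using uq p(2) QE(3) by blast
  then obtain b c where bc: "b \<in> U" "c \<in> Q" "c \<oplus> u \<otimes> b = \<one>" using ramified_atD(5)[OF Q uq(1)] by blast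
  have k: "u \<in> carrier R" "q \<in> carrier R" "b \<in> carrier R" "c \<in> carrier R"
    using uq bc UE(1) ideal_in_carrier[OF Y ramified_atD(2)[OF Q]] by auto
  have "(c \<ominus> b \<otimes> q) \<oplus> b \<otimes> p = c \<oplus> u \<otimes> b" unfolding uq(3) using k by algebra
  then have "(c \<ominus> b \<otimes> q) \<oplus> b \<otimes> p = \<one>" using bc(3) by simp
  moreover have "c \<ominus> b \<otimes> q \<in> Q"
    using ideal_in_minus[OF Y ramified_atD(2)[OF Q] bc(2)] QE(4) bc(1) UY uq(2) by blast
  moreover have "b \<otimes> p \<in> I" using IE(4) bc(1) UY p(1) by blast
  ultimately show thesis using that by blast
qed

text \<open>Both claims expand \<open>\<one> = (a + b)^2 = a^2 + (2 a + b) b\<close>. The factor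
  \<open>a^2\<close> carries \<open>Y\<close> into \<open>P P \<subseteq> U\<close>, and
  \<open>(2 a + b) b\<close> is in \<open>Q\<close>. For \<open>r \<in> Q - V\<close> the second
  factor carries \<open>r\<close> into \<open>Q Q \<subseteq> V\<close>, so \<open>a^2 r\<close> is
  the required element of \<open>Q \<inter> U\<close> outside \<open>V\<close>.\<close>

lemma ramified_comaximal_witness:
  assumes V: "subring V R" and Y: "subring Y R" and VY: "V \<subset> Y"
    and P: "ramified_at U Y P" and Q: "ramified_at V Y Q" and ab: "a \<in> P" "b \<in> Q" "a \<oplus> b = \<one>"
  shows "Y \<subseteq> sum_set U Q" and "\<exists>q\<in>Q. q \<in> U \<and> q \<notin> V"
proof -
  note VE = subringE[OF V] and YE = subringE[OF Y]
  note PE = ideal_inD[OF ramified_atD(2)[OF P]] and QE = ideal_inD[OF ramified_atD(2)[OF Q]]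
  have Yc: "\<And>u. u \<in> Y \<Longrightarrow> u \<in> carrier R" using YE(1) by blast
  have abY: "a \<in> Y" "b \<in> Y" using ab PE(1) QE(1) by auto
  have k: "a \<in> carrier R" "b \<in> carrier R" using abY Yc by auto
  show "Y \<subseteq> sum_set U Q"
  proof
    fix y assume y: "y \<in> Y"
    have yc: "y \<in> carrier R" using Yc[OF y] .
    have "y = (a \<oplus> b) \<otimes> (a \<oplus> b) \<otimes> y" unfolding ab(3) using yc by simp
    also have "\<dots> = a \<otimes> (y \<otimes> a) \<oplus> ((a \<oplus> a \<oplus> b) \<otimes> y) \<otimes> b" using k yc by algebra
    finally have eq: "y = a \<otimes> (y \<otimes> a) \<oplus> ((a \<oplus> a \<oplus> b) \<otimes> y) \<otimes> b" .
    have "a \<otimes> (y \<otimes> a) \<in> U" using ramified_atD(4)[OF P ab(1)] PE(4)[OF y ab(1)] by blast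
    moreover have "((a \<oplus> a \<oplus> b) \<otimes> y) \<otimes> b \<in> Q" using QE(4)[OF YE(6)[OF YE(7)[OF YE(7)[OF abY(1,1)] abY(2)] y] ab(2)] .
    ultimately show "y \<in> sum_set U Q" using eq sum_setI by metis
  qed
  obtain y where y: "y \<in> Y" "y \<notin> V" using VY by blast
  obtain v r where vr: "v \<in> V" "r \<in> Q" "y = v \<oplus> r" using ramified_atD(3)[OF Q] y(1) by (blast elim: sum_setE)
  have rV: "r \<notin> V" using vr y(2) VE(7) by blast
  have rY: "r \<in> Y" and rc: "r \<in> carrier R" using vr QE(1) Yc by auto
  have "r = r \<otimes> ((a \<oplus> b) \<otimes> (a \<oplus> b))" unfolding ab(3) using rc by simp
  also have "\<dots> = r \<otimes> ((a \<oplus> a \<oplus> b) \<otimes> b) \<oplus> a \<otimes> (r \<otimes> a)" using k rc by algebra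
  finally have eq: "r = r \<otimes> ((a \<oplus> a \<oplus> b) \<otimes> b) \<oplus> a \<otimes> (r \<otimes> a)" .
  have "(a \<oplus> a \<oplus> b) \<otimes> b \<in> Q" using QE(4)[OF YE(7)[OF YE(7)[OF abY(1,1)] abY(2)] ab(2)] .
  then have "r \<otimes> ((a \<oplus> a \<oplus> b) \<otimes> b) \<in> V" using ramified_atD(4)[OF Q vr(2)] by blast
  then have "a \<otimes> (r \<otimes> a) \<notin> V" using eq rV VE(7) by metis
  moreover have "a \<otimes> (r \<otimes> a) \<in> U" using ramified_atD(4)[OF P ab(1)] PE(4)[OF rY ab(1)] by blast
  moreover have "a \<otimes> (r \<otimes> a) \<in> Q"
  proof -
    have "a \<otimes> (r \<otimes> a) = (a \<otimes> a) \<otimes> r" using k rc by algebra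
    then show ?thesis using QE(4)[OF YE(6)[OF abY(1,1)] vr(2)] by simp
  qed
  ultimately show "\<exists>q\<in>Q. q \<in> U \<and> q \<notin> V" by blast
qed

text \<open>If \<open>Q \<inter> V\<close> were contained in \<open>U\<close>, then for
  \<open>r = v + v' q\<close> in \<open>Q\<close> both summands would be in \<open>U\<close>:
  \<open>v\<close> lies in \<open>Q \<inter> V\<close>, and \<open>v' q\<close> is treated by
  \<open>Y = U + Q\<close> and \<open>Q Q \<subseteq> U\<close>. This would give
  \<open>Q \<subseteq> U\<close> and \<open>Y = U\<close>. So distinct traces of \<open>Q\<close> on
  \<open>U\<close> and \<open>V\<close> are incomparable.\<close>

lemma ramified_same_witness:
  assumes maxU: "maximal_subring U Y" and maxV: "maximal_subring V Y"
    and QU: "ramified_at U Y Q" and QV: "ramified_at V Y Q" and q: "q \<in> Q" "q \<in> U" "q \<notin> V"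
  shows "\<exists>r\<in>Q. r \<in> V \<and> r \<notin> U"
proof (rule ccontr)
  assume "\<not> ?thesis"
  then have sub: "\<And>r. r \<in> Q \<Longrightarrow> r \<in> V \<Longrightarrow> r \<in> U" by blast
  note U = maximal_subringD(1)[OF maxU] and V = maximal_subringD(1)[OF maxV] and Y = maximal_subringD(2)[OF maxU]
  note UE = subringE[OF U] and QI = ramified_atD(2)[OF QU]
  note QE = ideal_inD[OF QI]
  have UY: "U \<subset> Y" "V \<subseteq> Y" using maximal_subringD(3)[OF maxU] maximal_subringD(3)[OF maxV] by auto
  have Yc: "\<And>y. y \<in> Y \<Longrightarrow> y \<in> carrier R" using subringE(1)[OF Y] by blast
  have "r \<in> U" if r: "r \<in> Q" for r
  proof -
    obtain v v' where v: "v \<in> V" "v' \<in> V" "r = v \<oplus> v' \<otimes> q"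
      using maximal_subring_generated[OF maxV _ q(3) ramified_atD(4)[OF QV q(1,1)], of r] q(1) r QE(1) by blast
    have vq: "v' \<otimes> q \<in> Q" using QE(4) v(2) UY q(1) by blast
    then have "v \<in> Q" using ideal_in_add_cancel[OF Y QI, of v "v' \<otimes> q"] v r Yc UY by blast
    then have vU: "v \<in> U" using sub v(1) by blast
    obtain u p where up: "u \<in> U" "p \<in> Q" "v' = u \<oplus> p"
      using ramified_atD(3)[OF QU] v(2) UY by (blast elim: sum_setE)
    have k: "u \<in> carrier R" "p \<in> carrier R" "q \<in> carrier R" using up q Yc QE(1) UY by auto
    have "v' \<otimes> q = u \<otimes> q \<oplus> p \<otimes> q" unfolding up(3) using k by algebra
    then have "v' \<otimes> q \<in> U" using UE(6,7) up q ramified_atD(4)[OF QU up(2) q(1)] by auto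
    then show ?thesis using v(3) vU UE(7) by simp
  qed
  then have "sum_set U Q \<subseteq> U" using UE(7) by (auto simp: sum_set_def)
  then show False using ramified_atD(3)[OF QU] UY by blast
qed

text \<open>Distinct \<open>P\<close> and \<open>Q\<close> are comaximal, which yields elements
  separating \<open>U\<close> and \<open>V\<close> in both directions; for \<open>P = Q\<close>
  these come from \<open>good\<close> through \<open>ramified_same_witness\<close>.\<close>

lemma ramified_diamond:
  assumes maxU: "maximal_subring U Y" and maxV: "maximal_subring V Y"
    and P: "ramified_at U Y P" and Q: "ramified_at V Y Q"
    and good: "P = Q \<Longrightarrow> Q \<inter> U \<noteq> Q \<inter> V"
  shows "maximal_subring (U \<inter> V) U \<and> subintegral_in (U \<inter> V) U \<and>
    maximal_subring (U \<inter> V) V \<and> subintegral_in (U \<inter> V) V"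
proof -
  note U = maximal_subringD(1)[OF maxU] and V = maximal_subringD(1)[OF maxV] and Y = maximal_subringD(2)[OF maxU]
  have UY: "U \<subset> Y" "V \<subset> Y" "U \<subseteq> Y" "V \<subseteq> Y"
    using maximal_subringD(3)[OF maxU] maximal_subringD(3)[OF maxV] by auto
  have "Y \<subseteq> sum_set U Q \<and> Y \<subseteq> sum_set V P \<and> (\<exists>q\<in>Q. q \<in> U \<and> q \<notin> V) \<and> (\<exists>q\<in>P. q \<in> V \<and> q \<notin> U)"
  proof (cases "P = Q")
    case True
    have "(\<exists>q\<in>Q. q \<in> U \<and> q \<notin> V) \<or> (\<exists>q\<in>Q. q \<in> V \<and> q \<notin> U)" using good[OF True] by blast
    then have "(\<exists>q\<in>Q. q \<in> U \<and> q \<notin> V) \<and> (\<exists>q\<in>Q. q \<in> V \<and> q \<notin> U)"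
      using ramified_same_witness[OF maxU maxV P[unfolded True] Q]
        ramified_same_witness[OF maxV maxU Q P[unfolded True]] by blast
    then show ?thesis using ramified_atD(3)[OF P] ramified_atD(3)[OF Q] True by blast
  next
    case False
    obtain a b where ab: "a \<in> P" "b \<in> Q" "a \<oplus> b = \<one>"
    proof (cases "Q \<subseteq> P")
      case True
      then have "\<not> P \<subseteq> Q" using False by blast
      then obtain b a where ba: "b \<in> Q" "a \<in> P" "b \<oplus> a = \<one>"
        using ramified_at_comaximal[OF V Y UY(4) Q ramified_atD(2)[OF P]] by blast
      then have "b \<in> carrier R" "a \<in> carrier R"
        using ideal_in_carrier[OF Y ramified_atD(2)[OF P]] ideal_in_carrier[OF Y ramified_atD(2)[OF Q]] by auto
      then have "a \<oplus> b = \<one>" using ba(3) a_comm by simp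
      then show thesis using that ba by blast
    next
      case False
      show thesis using ramified_at_comaximal[OF U Y UY(3) P ramified_atD(2)[OF Q] False] that .
    qed
    have "b \<in> carrier R" "a \<in> carrier R"
      using ab ideal_in_carrier[OF Y ramified_atD(2)[OF P]] ideal_in_carrier[OF Y ramified_atD(2)[OF Q]] by auto
    then have ba: "b \<oplus> a = \<one>" using ab(3) a_comm by simp
    show ?thesis
      using ramified_comaximal_witness[OF V Y UY(2) P Q ab]
        ramified_comaximal_witness[OF U Y UY(1) Q P ab(2,1) ba] by blast
  qed
  then obtain p q where w: "Y \<subseteq> sum_set U Q" "Y \<subseteq> sum_set V P"
    "q \<in> Q" "q \<in> U" "q \<notin> V" "p \<in> P" "p \<in> V" "p \<notin> U" by blast
  have "maximal_subring (U \<inter> V) U \<and> subintegral_in (U \<inter> V) U"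
    using ramified_diamond_side[OF U UY(3) maxV ramified_atD(2,4)[OF Q] w(1,3-5)] .
  moreover have "maximal_subring (V \<inter> U) V \<and> subintegral_in (V \<inter> U) V"
    using ramified_diamond_side[OF V UY(4) maxU ramified_atD(2,4)[OF P] w(2,6-8)] .
  ultimately show ?thesis by (simp add: Int_commute)
qed

text \<open>If \<open>W + W q\<close> exhausted \<open>W + Q\<close>, then for each
  \<open>u \<in> U\<close> some \<open>(u - w') q\<close> with \<open>w' \<in> W\<close> would lie
  in \<open>W\<close>. As \<open>q\<close> is not in \<open>U\<close>, the element
  \<open>u - w'\<close> is not invertible modulo \<open>Q \<inter> U\<close>; so it lies in
  \<open>Q \<inter> U \<subseteq> W\<close>, and \<open>U \<subseteq> W\<close> follows.\<close>

lemma ramified_same_trace: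
  assumes maxU: "maximal_subring U Y" and maxV: "maximal_subring V Y" and UV: "U \<noteq> V"
    and QU: "ramified_at U Y Q" and QV: "ramified_at V Y Q" and eq: "Q \<inter> U = Q \<inter> V"
  shows "\<exists>N. subring N R \<and> U \<inter> V \<subset> N \<and> N \<subset> sum_set (U \<inter> V) Q"
proof -
  note U = maximal_subringD(1)[OF maxU] and V = maximal_subringD(1)[OF maxV] and Y = maximal_subringD(2)[OF maxU]
  note UE = subringE[OF U] and QI = ramified_atD(2)[OF QU]
  note QE = ideal_inD[OF QI]
  define W where "W = U \<inter> V"
  have W: "subring W R" using subring_Int[OF U V] by (simp add: W_def)
  note WE = subringE[OF W]
  have UY: "U \<subset> Y" "U \<subseteq> Y" "W \<subseteq> Y" using maximal_subringD(3)[OF maxU] by (auto simp: W_def)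
  have Yc: "\<And>y. y \<in> Y \<Longrightarrow> y \<in> carrier R" using subringE(1)[OF Y] by blast
  have QW: "Q \<inter> U \<subseteq> W" using eq by (auto simp: W_def)
  have "\<not> Q \<subseteq> U"
  proof
    assume "Q \<subseteq> U"
    then have "sum_set U Q \<subseteq> U" using UE(7) by (auto simp: sum_set_def)
    then show False using ramified_atD(3)[OF QU] UY by blast
  qed
  then obtain q where q: "q \<in> Q" "q \<notin> U" by blast
  have qc: "q \<in> carrier R" using q QE(1) Yc by blast
  have qq: "q \<otimes> q \<in> W" using ramified_atD(4)[OF QU q(1,1)] ramified_atD(4)[OF QV q(1,1)] by (simp add: W_def)
  let ?J = "{w \<otimes> q | w. w \<in> W}"
  note adj = subring_adjoin_square[OF W qc qq]
  have J: "?J \<subseteq> Q" using QE(4) q(1) UY(3) by blast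
  then have sub: "sum_set W ?J \<subseteq> sum_set W Q" by (auto simp: sum_set_def)
  have "sum_set W ?J \<noteq> sum_set W Q"
  proof
    assume e: "sum_set W ?J = sum_set W Q"
    have "u \<in> W" if u: "u \<in> U" for u
    proof -
      have uq: "u \<otimes> q \<in> Q" using QE(4) u UY(2) q(1) by blast
      then have "u \<otimes> q \<in> sum_set W ?J"
        unfolding e using subset_sum_set'[OF WE(2) ideal_in_carrier[OF Y QI]] by blast
      then obtain w j where "w \<in> W" "j \<in> ?J" "u \<otimes> q = w \<oplus> j" by (rule sum_setE)
      then obtain w' where w: "w \<in> W" "w' \<in> W" "u \<otimes> q = w \<oplus> w' \<otimes> q" by blast
      have k: "u \<in> carrier R" "w \<in> carrier R" "w' \<in> carrier R" using u w UE(1) WE(1) by auto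
      define d where "d = u \<ominus> w'"
      have dU: "d \<in> U" using subring_minus[OF U u] w(2) by (auto simp: d_def W_def)
      have dc: "d \<in> carrier R" using dU UE(1) by blast
      have "d \<otimes> q = u \<otimes> q \<ominus> w' \<otimes> q" unfolding d_def using k qc by algebra
      also have "\<dots> = w" unfolding w(3) using k qc by algebra
      finally have dq: "d \<otimes> q \<in> U" using w(1) by (simp add: W_def)
      have "d \<in> Q"
      proof (rule ccontr)
        assume "d \<notin> Q"
        then obtain b c where bc: "b \<in> U" "c \<in> Q \<inter> U" "c \<oplus> d \<otimes> b = \<one>"
          using ramified_atD(5)[OF QU dU] by blast
        have kb: "b \<in> carrier R" "c \<in> carrier R" using bc UE(1) by auto
        have "q = (c \<oplus> d \<otimes> b) \<otimes> q" unfolding bc(3) using qc by simp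
        also have "\<dots> = c \<otimes> q \<oplus> b \<otimes> (d \<otimes> q)" using kb dc qc by algebra
        finally have "q = c \<otimes> q \<oplus> b \<otimes> (d \<otimes> q)" .
        moreover have "c \<otimes> q \<in> U" using ramified_atD(4)[OF QU] bc(2) q(1) by blast
        moreover have "b \<otimes> (d \<otimes> q) \<in> U" using UE(6)[OF bc(1) dq] .
        ultimately have "q \<in> U" using UE(7) by metis
        then show False using q(2) by blast
      qed
      then have "d \<in> W" using dU QW by blast
      moreover have "u = d \<oplus> w'" unfolding d_def using k by algebra
      ultimately show ?thesis using WE(7) w(2) by simp
    qed
    then have "U \<subseteq> V" by (auto simp: W_def)
    then show False
      using maximal_subringD(4)[OF maxU V] maximal_subringD(3)[OF maxV] UV by blast
  qed
  moreover have "W \<noteq> sum_set W ?J" using adj(3) q(2) by (auto simp: W_def)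
  ultimately show ?thesis using adj sub unfolding W_def by blast
qed

text \<open>An element of \<open>B\<close> in \<open>A + Q\<close> differs from one of
  \<open>A\<close> by an element of \<open>Q \<inter> B \<subseteq> A\<close>, so it is already in
  \<open>A\<close>.\<close>

lemma sum_set_strict_mono:
  assumes A: "subring A R" and B: "subring B R" and AB: "A \<subset> B"
    and Q: "Q \<subseteq> carrier R" "\<zero> \<in> Q" "Q \<inter> B \<subseteq> A"
  shows "sum_set A Q \<subset> sum_set B Q"
proof -
  obtain b where b: "b \<in> B" "b \<notin> A" using AB by blast
  have "b \<notin> sum_set A Q"
  proof
    assume "b \<in> sum_set A Q"
    then obtain a q where aq: "a \<in> A" "q \<in> Q" "b = a \<oplus> q" by (rule sum_setE)
    have k: "a \<in> carrier R" "q \<in> carrier R" using aq subringE(1)[OF A] Q(1) by auto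
    have "q \<in> B"
      using subring_add_cancel[OF B k(2), of a] aq AB b(1) a_comm[OF k] by auto
    then have "q \<in> A" using Q(3) aq(2) by blast
    then show False using aq(1,3) b(2) subringE(7)[OF A] by simp
  qed
  moreover have "b \<in> sum_set B Q" using subset_sum_set[OF Q(2) subringE(1)[OF B]] b(1) by blast
  moreover have "sum_set A Q \<subseteq> sum_set B Q" using AB by (auto simp: sum_set_def)
  ultimately show ?thesis by blast
qed

end

section \<open>The co-subintegral closure\<close>

context cring begin

lemma Spec_iff_prime_in: "Q \<in> Spec R \<longleftrightarrow> prime_in (carrier R) Q"
proof
  assume "Q \<in> Spec R"
  then interpret Q: primeideal Q R by (simp add: Spec_def)
  show "prime_in (carrier R) Q"
    unfolding prime_in_def ideal_in_def
  proof (intro conjI ballI impI)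
    show "Q \<subseteq> carrier R" by (rule Q.a_subset)
    show "\<zero> \<in> Q" by (rule additive_subgroup.zero_closed[OF Q.is_additive_subgroup])
    show "\<one> \<notin> Q" using Q.one_imp_carrier Q.I_notcarr by blast
  qed (use Q.a_closed Q.I_l_closed Q.I_prime in auto)
next
  assume P: "prime_in (carrier R) Q"
  note QI = prime_inD(1)[OF P] and Y = carrier_is_subring
  note QE = ideal_inD[OF QI]
  have "primeideal Q R"
  proof (rule primeidealI2)
    show "additive_subgroup Q R"
    proof (rule additive_subgroup.intro, rule add.subgroupI)
      show "Q \<noteq> {}" using QE(2) by blast
    qed (use QE ideal_in_uminus[OF Y QI] in auto)
    show "cring R" by (rule cring_axioms)
    show "carrier R \<noteq> Q" using prime_inD(2)[OF P] one_closed by blast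
    show "a \<otimes> x \<in> Q" if "a \<in> Q" "x \<in> carrier R" for a x
      using QE(4)[OF that(2,1)] m_comm[of a x] that QE(1) by auto
  qed (use QE(4) prime_inD(3)[OF P] in auto)
  then show "Q \<in> Spec R" by (simp add: Spec_def)
qed

lemma subintegral_extension_iff:
  assumes "integral_extension U R"
  shows "subintegral_extension U R \<longleftrightarrow> subintegral_in U (carrier R)"
proof -
  have U: "subring U R" using assms by (simp add: integral_extension_def)
  have "residual_map R Q \<in> ring_iso (residue_field (R\<lparr>carrier := U\<rparr>) (Q \<inter> U)) (residue_field R Q) \<longleftrightarrow>
      (\<forall>x \<in> carrier R. \<exists>u \<in> U. \<exists>v \<in> U - Q. \<exists>q \<in> Q. v \<otimes> x = u \<oplus> q)" if "Q \<in> Spec R" for Q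
    using residual_map_iso_iff[OF U] that by (simp add: Spec_def)
  then show ?thesis
    unfolding subintegral_extension_def subintegral_in_def inj_on_def Ball_def[of "Spec R"]
    using assms Spec_iff_prime_in by auto
qed

lemma integral_extension_mono:
  assumes "integral_extension U R" "subring V R" "U \<subseteq> V"
  shows "integral_extension V R"
  using assms unfolding integral_extension_def by (meson order_trans)

lemma subintegral_in_refl:
  assumes Y: "subring Y R"
  shows "subintegral_in Y Y"
proof (rule subintegral_in_if_square[OF Y Y subset_refl, of "{\<zero>}"])
  show "ideal_in Y {\<zero>}" using subringE(1,2)[OF Y] by (auto simp: ideal_in_def)
  show "Y \<subseteq> sum_set Y {\<zero>}" by (rule subset_sum_set) (use subringE(1)[OF Y] in auto)
qed (use subringE(2)[OF Y] in auto)

lemma intermediate_rings_iff: "U \<in> intermediate_rings T R \<longleftrightarrow> subring U R \<and> T \<subseteq> U"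
  by (simp add: intermediate_rings_def)

section \<open>Catenarity and subintegrality\<close>

lemma covers_iff_maximal_subring:
  "(U, Y) \<in> covers (intermediate_rings T R) \<longleftrightarrow> T \<subseteq> U \<and> maximal_subring U Y"
proof
  assume "(U, Y) \<in> covers (intermediate_rings T R)"
  note cov = coversD[OF this]
  have "A = Y" if "subring A R" "U \<subset> A" "A \<subseteq> Y" for A
    using cov(4)[of A] cov(1) that by (auto simp: intermediate_rings_iff)
  then show "T \<subseteq> U \<and> maximal_subring U Y"
    using cov(1-3) by (auto simp: intermediate_rings_iff maximal_subring_def)
next
  assume "T \<subseteq> U \<and> maximal_subring U Y"
  then show "(U, Y) \<in> covers (intermediate_rings T R)"
    by (auto simp: covers_def intermediate_rings_iff maximal_subring_def)
qed

lemma FCP_bounded_finite_chains: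
  assumes "subring T R" "FCP T R"
  shows "bounded_finite_chains (intermediate_rings T R) T (carrier R)"
proof
  show "finite C" if "subset.chain (intermediate_rings T R) C" for C
    using assms(2) that by (simp add: FCP_def)
qed (use assms(1) subringE(1)[OF assms(1)] carrier_is_subring in
    \<open>auto simp: intermediate_rings_iff dest: subringE(1)\<close>)

lemma catenarian_iff_covers_pow:
  assumes "subring T R" "FCP T R"
  shows "catenarian T R \<longleftrightarrow>
    (\<forall>m n. (T, carrier R) \<in> covers (intermediate_rings T R) ^^ m \<longrightarrow>
      (T, carrier R) \<in> covers (intermediate_rings T R) ^^ n \<longrightarrow> m = n)"
  using bounded_finite_chains.maxchains_equicardinal_iff[OF FCP_bounded_finite_chains[OF assms]] assms(2)
  by (simp add: catenarian_def)

lemma subintegral_imp_catenarian: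
  assumes T: "subring T R" and fcp: "FCP T R" and int: "integral_extension T R"
    and sub: "subintegral_in T (carrier R)"
  shows "catenarian T R"
proof -
  let ?F = "intermediate_rings T R"
  interpret bounded_finite_chains ?F T "carrier R" using FCP_bounded_finite_chains[OF T fcp] .
  have simple: "\<exists>a\<in>V. \<exists>t\<in>T. y = a \<oplus> t \<otimes> x"
    if "T \<subseteq> V" "maximal_subring V Y" "x \<in> Y" "x \<notin> V" "y \<in> Y" for V Y x y
  proof -
    note Y = maximal_subringD(2)[OF that(2)]
    have TY: "T \<subseteq> Y" using that(1) maximal_subringD(3)[OF that(2)] by blast
    have YR: "Y \<subseteq> carrier R" using subringE(1)[OF Y] .
    have int': "integral_over T y" if "y \<in> carrier R" for y
      using integral_extension_imp_integral_over[OF int that] .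
    \<comment> \<open>Every intermediate ring \<open>Y\<close> inherits the hypothesis, so the
      modules \<open>Y / V\<close> are simple at all levels of the lattice and not only at its
      top.\<close>
    have "subintegral_in T Y"
      using subintegral_in_lower[OF T Y carrier_is_subring TY YR int' sub] .
    then show ?thesis
      using subintegral_maximal_simple[OF T that(1,2) _ _ that(3-5)] int' YR by blast
  qed
  have semimod: "(U \<inter> V, U) \<in> covers ?F \<and> (U \<inter> V, V) \<in> covers ?F"
    if "(U, Y) \<in> covers ?F" "(V, Y) \<in> covers ?F" "U \<noteq> V" for U V Y
  proof -
    have U: "T \<subseteq> U" "maximal_subring U Y" and V: "T \<subseteq> V" "maximal_subring V Y"
      using that by (simp_all add: covers_iff_maximal_subring)
    have "maximal_subring (U \<inter> V) U" "maximal_subring (V \<inter> U) V"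
      using maximal_subring_Int[OF _ U(2) V(2) that(3), of T] maximal_subring_Int[OF _ V(2) U(2) that(3)[symmetric], of T]
        simple[OF U] simple[OF V] U(1) V(1) by blast+
    then show ?thesis using U(1) V(1) by (simp add: covers_iff_maximal_subring Int_commute)
  qed
  show ?thesis
    unfolding catenarian_iff_covers_pow[OF T fcp]
    by (intro allI impI) (rule covers_pow_length_unique[OF semimod])
qed

text \<open>With \<open>W = U \<inter> V\<close> and \<open>n = h U - h W\<close>, the images
  \<open>A + Q\<close> of a path from \<open>W\<close> to \<open>U\<close> give
  \<open>h Y \<ge> h (W + Q) + n\<close>, and the ring of \<open>ramified_same_trace\<close> gives
  \<open>h (W + Q) \<ge> h W + 2\<close>. Together \<open>h Y \<ge> h U + 2\<close>, whereas
  \<open>U \<subset> Y\<close> is a single step.\<close>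

lemma rank_excludes_same_trace:
  assumes T: "subring T R" and fcp: "FCP T R"
    and h: "\<And>A B. (A, B) \<in> covers (intermediate_rings T R) \<Longrightarrow> h B = Suc (h A)"
    and TU: "T \<subseteq> U \<inter> V" and maxU: "maximal_subring U Y" and maxV: "maximal_subring V Y" and UV: "U \<noteq> V"
    and QU: "ramified_at U Y Q" and QV: "ramified_at V Y Q"
  shows "Q \<inter> U \<noteq> Q \<inter> V"
proof
  assume eq: "Q \<inter> U = Q \<inter> V"
  let ?F = "intermediate_rings T R" and ?W = "U \<inter> V"
  interpret bounded_finite_chains ?F T "carrier R" using FCP_bounded_finite_chains[OF T fcp] .
  have mono: "h A < h B" if "A \<in> ?F" "B \<in> ?F" "A \<subset> B" for A B
    using rank_strict_mono[of h A B] h that by blast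
  note U = maximal_subringD(1)[OF maxU] and V = maximal_subringD(1)[OF maxV] and Y = maximal_subringD(2)[OF maxU]
  note QI = ramified_atD(2)[OF QU]
  have UY: "U \<subseteq> Y" using maximal_subringD(3)[OF maxU] by blast
  have Qc: "Q \<subseteq> carrier R" using ideal_in_carrier[OF Y QI] .
  have W: "?W \<in> ?F" using subring_Int[OF U V] TU by (simp add: intermediate_rings_iff)
  have UF: "U \<in> ?F" using U TU by (simp add: intermediate_rings_iff)
  have sumF: "sum_set A Q \<in> ?F" if "A \<in> ?F" "A \<subseteq> U" for A
    using subring_sum_set_ideal(1,2)[OF _ Y _ QI, of A] that UY by (auto simp: intermediate_rings_iff)
  \<comment> \<open>Only an inequality for the images, since consecutive rings need not have
    consecutive images; each step raises their rank by at least one.\<close>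
  have step: "h (sum_set ?W Q) + n \<le> h (sum_set A Q) \<and> h A = h ?W + n"
    if "(?W, A) \<in> covers ?F ^^ n" "A \<subseteq> U" for n A
    using that
  proof (induction n arbitrary: A)
    case (Suc n)
    then obtain B where B: "(?W, B) \<in> covers ?F ^^ n" "(B, A) \<in> covers ?F" by auto
    note cov = coversD[OF B(2)]
    have BU: "B \<subseteq> U" using cov(3) Suc.prems(2) by blast
    have WB: "?W \<subseteq> B" using covers_pow_mem[OF B(1) W] by blast
    \<comment> \<open>All rings between \<open>W\<close> and \<open>U\<close> meet \<open>Q\<close>
      in the same set, because \<open>Q \<inter> U = Q \<inter> V\<close> already lies in
      \<open>W\<close>.\<close>
    have "Q \<inter> A \<subseteq> B" using Suc.prems(2) eq WB by blast
    then have "sum_set B Q \<subset> sum_set A Q"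
      using sum_set_strict_mono[OF _ _ cov(3) Qc ideal_inD(2)[OF QI]] cov(1,2)
      by (simp add: intermediate_rings_iff)
    then have "h (sum_set B Q) < h (sum_set A Q)"
      using mono sumF[OF cov(1) BU] sumF[OF cov(2) Suc.prems(2)] by blast
    then show ?case using Suc.IH[OF B(1) BU] h[OF B(2)] by simp
  qed simp
  obtain n where "(?W, U) \<in> covers ?F ^^ n" using exists_covers_pow[OF W UF] by blast
  then have 1: "h (sum_set ?W Q) + n \<le> h (sum_set U Q)" "h U = h ?W + n" using step by auto
  have "sum_set U Q = Y" using subring_sum_set_ideal(4)[OF U Y UY QI] ramified_atD(3)[OF QU] by blast
  moreover have "h Y = Suc (h U)" using h covers_iff_maximal_subring maxU TU by blast
  moreover obtain N where N: "subring N R" "?W \<subset> N" "N \<subset> sum_set ?W Q"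
    using ramified_same_trace[OF maxU maxV UV QU QV eq] by blast
  have NF: "N \<in> ?F" using N TU by (auto simp: intermediate_rings_iff)
  have "h ?W < h N" "h N < h (sum_set ?W Q)"
    using mono[OF W NF N(2)] mono[OF NF sumF[OF W Int_lower1] N(3)] by simp_all
  ultimately show False using 1 by simp
qed

text \<open>By FCP a subintegral extension decomposes into minimal subintegral ones, and
  compositions of these are subintegral again. So the claim becomes the confluence of the descending
  relation \<open>r\<close>, and the rank obtained from catenarity removes the one obstruction to
  its diamond property.\<close>

lemma catenarian_imp_subintegral_Int:
  assumes T: "subring T R" and cat: "catenarian T R" and int: "integral_extension T R"
    and U: "subring U R" "T \<subseteq> U" "subintegral_in U (carrier R)"
    and V: "subring V R" "T \<subseteq> V" "subintegral_in V (carrier R)"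
  shows "subintegral_in (U \<inter> V) (carrier R)"
proof -
  let ?F = "intermediate_rings T R"
  have fcp: "FCP T R" using cat by (simp add: catenarian_def)
  interpret bounded_finite_chains ?F T "carrier R" using FCP_bounded_finite_chains[OF T fcp] .
  obtain h :: "'a set \<Rightarrow> nat" where h: "\<And>A B. (A, B) \<in> covers ?F \<Longrightarrow> h B = Suc (h A)"
    using exists_rank catenarian_iff_covers_pow[OF T fcp] cat by metis
  have int': "integral_over A y" if "T \<subseteq> A" "y \<in> carrier R" for A y
    using integral_over_mono[OF that(1) integral_extension_imp_integral_over[OF int that(2)]] .
  define r where "r = {(Y, A). T \<subseteq> A \<and> maximal_subring A Y \<and> subintegral_in A Y}"
  have r_sub: "A \<subset> Y" if "(Y, A) \<in> r" for Y A
    using that maximal_subringD(3) by (auto simp: r_def)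
  have r_ram: "\<exists>Q. ramified_at A Y Q" if "(Y, A) \<in> r" for Y A
  proof -
    have A: "T \<subseteq> A" "maximal_subring A Y" "subintegral_in A Y" using that by (auto simp: r_def)
    have "Y \<subseteq> carrier R" using subringE(1)[OF maximal_subringD(2)[OF A(2)]] .
    then show ?thesis using exists_ramified_at[OF A(2) int'[OF A(1)] A(3)] by blast
  qed
  have diamond: "(A, A \<inter> B) \<in> r\<^sup>= \<and> (B, A \<inter> B) \<in> r\<^sup>=" if AB: "(Y, A) \<in> r" "(Y, B) \<in> r" for Y A B
  proof (cases "A = B")
    case False
    have A: "T \<subseteq> A" "maximal_subring A Y" and B: "T \<subseteq> B" "maximal_subring B Y"
      using AB by (auto simp: r_def)
    obtain P where P: "ramified_at A Y P" using r_ram[OF AB(1)] by blast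
    obtain Q where Q: "ramified_at B Y Q" using r_ram[OF AB(2)] by blast
    have TW: "T \<subseteq> A \<inter> B" using A B by blast
    have "Q \<inter> A \<noteq> Q \<inter> B" if "P = Q"
      by (rule rank_excludes_same_trace[where h = h, OF T fcp _ TW A(2) B(2) False])
        (use h P Q that in auto)
    then show ?thesis using ramified_diamond[OF A(2) B(2) P Q] TW by (auto simp: r_def)
  qed simp
  have path: "(Y, A) \<in> r\<^sup>*"
    if A: "subring A R" "T \<subseteq> A" and Y: "subring Y R" "A \<subseteq> Y" and sub: "subintegral_in A Y" for A Y
  proof -
    have AF: "A \<in> ?F" and YF: "Y \<in> ?F" using A Y by (auto simp: intermediate_rings_iff)
    obtain n where "(A, Y) \<in> covers ?F ^^ n" using exists_covers_pow[OF AF YF Y(2)] by blast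
    then show ?thesis using Y(1) sub
    proof (induction n arbitrary: Y)
      case 0
      then show ?case by simp
    next
      case (Suc n)
      then obtain C where C: "(A, C) \<in> covers ?F ^^ n" "(C, Y) \<in> covers ?F" by auto
      have CA: "A \<subseteq> C" using covers_pow_mem[OF C(1) AF] by blast
      have C': "T \<subseteq> C" "maximal_subring C Y" using C(2) by (auto simp: covers_iff_maximal_subring)
      note Cr = maximal_subringD(1)[OF C'(2)]
      have CY: "C \<subseteq> Y" using maximal_subringD(3)[OF C'(2)] by blast
      have "subintegral_in A C"
        using subintegral_in_lower[OF A(1) Cr Suc.prems(2) CA CY _ Suc.prems(3)] int'[OF A(2)]
          subringE(1)[OF Suc.prems(2)] by blast
      then have "(C, A) \<in> r\<^sup>*" using Suc.IH[OF C(1) Cr] by blast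
      moreover have "(Y, C) \<in> r"
        using C' subintegral_in_upper[OF CA CY Suc.prems(3)] by (simp add: r_def)
      ultimately show ?case by (rule converse_rtrancl_into_rtrancl[rotated])
    qed
  qed
  have sound: "subring A R \<and> A \<subseteq> Y \<and> subintegral_in A Y" if "(Y, A) \<in> r\<^sup>*" "subring Y R" for Y A
    using that(1)
  proof (induction rule: rtrancl_induct)
    case base
    then show ?case using subintegral_in_refl that(2) by simp
  next
    case (step B A)
    have A: "maximal_subring A B" "subintegral_in A B" using step.hyps(2) by (auto simp: r_def)
    note AB = maximal_subringD[OF A(1)]
    have "A \<subseteq> B" using AB(3) by blast
    then show ?case
      using subintegral_in_trans[OF AB(1,2) that(2) _ _ A(2)] step.IH AB(1) by blast
  qed
  note S = carrier_is_subring
  have pU: "(carrier R, U) \<in> r\<^sup>*" using path[OF U(1,2) S subringE(1)[OF U(1)] U(3)] .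
  have pV: "(carrier R, V) \<in> r\<^sup>*" using path[OF V(1,2) S subringE(1)[OF V(1)] V(3)] .
  have "(U, U \<inter> V) \<in> r\<^sup>*" using Int_confluence[OF r_sub diamond pU pV] .
  then have "(carrier R, U \<inter> V) \<in> r\<^sup>*" using pU by (rule rtrancl_trans[rotated])
  then show ?thesis using sound S by blast
qed

end

theorem theorem6p15:
  fixes S :: "('a, 'b) ring_scheme" and R T :: "'a set"
  assumes "cring S" and "subring R S" and "R \<subset> carrier S"
    and "integral_extension R S" and "FCP R S"
    and "T = \<Inter>{U \<in> intermediate_rings R S. subintegral_extension U S}"
  shows "((\<exists>V. is_cosubintegral_closure V R S) \<longleftrightarrow> subintegral_extension T S) \<and>
    (subintegral_extension T S \<longleftrightarrow> catenarian T S) \<and>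
    ((\<exists>V. is_cosubintegral_closure V R S) \<longrightarrow> is_cosubintegral_closure T R S)"
proof -
  interpret S: cring S by fact
  let ?G = "{U \<in> intermediate_rings R S. subintegral_extension U S}"
  have int: "integral_extension U S" if "U \<in> intermediate_rings R S" for U
    using S.integral_extension_mono[OF assms(4)] that by (auto simp: intermediate_rings_def)
  have sub_iff: "subintegral_extension U S \<longleftrightarrow> S.subintegral_in U (carrier S)"
    if "U \<in> intermediate_rings R S" for U
    using S.subintegral_extension_iff[OF int[OF that]] .
  have SF: "carrier S \<in> intermediate_rings R S"
    using S.carrier_is_subring assms(3) by (auto simp: intermediate_rings_def)
  \<comment> \<open>The intersection defining \<open>T\<close> thus ranges over a nonempty family
    and stays inside \<open>carrier S\<close>; over an empty one it would be
    \<open>UNIV\<close>.\<close>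
  then have SG: "carrier S \<in> ?G"
    using sub_iff S.subintegral_in_refl[OF S.carrier_is_subring] by simp
  have T: "subring T S"
  proof (rule S.subringI)
    show "T \<subseteq> carrier S" using SG assms(6) by blast
  qed (auto simp: assms(6) intermediate_rings_def dest: subringE)
  have RT: "R \<subseteq> T" by (auto simp: assms(6) intermediate_rings_def)
  have TF: "T \<in> intermediate_rings R S" using T RT by (simp add: intermediate_rings_def)
  have fcp: "FCP T S"
    unfolding FCP_def
  proof (intro allI impI)
    fix C assume "subset.chain (intermediate_rings T S) C"
    then have "subset.chain (intermediate_rings R S) C"
      using RT by (auto simp: subset_chain_def intermediate_rings_def)
    then show "finite C" using assms(5) by (simp add: FCP_def)
  qed
  have le: "T \<subseteq> U" if "U \<in> ?G" for U using that assms(6) by blast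
  have closure: "is_cosubintegral_closure T R S" if "subintegral_extension T S"
    using that TF le by (auto simp: is_cosubintegral_closure_def)
  \<comment> \<open>A closure is a member of the family and lies in all members, so it equals their
    intersection.\<close>
  have 1: "subintegral_extension T S" if V: "is_cosubintegral_closure V R S" for V
  proof -
    have "V \<in> ?G" and "\<And>U. U \<in> ?G \<Longrightarrow> V \<subseteq> U" using V by (auto simp: is_cosubintegral_closure_def)
    then have "V = T" using le[of V] assms(6) by blast
    then show ?thesis using V by (simp add: is_cosubintegral_closure_def)
  qed
  have 2: "catenarian T S" if "subintegral_extension T S"
    using S.subintegral_imp_catenarian[OF T fcp int[OF TF]] that sub_iff[OF TF] by blast
  have 3: "subintegral_extension T S" if cat: "catenarian T S"
  proof -
    interpret finite_chains "intermediate_rings R S"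
      using assms(5) by unfold_locales (simp add: FCP_def)
    have "?G \<subseteq> intermediate_rings R S" "?G \<noteq> {}" using SG by auto
    then obtain M where M: "M \<in> ?G" and min: "\<forall>A\<in>?G. \<not> A \<subset> M" using exists_minimal by meson
    have "M \<subseteq> U" if U: "U \<in> ?G" for U
    proof -
      have k: "subring M S" "subring U S" "M \<in> intermediate_rings R S" "U \<in> intermediate_rings R S"
        "S.subintegral_in M (carrier S)" "S.subintegral_in U (carrier S)"
        using M U sub_iff by (auto simp: intermediate_rings_def)
      have "S.subintegral_in (M \<inter> U) (carrier S)"
        using S.catenarian_imp_subintegral_Int[OF T cat int[OF TF] k(1) le[OF M] k(5) k(2) le[OF U] k(6)] .
      moreover have "M \<inter> U \<in> intermediate_rings R S"
        using k S.subring_Int[OF k(1,2)] by (auto simp: intermediate_rings_def)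
      ultimately have "M \<inter> U \<in> ?G" using sub_iff by blast
      then show ?thesis using min by blast
    qed
    then have "M = T" using le[OF M] assms(6) by blast
    then show ?thesis using M by blast
  qed
  show ?thesis using closure 1 2 3 by blast
qed

end
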